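(* Let $\Gamma\subset\mathbb{C}$ be a closed Jordan curve and let $f$ be a conformal map of the unit disc $\mathbb{D}$ onto the interior domain of $\Gamma$, extended to a homeomorphism of $\overline{\mathbb{D}}$ onto the closure of that domain. For an arc $I\subset\mathbb{T}$ with endpoints $z_1\neq z_2$, put $w_i=f(z_i)$, $i=1,2$, and $$\Delta(I)=\frac{\ell_\Gamma(w_1,w_2)-|w_1-w_2|}{|w_1-w_2|}.$$ (i) Let $0<p<1$. If $\Gamma$ is a $Q_{p,0}$-curve, i.e. $\log f'\in Q_{p,0}$, then for dyadic arcs $J\subset\mathbb{T}$, $$\frac{1}{|J|^p}\sum_{I}\Delta(I)\,|I|^p\to0\quad\text{as }|J|\to0,$$ where the sum is over all dyadic intervals $I\subset J$. (ii) Let $p\ge0$. If $\Gamma$ is a $\mathcal{D}_{\log_p}$-curve, i.e. $\log f'\in\mathcal{D}_{\log_p}$, then $$\sum_{I}\Delta(I)\left(\log\frac{1}{|I|}\right)^p<\infty,$$ where the sum is over all dyadic intervals $I$ in $\mathbb{T}$.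
   Context: $\mathbb{D}$ is the open unit disc in $\mathbb{C}$, $\mathbb{T}=\partial\mathbb{D}$, and $dA$ is area (Lebesgue) measure. $\log f'$ denotes a holomorphic branch on $\mathbb{D}$ of the logarithm of $f'$. For distinct $w_1,w_2\in\Gamma$, $\Gamma(w_1,w_2)$ denotes the subarc of $\Gamma$ joining $w_1$ and $w_2$ with smaller diameter, and $\ell_\Gamma(w_1,w_2)$ is the length of $\Gamma(w_1,w_2)$. Dyadic intervals (arcs) of $\mathbb{T}$ are the arcs $\{e^{2\pi i\theta}: k2^{-n}\le\theta\le(k+1)2^{-n}\}$ with $n\ge1$ and $0\le k<2^n$; $|I|$ denotes the length of an arc, normalized so that $|\mathbb{T}|=1$. The limit as $|J|\to0$ is uniform over all dyadic arcs $J$ (the supremum over dyadic $J$ with $|J|\le\delta$ tends to $0$ as $\delta\to0$). For an arc $I\subset\mathbb{T}$, the Carleson box is $Q_I=\{z\in\mathbb{D}:1-|I|\le|z|<1,\ z/|z|\in I\}$. For $p>0$, an analytic function $g$ on $\mathbb{D}$ belongs to $Q_{p,0}$ if $$\lim_{|I|\to0}\frac{1}{|I|^p}\int_{Q_I}|g'(z)|^2(1-|z|^2)^p\,dA(z)=0,$$ the limit being uniform over all arcs $I\subset\mathbb{T}$. For $p\ge0$, an analytic function $g$ on $\mathbb{D}$ belongs to $\mathcal{D}_{\log_p}$ if $$\int_{\mathbb{D}}|g'(z)|^2\left(\log\frac{1}{1-|z|}\right)^p dA(z)<\infty .$$ When $p=0$, $p$-th powers of logarithms are understood to be identically $1$.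 *)

theory Defs
  imports "HOL-Analysis.Analysis"
begin

definition closed_jordan_curve :: "complex set \<Rightarrow> bool" where
  "closed_jordan_curve \<Gamma> \<longleftrightarrow>
     (\<exists>\<gamma>. simple_path \<gamma> \<and> pathfinish \<gamma> = pathstart \<gamma> \<and> path_image \<gamma> = \<Gamma>)"

text \<open>The values of \<open>f\<close> on the closed unit disc are those of the homeomorphic extension.\<close>

definition conformal_onto_inside :: "(complex \<Rightarrow> complex) \<Rightarrow> complex set \<Rightarrow> bool" where
  "conformal_onto_inside f \<Gamma> \<longleftrightarrow>
     f holomorphic_on ball 0 1 \<and> inj_on f (ball 0 1) \<and> f ` ball 0 1 = inside \<Gamma> \<and>
     (\<exists>g. homeomorphism (cball 0 1) (closure (inside \<Gamma>)) f g)"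

definition log_deriv_branch :: "(complex \<Rightarrow> complex) \<Rightarrow> (complex \<Rightarrow> complex) \<Rightarrow> bool" where
  "log_deriv_branch f h \<longleftrightarrow>
     h holomorphic_on ball 0 1 \<and> (\<forall>z\<in>ball 0 1. exp (h z) = deriv f z)"


text \<open>An arc of the unit circle is given by its endpoints in the parameter \<open>\<theta>\<close>, where
  \<open>a < b \<le> a + 1\<close>; its normalized length is \<open>b - a\<close>.\<close>

definition circle_arc :: "real \<Rightarrow> real \<Rightarrow> complex set" where
  "circle_arc a b = (\<lambda>\<theta>. cis (2 * pi * \<theta>)) ` {a..b}"

definition carleson_box :: "real \<Rightarrow> real \<Rightarrow> complex set" where
  "carleson_box a b =
     {z. 1 - (b - a) \<le> norm z \<and> norm z < 1 \<and> z / of_real (norm z) \<in> circle_arc a b}"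

definition Q_p0 :: "real \<Rightarrow> (complex \<Rightarrow> complex) set" where
  "Q_p0 p = {g. g holomorphic_on ball 0 1 \<and>
     ((\<lambda>\<delta>. SUP (a, b)\<in>{(a, b). a < b \<and> b - a \<le> 1 \<and> b - a \<le> \<delta>}.
         ennreal (1 / (b - a) powr p) *
         (\<integral>\<^sup>+ z\<in>carleson_box a b.
            ennreal ((norm (deriv g z))\<^sup>2 * (1 - (norm z)\<^sup>2) powr p) \<partial>lborel))
       \<longlongrightarrow> 0) (at_right 0)}"

text \<open>\<open>0 powr 0 = 0\<close>, whereas the zeroth power is meant to be identically 1.\<close>

definition log_power :: "real \<Rightarrow> real \<Rightarrow> real" where
  "log_power p x = (if p = 0 then 1 else ln x powr p)"

definition D_log :: "real \<Rightarrow> (complex \<Rightarrow> complex) set" where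
  "D_log p = {g. g holomorphic_on ball 0 1 \<and>
     (\<integral>\<^sup>+ z\<in>ball 0 1.
        ennreal ((norm (deriv g z))\<^sup>2 * log_power p (1 / (1 - norm z))) \<partial>lborel) < \<infinity>}"


definition path_length :: "(real \<Rightarrow> complex) \<Rightarrow> ennreal" where
  "path_length g =
     (SUP (N, t)\<in>{(N :: nat, t). mono_on {..N} t \<and> t ` {..N} \<subseteq> {0..1}}.
        \<Sum>i<N. ennreal (dist (g (t i)) (g (t (Suc i)))))"

definition joining_subarc ::
    "complex set \<Rightarrow> complex \<Rightarrow> complex \<Rightarrow> (real \<Rightarrow> complex) \<Rightarrow> bool" where
  "joining_subarc \<Gamma> w\<^sub>1 w\<^sub>2 g \<longleftrightarrow>
     arc g \<and> path_image g \<subseteq> \<Gamma> \<and> pathstart g = w\<^sub>1 \<and> pathfinish g = w\<^sub>2"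

definition smaller_subarc ::
    "complex set \<Rightarrow> complex \<Rightarrow> complex \<Rightarrow> (real \<Rightarrow> complex) \<Rightarrow> bool" where
  "smaller_subarc \<Gamma> w\<^sub>1 w\<^sub>2 g \<longleftrightarrow>
     joining_subarc \<Gamma> w\<^sub>1 w\<^sub>2 g \<and>
     (\<forall>h. joining_subarc \<Gamma> w\<^sub>1 w\<^sub>2 h \<longrightarrow> diameter (path_image g) \<le> diameter (path_image h))"

text \<open>All parametrizations of an arc have the same length, so the supremum only matters if the two
  subarcs joining \<open>w\<^sub>1\<close> and \<open>w\<^sub>2\<close> have equal diameters; then the longer one is taken.\<close>

definition subarc_length :: "complex set \<Rightarrow> complex \<Rightarrow> complex \<Rightarrow> ennreal" where
  "subarc_length \<Gamma> w\<^sub>1 w\<^sub>2 = (SUP g\<in>{g. smaller_subarc \<Gamma> w\<^sub>1 w\<^sub>2 g}. path_length g)"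

definition Delta :: "complex set \<Rightarrow> (complex \<Rightarrow> complex) \<Rightarrow> real \<Rightarrow> real \<Rightarrow> ennreal" where
  "Delta \<Gamma> f a b =
     (let w\<^sub>1 = f (cis (2 * pi * a)); w\<^sub>2 = f (cis (2 * pi * b))
      in (subarc_length \<Gamma> w\<^sub>1 w\<^sub>2 - ennreal (dist w\<^sub>1 w\<^sub>2)) / ennreal (dist w\<^sub>1 w\<^sub>2))"


text \<open>Dyadic arcs are indexed by pairs \<open>(n, k)\<close>; distinct indices give distinct arcs.\<close>

definition dyadic_indices :: "(nat \<times> nat) set" where
  "dyadic_indices = {(n, k). n \<ge> 1 \<and> k < 2 ^ n}"

definition dyadic_arc :: "nat \<times> nat \<Rightarrow> complex set" where
  "dyadic_arc = (\<lambda>(n, k). circle_arc (real k / 2 ^ n) (real (k + 1) / 2 ^ n))"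

definition dyadic_length :: "nat \<times> nat \<Rightarrow> real" where
  "dyadic_length = (\<lambda>(n, k). 1 / 2 ^ n)"

definition dyadic_Delta :: "complex set \<Rightarrow> (complex \<Rightarrow> complex) \<Rightarrow> nat \<times> nat \<Rightarrow> ennreal" where
  "dyadic_Delta \<Gamma> f = (\<lambda>(n, k). Delta \<Gamma> f (real k / 2 ^ n) (real (k + 1) / 2 ^ n))"

end

(*
  The excess length of f(I) over its chord telescopes along the dyadic subarcs J of I: replacing a
  chord c by the two half chords a, b costs |a| + |b| - |a + b| <= (|a - b| / |a + b|)^2 |a + b|, so
  with bend(J) = |a - b| / |a + b| and chord(J) <= q^(n_J - n_I) chord(I), where q is close to 1/2,
    Delta(I) <= sum over J in I of q^(n_J - n_I) bend(J)^2.
  Both conditions on h = log f' make (1 - |z|) |h'(z)| small near the circle. A Taylor expansion of f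
  at the apex of the Carleson box over J along the segments to the endpoints and the midpoint of J
  therefore shows that bend(J) is small and, since f'' = h' f' and f' varies slowly, that bend(J)^2
  is at most C |J|^2 plus an integral of |h'|^2 over a cone below J, in which a point w has
  weight (1 - |w|) / |J|. Since p < 1 (or the weight is logarithmic), summing over all J is a geometric
  sum, and what remains is the integral of |h'|^2 in the hypothesis.
*)

theory Submission
  imports Defs "HOL-Complex_Analysis.Complex_Analysis" "HOL-Real_Asymp.Real_Asymp"
begin

text \<open>No rectifiability is assumed, so \<open>Delta\<close> may a priori be infinite;
  estimates are made in \<open>ennreal\<close> and lengths enter only as upper bounds for polygons.
  A second obstacle is that \<open>Delta\<close> refers to the subarc of smaller diameter, which is
  the image of the dyadic arc only when that arc is short. In (i) only short arcs matter; in (ii)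
  the finitely many others get a finite \<open>Delta\<close> because the whole curve turns out to
  have finite length. The excess must be quadratic in the bend because only the square of h' is
  integrable; the parallelogram law supplies this. A point w at height t = 1 - |w| is seen by
  boundedly many arcs of each generation n, with weight about t 2^n, and by none once 2^(-n) is far
  below t. For wt n = 2^(-n p) the total weight is a geometric sum dominated by its last term
  because 2^p < 2, which leaves t^p. Passing from bends to \<open>Delta\<close> costs a convolution
  with q^l, harmless if 2^p q < 1; as 2^p < 2 this only asks for q close to 1/2, that is, for small
  bends, and these come from the decay of (1 - |z|) |h'(z)|.\<close>

section \<open>A mean value inequality on squares\<close>

text \<open>Both measures agree on boxes, and that determines Lebesgue measure. Plane integrals thus
  become iterated integrals along lines, which is how the sides of squares will sweep out
  area.\<close>

lemma lborel_complex_eq: "distr (lborel \<Otimes>\<^sub>M lborel) borel (\<lambda>(x, y). Complex x y) = lborel"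
proof (rule lborel_eqI[symmetric])
  have m [measurable]: "(\<lambda>(x, y). Complex x y) \<in> borel_measurable (lborel \<Otimes>\<^sub>M lborel)"
  proof -
    have "continuous_on UNIV (\<lambda>p. Complex (fst p) (snd p))"
      by (auto simp: Complex_eq intro!: continuous_intros)
    then show ?thesis
      unfolding lborel_prod by (auto simp: case_prod_beta' intro: borel_measurable_continuous_onI)
  qed
  fix l u :: complex
  assume le: "\<And>b. b \<in> Basis \<Longrightarrow> l \<bullet> b \<le> u \<bullet> b"
  have *: "Re l \<le> Re u" "Im l \<le> Im u"
    using le[of 1] le[of \<i>] by (auto simp: Basis_complex_def inner_complex_def)
  have "(\<lambda>(x, y). Complex x y) -` box l u \<inter> space (lborel \<Otimes>\<^sub>M lborel)
      = {Re l<..<Re u} \<times> {Im l<..<Im u}"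
    by (auto simp: in_box_complex_iff space_pair_measure)
  then have "emeasure (distr (lborel \<Otimes>\<^sub>M lborel) borel (\<lambda>(x, y). Complex x y)) (box l u)
      = emeasure (lborel \<Otimes>\<^sub>M lborel) ({Re l<..<Re u} \<times> {Im l<..<Im u})"
    by (subst emeasure_distr) auto
  also have "\<dots> = ennreal (Re u - Re l) * ennreal (Im u - Im l)"
    using * by (subst lborel.emeasure_pair_measure_Times) auto
  finally show "emeasure (distr (lborel \<Otimes>\<^sub>M lborel) borel (\<lambda>(x, y). Complex x y)) (box l u)
      = ennreal (\<Prod>b\<in>Basis. (u - l) \<bullet> b)"
    using * by (simp add: Basis_complex_def inner_complex_def ennreal_mult)
qed simp

lemma measurable_Complex [measurable (raw)]:
  assumes "f \<in> borel_measurable M" "g \<in> borel_measurable M"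
  shows "(\<lambda>x. Complex (f x) (g x)) \<in> borel_measurable M"
  unfolding Complex_eq using assms by measurable

lemma nn_integral_complex:
  assumes [measurable]: "F \<in> borel_measurable borel"
  shows "(\<integral>\<^sup>+ w. F w \<partial>lborel) = (\<integral>\<^sup>+ x. \<integral>\<^sup>+ y. F (Complex x y) \<partial>lborel \<partial>lborel)"
proof -
  have "(\<integral>\<^sup>+ w. F w \<partial>lborel) = (\<integral>\<^sup>+ p. F (case p of (x, y) \<Rightarrow> Complex x y) \<partial>(lborel \<Otimes>\<^sub>M lborel))"
    by (subst lborel_complex_eq[symmetric], subst nn_integral_distr) (simp_all add: case_prod_beta')
  also have "\<dots> = (\<integral>\<^sup>+ x. \<integral>\<^sup>+ y. F (Complex x y) \<partial>lborel \<partial>lborel)"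
    by (subst lborel.nn_integral_fst[symmetric]) (simp_all add: case_prod_beta')
  finally show ?thesis .
qed

text \<open>Multiplication by \<open>\<i>\<close> swaps the coordinates and reflects one of them;
  the reflection leaves integrals over a line alone and the swap is Tonelli's theorem.\<close>

lemma nn_integral_complex_rotate:
  assumes [measurable]: "F \<in> borel_measurable borel"
  shows "(\<integral>\<^sup>+ w. F (\<i> * w) \<partial>lborel) = (\<integral>\<^sup>+ w. F w \<partial>lborel)"
proof -
  have "(\<integral>\<^sup>+ w. F (\<i> * w) \<partial>lborel) = (\<integral>\<^sup>+ x. \<integral>\<^sup>+ y. F (Complex (- y) x) \<partial>lborel \<partial>lborel)"
    by (subst nn_integral_complex) (auto intro!: nn_integral_cong arg_cong[of _ _ F] simp: complex_eq_iff)
  also have "\<dots> = (\<integral>\<^sup>+ x. \<integral>\<^sup>+ y. F (Complex y x) \<partial>lborel \<partial>lborel)"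
  proof (rule nn_integral_cong)
    fix x :: real
    show "(\<integral>\<^sup>+ y. F (Complex (- y) x) \<partial>lborel) = (\<integral>\<^sup>+ y. F (Complex y x) \<partial>lborel)"
      by (subst (2) nn_integral_real_affine[of _ "-1" 0]) simp_all
  qed
  also have "\<dots> = (\<integral>\<^sup>+ y. \<integral>\<^sup>+ x. F (Complex y x) \<partial>lborel \<partial>lborel)"
    by (rule lborel_pair.Fubini') (simp add: case_prod_beta')
  also have "\<dots> = (\<integral>\<^sup>+ w. F w \<partial>lborel)"
    by (rule nn_integral_complex[symmetric]) simp
  finally show ?thesis .
qed

text \<open>In the frames rotated by \<open>\<i> ^ k\<close> all four sides of a square look like its right side.\<close>

lemma nn_integral_complex_frame:
  fixes F :: "complex \<Rightarrow> ennreal"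
  assumes [measurable]: "F \<in> borel_measurable borel"
  shows "(\<integral>\<^sup>+ x. \<integral>\<^sup>+ y. F (z + \<i> ^ k * Complex x y) \<partial>lborel \<partial>lborel) = (\<integral>\<^sup>+ w. F w \<partial>lborel)"
proof -
  have "(\<integral>\<^sup>+ w. F (z + \<i> ^ k * w) \<partial>lborel) = (\<integral>\<^sup>+ w. F (z + w) \<partial>lborel)"
  proof (induction k)
    case (Suc k)
    then show ?case
      using nn_integral_complex_rotate[of "\<lambda>w. F (z + \<i> ^ k * w)"] by (simp add: mult_ac)
  qed simp
  also have "\<dots> = (\<integral>\<^sup>+ w. F w \<partial>distr lborel borel ((+) z))"
    by (subst nn_integral_distr) simp_all
  finally show ?thesis
    by (subst nn_integral_complex[symmetric]) (simp_all add: lborel_distr_plus)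
qed

text \<open>Meant for one side of a square, with \<open>u\<close> its unit direction and
  \<open>t\<close> half its length. The bound extends over the whole line containing the side, so
  that integrating it over parallel lines gives a plane integral.\<close>

lemma norm_contour_integral_linepath_le:
  fixes g :: "complex \<Rightarrow> complex" and F :: "complex \<Rightarrow> ennreal" and t :: real
  assumes F [measurable]: "F \<in> borel_measurable borel"
    and I: "(g has_contour_integral I) (linepath (c - of_real t * u) (c + of_real t * u))" and t: "t > 0" and u: "norm u = 1"
    and cont: "continuous_on (closed_segment (c - of_real t * u) (c + of_real t * u)) g"
    and gF: "\<And>y. \<bar>y\<bar> \<le> t \<Longrightarrow> ennreal (norm (g (c + of_real y * u))) \<le> F (c + of_real y * u)"
  shows "ennreal (norm I) \<le> (\<integral>\<^sup>+ y. F (c + of_real y * u) \<partial>lborel)"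
proof -
  define \<phi> where "\<phi> s = linepath (c - of_real t * u) (c + of_real t * u) s" for s :: real
  have \<phi>: "\<phi> s = c + of_real (t * (2 * s - 1)) * u" for s :: real
    by (simp add: \<phi>_def linepath_def scaleR_conv_of_real algebra_simps)
  have "continuous_on {0..1} (\<lambda>s. g (\<phi> s))"
    unfolding \<phi>_def
    by (rule continuous_on_compose2[OF cont]) (auto simp: linepath_in_path intro!: continuous_intros)
  then have "continuous_on {0..1} (\<lambda>s. norm (g (\<phi> s)) * (2 * t))"
    by (intro continuous_intros)
  then obtain J where J: "((\<lambda>s. norm (g (\<phi> s)) * (2 * t)) has_integral J) {0..1}"
    using integrable_continuous_interval unfolding integrable_on_def by blast
  have I': "((\<lambda>s. g (\<phi> s) * (of_real (2 * t) * u)) has_integral I) {0..1}"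
    using I by (simp add: has_contour_integral_linepath \<phi>_def algebra_simps)
  have "norm I \<le> J"
    unfolding integral_unique[OF I', symmetric] integral_unique[OF J, symmetric]
    using I' J t u by (intro integral_norm_bound_integral) (auto simp: norm_mult)
  then have "ennreal (norm I) \<le> ennreal J" by (rule ennreal_leI)
  also have "\<dots> = (\<integral>\<^sup>+ s. ennreal (norm (g (\<phi> s)) * (2 * t)) * indicator {0..1} s \<partial>lborel)"
    using t J by (intro nn_integral_has_integral_lebesgue'[symmetric]) auto
  also have "\<dots> \<le> (\<integral>\<^sup>+ s. (2 * t) * F (c + of_real (- t + (2 * t) * s) * u) \<partial>lborel)"
  proof (rule nn_integral_mono)
    fix s :: real
    show "ennreal (norm (g (\<phi> s)) * (2 * t)) * indicator {0..1} s \<le> ennreal (2 * t) * F (c + of_real (- t + (2 * t) * s) * u)"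
    proof (cases "s \<in> {0..1}")
      case True
      have "\<bar>t * (2 * s - 1)\<bar> \<le> t * 1"
        unfolding abs_mult using True t by (intro mult_mono) auto
      then have "ennreal (norm (g (\<phi> s))) \<le> F (\<phi> s)"
        unfolding \<phi> by (intro gF) auto
      moreover have "c + of_real (- t + (2 * t) * s) * u = \<phi> s"
        by (simp add: \<phi> algebra_simps)
      ultimately show ?thesis
        using True t by (auto simp: ennreal_mult mult.commute intro!: mult_right_mono)
    qed auto
  qed
  also have "\<dots> = (\<integral>\<^sup>+ y. F (c + of_real y * u) \<partial>lborel)"
    using t nn_integral_real_affine[of "\<lambda>y. F (c + of_real y * u)" "2 * t" "- t"]
    by (simp add: nn_integral_cmult)
  finally show ?thesis .
qed

text \<open>Cauchy's formula on the boundaries of the squares with half side \<open>t\<close>, averaged over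
  \<open>t \<in> (r/2, r)\<close>. Squares make Fubini's theorem applicable without polar coordinates.\<close>

lemma norm_holomorphic_le_integral:
  fixes g :: "complex \<Rightarrow> complex"
  assumes hol: "g holomorphic_on ball z (2 * r)" and r: "r > 0"
  shows "ennreal (norm (g z)) \<le> ennreal (4 / r\<^sup>2) * (\<integral>\<^sup>+ w\<in>ball z (2 * r). ennreal (norm (g w)) \<partial>lborel)"
proof -
  define F where "F w = ennreal (norm (g w)) * indicator (ball z (2 * r)) w" for w
  have cg: "continuous_on (ball z (2 * r)) g"
    by (rule holomorphic_on_imp_continuous_on[OF hol])
  have "(\<lambda>w. indicator (ball z (2 * r)) w *\<^sub>R norm (g w)) \<in> borel_measurable borel"
    by (rule borel_measurable_continuous_on_indicator) (auto intro!: continuous_intros cg)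
  then have "(\<lambda>w. ennreal (indicator (ball z (2 * r)) w *\<^sub>R norm (g w))) \<in> borel_measurable borel"
    by measurable
  also have "(\<lambda>w. ennreal (indicator (ball z (2 * r)) w *\<^sub>R norm (g w))) = F"
    by (auto simp: F_def fun_eq_iff split: split_indicator)
  finally have F [measurable]: "F \<in> borel_measurable borel" .
  \<comment> \<open>A point on a side of the square of half side \<open>t\<close> has distance
    between \<open>t\<close> and \<open>2 * t\<close> from the centre; hence the ball of radius
    \<open>2 * r\<close> in the statement.\<close>
  have dist_frame: "dist z (z + \<i> ^ k * Complex t y) < 2 * r \<and> t \<le> dist z (z + \<i> ^ k * Complex t y)"
    if "0 < t" "t < r" "\<bar>y\<bar> \<le> t" for t y k
  proof -
    have "norm (Complex t y) \<le> \<bar>t\<bar> + \<bar>y\<bar>" "\<bar>t\<bar> \<le> norm (Complex t y)"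
      using cmod_le[of "Complex t y"] abs_Re_le_cmod[of "Complex t y"] by auto
    then show ?thesis using that by (auto simp: dist_norm norm_mult norm_power)
  qed
  have main: "ennreal (2 * pi * t * norm (g z)) \<le> (\<Sum>k<4. \<integral>\<^sup>+ y. F (z + \<i> ^ k * Complex t y) \<partial>lborel)"
    if t: "0 < t" "t < r" for t
  proof -
    define G where "G w = g w / (w - z)" for w
    define s where "s k = linepath (z + \<i> ^ k * of_real t - of_real t * \<i> ^ Suc k) (z + \<i> ^ k * of_real t + of_real t * \<i> ^ Suc k)" for k :: nat
    define P where "P = rectpath (z - Complex t t) (z + Complex t t)"
    \<comment> \<open>\<open>rectpath\<close> starts at the lower left corner with the bottom side,
      which lies in the direction \<open>\<i> ^ 3\<close> from the centre.\<close>
    have P: "P = s 3 +++ s 0 +++ s 1 +++ s 2"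
      by (auto simp: P_def rectpath_def Let_def s_def complex_eq_iff eval_nat_numeral
          intro!: arg_cong2[of _ _ _ _ "(+++)"] arg_cong2[of _ _ _ _ linepath])
    have img: "path_image P = cbox (z - Complex t t) (z + Complex t t) - box (z - Complex t t) (z + Complex t t)"
      unfolding P_def using t by (intro path_image_rectpath_cbox_minus_box) auto
    have frame: "\<exists>k y. \<bar>y\<bar> \<le> t \<and> w = z + \<i> ^ k * Complex t y" if "w \<in> path_image (s k)" for w k
    proof -
      obtain x where x: "0 \<le> x" "x \<le> 1" "w = s k x"
        using \<open>w \<in> path_image (s k)\<close> by (auto simp: path_image_def)
      have "\<bar>t * (2 * x - 1)\<bar> \<le> t * 1"
        unfolding abs_mult using x t by (intro mult_mono) auto
      moreover have "w = z + \<i> ^ k * Complex t (t * (2 * x - 1))"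
        by (simp add: x s_def linepath_def scaleR_conv_of_real Complex_eq algebra_simps)
      ultimately show ?thesis by (metis mult.right_neutral)
    qed
    have sub: "path_image (s k) \<subseteq> ball z (2 * r) - {z}" for k
    proof
      fix w assume "w \<in> path_image (s k)"
      then obtain j y where "\<bar>y\<bar> \<le> t" "w = z + \<i> ^ j * Complex t y"
        using frame by blast
      then show "w \<in> ball z (2 * r) - {z}"
        using dist_frame[OF t, of y j] t by auto
    qed
    have "path_image P \<subseteq> path_image (s 3) \<union> path_image (s 0) \<union> path_image (s 1) \<union> path_image (s 2)"
      unfolding P using path_image_join_subset by blast
    then have "path_image P \<subseteq> ball z (2 * r) - {z}" using sub by blast
    moreover have "winding_number P z = 1"
      unfolding P_def using t by (intro winding_number_rectpath) (auto simp: in_box_complex_iff)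
    moreover have "valid_path P" "pathfinish P = pathstart P"
      by (auto simp: P_def)
    ultimately have int: "(G has_contour_integral (2 * pi * \<i> * g z)) P"
      unfolding G_def using Cauchy_integral_formula_convex_simple[OF _ hol, of z P] r by auto
    have cG: "continuous_on (path_image (s k)) G" for k
      unfolding G_def using sub[of k] by (intro continuous_intros continuous_on_subset[OF cg]) auto
    have Gint: "G contour_integrable_on s k" for k
      unfolding s_def by (rule contour_integrable_continuous_linepath) (use cG[of k] in \<open>simp add: s_def\<close>)
    have fin: "pathfinish (s 3) = pathstart (s 0)" "pathfinish (s 0) = pathstart (s 1)" "pathfinish (s 1) = pathstart (s 2)"
      by (auto simp: s_def eval_nat_numeral algebra_simps)
    have vp: "valid_path (s k)" for k by (simp add: s_def)
    have "2 * pi * \<i> * g z = contour_integral P G"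
      using int by (simp add: contour_integral_unique)
    also have "\<dots> = contour_integral (s 3) G + (contour_integral (s 0) G + (contour_integral (s 1) G + contour_integral (s 2) G))"
      unfolding P using Gint fin vp by (simp add: valid_path_join)
    also have "\<dots> = (\<Sum>k<4. contour_integral (s k) G)"
      by (simp add: eval_nat_numeral lessThan_Suc algebra_simps)
    finally have eq: "2 * pi * \<i> * g z = (\<Sum>k<4. contour_integral (s k) G)" .
    \<comment> \<open>On the sides \<open>dist z w \<ge> t\<close>, so the Cauchy kernel costs at
      most 1 / t.\<close>
    have side: "ennreal (t * norm (contour_integral (s k) G)) \<le> (\<integral>\<^sup>+ y. F (z + \<i> ^ k * Complex t y) \<partial>lborel)" for k
    proof -
      have "ennreal (norm (contour_integral (s k) G)) \<le>
          (\<integral>\<^sup>+ y. ennreal (1 / t) * F (z + \<i> ^ k * of_real t + of_real y * \<i> ^ Suc k) \<partial>lborel)"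
      proof (rule norm_contour_integral_linepath_le[where g = G and t = t])
        show "(G has_contour_integral contour_integral (s k) G)
           (linepath (z + \<i> ^ k * of_real t - of_real t * \<i> ^ Suc k) (z + \<i> ^ k * of_real t + of_real t * \<i> ^ Suc k))"
          using has_contour_integral_integral[OF Gint[of k]] by (simp add: s_def)
        show "continuous_on (closed_segment (z + \<i> ^ k * of_real t - of_real t * \<i> ^ Suc k) (z + \<i> ^ k * of_real t + of_real t * \<i> ^ Suc k)) G"
          using cG[of k] by (simp add: s_def)
        fix y :: real assume y: "\<bar>y\<bar> \<le> t"
        define w where "w = z + \<i> ^ k * Complex t y"
        have w: "z + \<i> ^ k * of_real t + of_real y * \<i> ^ Suc k = w"
          by (simp add: w_def Complex_eq algebra_simps)
        have "dist z w < 2 * r" "t \<le> dist z w"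
          unfolding w_def using dist_frame[OF t y] by auto
        then have "norm (G w) \<le> norm (g w) / t" "w \<in> ball z (2 * r)"
          unfolding G_def norm_divide using t
          by (auto intro!: divide_left_mono mult_pos_pos simp: dist_norm norm_minus_commute)
        then have "ennreal (norm (G w)) \<le> ennreal (1 / t) * F w"
          using t by (auto simp: F_def ennreal_mult'[symmetric] intro!: ennreal_leI)
        then show "ennreal (norm (G (z + \<i> ^ k * of_real t + of_real y * \<i> ^ Suc k)))
            \<le> ennreal (1 / t) * F (z + \<i> ^ k * of_real t + of_real y * \<i> ^ Suc k)"
          unfolding w .
      qed (use t in \<open>auto simp: norm_mult norm_power\<close>)
      also have "\<dots> = ennreal (1 / t) * (\<integral>\<^sup>+ y. F (z + \<i> ^ k * Complex t y) \<partial>lborel)"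
        by (subst nn_integral_cmult) (simp_all add: Complex_eq algebra_simps)
      finally have "ennreal t * ennreal (norm (contour_integral (s k) G)) \<le>
         ennreal t * (ennreal (1 / t) * (\<integral>\<^sup>+ y. F (z + \<i> ^ k * Complex t y) \<partial>lborel))"
        by (rule mult_left_mono) simp
      also have "\<dots> = (\<integral>\<^sup>+ y. F (z + \<i> ^ k * Complex t y) \<partial>lborel)"
        using t by (subst mult.assoc[symmetric], subst ennreal_mult[symmetric]) auto
      finally show ?thesis using t by (simp add: ennreal_mult)
    qed
    have "2 * pi * t * norm (g z) = t * norm (2 * pi * \<i> * g z)"
      by (simp add: norm_mult)
    also have "\<dots> \<le> t * (\<Sum>k<4. norm (contour_integral (s k) G))"
      unfolding eq using t by (intro mult_left_mono norm_sum) auto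
    finally have "ennreal (2 * pi * t * norm (g z)) \<le> ennreal (\<Sum>k<4. t * norm (contour_integral (s k) G))"
      by (intro ennreal_leI) (simp add: sum_distrib_left)
    also have "\<dots> = (\<Sum>k<4. ennreal (t * norm (contour_integral (s k) G)))"
      using t by (intro sum_ennreal[symmetric]) auto
    also have "\<dots> \<le> (\<Sum>k<4. \<integral>\<^sup>+ y. F (z + \<i> ^ k * Complex t y) \<partial>lborel)"
      by (intro sum_mono side)
    finally show ?thesis .
  qed
  \<comment> \<open>The average over half sides between r / 2 and r, an interval of length r / 2 on
    which 2 pi t is at least pi r. Each of the four families of sides then contributes at most one
    full plane integral.\<close>
  have "ennreal (pi * r * norm (g z)) * ennreal (r / 2) = (\<integral>\<^sup>+ t. ennreal (pi * r * norm (g z)) * indicator {r/2<..<r} t \<partial>lborel)"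
    using r by (subst nn_integral_cmult_indicator) auto
  also have "\<dots> \<le> (\<integral>\<^sup>+ t. (\<Sum>k<4. \<integral>\<^sup>+ y. F (z + \<i> ^ k * Complex t y) \<partial>lborel) \<partial>lborel)"
  proof (rule nn_integral_mono)
    fix t :: real
    show "ennreal (pi * r * norm (g z)) * indicator {r/2<..<r} t \<le> (\<Sum>k<4. \<integral>\<^sup>+ y. F (z + \<i> ^ k * Complex t y) \<partial>lborel)"
    proof (cases "t \<in> {r/2<..<r}")
      case True
      then have "pi * r * norm (g z) \<le> 2 * pi * t * norm (g z)"
        using r by (intro mult_right_mono) auto
      then show ?thesis
        using order_trans[OF ennreal_leI main[of t]] True r by simp
    qed auto
  qed
  also have "\<dots> = (\<Sum>k<4. \<integral>\<^sup>+ t. \<integral>\<^sup>+ y. F (z + \<i> ^ k * Complex t y) \<partial>lborel \<partial>lborel)"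
    by (rule nn_integral_sum) simp
  also have "\<dots> = 4 * (\<integral>\<^sup>+ w. F w \<partial>lborel)"
    by (subst nn_integral_complex_frame[OF F]) (simp)
  finally have *: "ennreal (pi * r * norm (g z)) * ennreal (r / 2) \<le> 4 * (\<integral>\<^sup>+ w. F w \<partial>lborel)" .
  have "norm (g z) = (2 / (pi * r\<^sup>2)) * (pi * r * norm (g z) * (r / 2))"
    using r by (simp add: field_simps power2_eq_square)
  then have "ennreal (norm (g z)) = ennreal (2 / (pi * r\<^sup>2)) * (ennreal (pi * r * norm (g z)) * ennreal (r / 2))"
    using r by (metis ennreal_mult divide_nonneg_nonneg mult_nonneg_nonneg norm_ge_zero pi_ge_zero less_imp_le zero_le_power2 zero_le_numeral)
  also have "\<dots> \<le> ennreal (2 / (pi * r\<^sup>2)) * (4 * (\<integral>\<^sup>+ w. F w \<partial>lborel))"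
    by (intro mult_left_mono *) simp
  also have "\<dots> = ennreal (8 / (pi * r\<^sup>2)) * (\<integral>\<^sup>+ w. F w \<partial>lborel)"
    using r by (subst mult.assoc[symmetric], subst ennreal_numeral[symmetric], subst ennreal_mult'[symmetric]) auto
  also have "\<dots> \<le> ennreal (4 / r\<^sup>2) * (\<integral>\<^sup>+ w. F w \<partial>lborel)"
    using r pi_gt3 by (intro mult_right_mono ennreal_leI) (auto simp: field_simps)
  finally show ?thesis unfolding F_def .
qed

section \<open>Taylor expansion up to the boundary\<close>

text \<open>Nonnegativity of the integral of \<open>(p s - l * q s)\<^sup>2\<close> at a suitable
  \<open>l\<close>. An upper bound \<open>Q > 0\<close> stands in for the integral of
  \<open>(q s)\<^sup>2\<close>, so there is no division by an integral that might vanish.\<close>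

lemma Cauchy_Schwarz_integral_interval:
  fixes p q :: "real \<Rightarrow> real"
  assumes p: "continuous_on {a..b} p" and q: "continuous_on {a..b} q"
    and Q: "integral {a..b} (\<lambda>s. (q s)\<^sup>2) \<le> Q" "Q > 0"
  shows "(integral {a..b} (\<lambda>s. p s * q s))\<^sup>2 \<le> integral {a..b} (\<lambda>s. (p s)\<^sup>2) * Q"
proof -
  define X where "X = integral {a..b} (\<lambda>s. p s * q s)"
  define P where "P = integral {a..b} (\<lambda>s. (p s)\<^sup>2)"
  define l where "l = X / Q"
  have i: "(\<lambda>s. (p s)\<^sup>2) integrable_on {a..b}" "(\<lambda>s. p s * q s) integrable_on {a..b}" "(\<lambda>s. (q s)\<^sup>2) integrable_on {a..b}"
    using p q by (auto intro!: integrable_continuous_interval continuous_intros)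
  have "0 \<le> integral {a..b} (\<lambda>s. (p s - l * q s)\<^sup>2)"
    using p q by (intro integral_nonneg integrable_continuous_interval continuous_intros) auto
  also have "(\<lambda>s. (p s - l * q s)\<^sup>2) = (\<lambda>s. (p s)\<^sup>2 - 2 * l * (p s * q s) + l\<^sup>2 * (q s)\<^sup>2)"
    by (simp add: power2_eq_square algebra_simps)
  also have "integral {a..b} \<dots> = P - 2 * l * X + l\<^sup>2 * integral {a..b} (\<lambda>s. (q s)\<^sup>2)"
    unfolding P_def X_def
    by (subst integral_add, intro integrable_diff integrable_on_mult_right i, intro integrable_on_mult_right i,
        subst integral_diff, intro i, intro integrable_on_mult_right i) simp
  also have "\<dots> \<le> P - 2 * l * X + l\<^sup>2 * Q"
    using Q by (intro add_left_mono mult_left_mono) auto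
  also have "\<dots> = P - X\<^sup>2 / Q"
    using Q by (simp add: l_def power2_eq_square field_simps)
  finally show ?thesis using Q by (simp add: X_def P_def field_simps)
qed

text \<open>Integrating \<open>\<kappa> / (1 - s)\<close> gives logarithmic growth of
  \<open>u\<close>. In the application \<open>exp (u s)\<close> is the ratio of f' at a point of a
  segment to f' at its starting point, so a small bound for (1 - |z|) |h'(z)| means that f' grows at
  most like a small power towards the circle.\<close>

lemma log_growth_bound:
  fixes u H :: "real \<Rightarrow> complex"
  assumes du: "\<And>s. 0 \<le> s \<Longrightarrow> s < 1 \<Longrightarrow> (u has_vector_derivative H s) (at s)" and u0: "u 0 = 0"
    and H: "\<And>s. 0 \<le> s \<Longrightarrow> s < 1 \<Longrightarrow> norm (H s) * (1 - s) \<le> \<kappa>"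
    and S: "0 \<le> S" "S < 1"
  shows "norm (exp (u S)) \<le> (1 - S) powr (- \<kappa>)"
proof -
  have 1: "(H has_integral (u S - u 0)) {0..S}"
    using S has_vector_derivative_at_within[OF du] by (intro fundamental_theorem_of_calculus) auto
  have 2: "((\<lambda>s. \<kappa> / (1 - s)) has_integral (- \<kappa> * ln (1 - S) - (- \<kappa> * ln (1 - 0)))) {0..S}"
    using S by (intro fundamental_theorem_of_calculus)
      (auto simp: has_real_derivative_iff_has_vector_derivative[symmetric] intro!: derivative_eq_intros)
  have "norm (u S) \<le> - \<kappa> * ln (1 - S)"
    using integral_norm_bound_integral[OF has_integral_integrable[OF 1] has_integral_integrable[OF 2]] H S u0
    by (auto simp: integral_unique[OF 1] integral_unique[OF 2] pos_le_divide_eq)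
  then have "Re (u S) \<le> - \<kappa> * ln (1 - S)"
    using complex_Re_le_cmod order_trans by blast
  then show ?thesis using S by (simp add: powr_def)
qed

text \<open>The remainder is integrated by parts as
  \<open>F S + (1 - S) F' S - F 0 - F' 0 = \<integral> (1 - s) F''\<close>, so that only \<open>F'' = H F'\<close> occurs.\<close>

lemma boundary_taylor_bound:
  fixes F u H :: "real \<Rightarrow> complex" and A :: complex
  assumes cF: "continuous_on {0..1} F"
    and dF: "\<And>s. 0 \<le> s \<Longrightarrow> s < 1 \<Longrightarrow> (F has_vector_derivative A * exp (u s)) (at s)"
    and du: "\<And>s. 0 \<le> s \<Longrightarrow> s < 1 \<Longrightarrow> (u has_vector_derivative H s) (at s)" and u0: "u 0 = 0"
    and cH: "continuous_on {0..<1} H"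
    and H: "\<And>s. 0 \<le> s \<Longrightarrow> s < 1 \<Longrightarrow> norm (H s) * (1 - s) \<le> \<kappa>" and \<kappa>: "\<kappa> \<le> 1/4"
    and T: "\<And>S. 0 \<le> S \<Longrightarrow> S < 1 \<Longrightarrow> integral {0..S} (\<lambda>s. (norm (H s) * (1 - s))\<^sup>2) \<le> T"
  shows "(norm (F 1 - F 0 - A))\<^sup>2 \<le> 2 * (norm A)\<^sup>2 * T"
proof -
  define \<Phi> where "\<Phi> s = F s + of_real (1 - s) * (A * exp (u s))" for s
  have eu: "norm (exp (u s)) \<le> (1 - s) powr (- (1/4))" if "0 \<le> s" "s < 1" for s
    using log_growth_bound[OF du u0 _ that, of "1/4"] order_trans[OF H \<kappa>] by auto
  have bound: "(norm (\<Phi> S - \<Phi> 0))\<^sup>2 \<le> 2 * (norm A)\<^sup>2 * T" if S: "0 \<le> S" "S < 1" for S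
  proof -
    have cH': "continuous_on {0..S} H"
      using S by (intro continuous_on_subset[OF cH]) auto
    have 1: "((\<lambda>s. of_real (1 - s) * (A * (exp (u s) * H s))) has_integral (\<Phi> S - \<Phi> 0)) {0..S}"
    proof (rule fundamental_theorem_of_calculus)
      fix s assume s: "s \<in> {0..S}"
      have e: "((\<lambda>s. exp (u s)) has_vector_derivative H s * exp (u s)) (at s within {0..S})"
        using field_vector_diff_chain_within[OF has_vector_derivative_at_within[OF du[of s]]
            has_field_derivative_at_within[OF DERIV_exp[of "u s"]], of "{0..S}"] s S
        by (simp add: o_def)
      then show "(\<Phi> has_vector_derivative of_real (1 - s) * (A * (exp (u s) * H s))) (at s within {0..S})"
      proof -
        have "((\<lambda>s. of_real (1 - s)) has_vector_derivative (- 1 :: complex)) (at s within {0..S})"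
          by (auto intro!: derivative_eq_intros)
        from has_vector_derivative_mult[OF this has_vector_derivative_mult_right[OF e, of A]]
        have "((\<lambda>s. of_real (1 - s) * (A * exp (u s))) has_vector_derivative
            (of_real (1 - s) * (A * (H s * exp (u s))) + - 1 * (A * exp (u s)))) (at s within {0..S})" .
        moreover have "(F has_vector_derivative A * exp (u s)) (at s within {0..S})"
          using s S has_vector_derivative_at_within[OF dF[of s]] by auto
        ultimately show ?thesis
          unfolding \<Phi>_def using has_vector_derivative_add by (fastforce simp: algebra_simps)
      qed
    qed (use S in auto)
    define p where "p s = norm (H s) * (1 - s)" for s
    \<comment> \<open>\<open>q\<close> majorizes the norm of \<open>exp (u s)\<close>. Its square is
      \<open>(1 - s) powr (- (1/2))\<close>, whose integral stays below 2 up to the boundary; this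
      is the purpose of \<open>\<kappa> \<le> 1/4\<close>.\<close>
    define q where "q s = (1 - s) powr (- (1/4))" for s :: real
    have pq: "continuous_on {0..S} p" "continuous_on {0..S} q"
      unfolding p_def q_def using S by (auto intro!: continuous_intros cH')
    have 2: "(\<lambda>s. norm A * (p s * q s)) integrable_on {0..S}"
      using pq by (intro integrable_continuous_interval continuous_intros)
    have "norm (\<Phi> S - \<Phi> 0) \<le> integral {0..S} (\<lambda>s. norm A * (p s * q s))"
      unfolding integral_unique[OF 1, symmetric]
    proof (rule integral_norm_bound_integral[OF has_integral_integrable[OF 1] 2])
      fix s assume s: "s \<in> {0..S}"
      have "norm (of_real (1 - s) * (A * (exp (u s) * H s))) = norm A * (p s * norm (exp (u s)))"
        using s S by (simp add: norm_mult p_def norm_of_real del: norm_exp_eq_Re of_real_diff)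
      also have "\<dots> \<le> norm A * (p s * q s)"
        unfolding q_def using s S by (intro mult_left_mono eu) (auto simp: p_def)
      finally show "norm (of_real (1 - s) * (A * (exp (u s) * H s))) \<le> norm A * (p s * q s)" .
    qed
    also have "\<dots> = norm A * integral {0..S} (\<lambda>s. p s * q s)"
      by simp
    finally have 3: "(norm (\<Phi> S - \<Phi> 0))\<^sup>2 \<le> (norm A)\<^sup>2 * (integral {0..S} (\<lambda>s. p s * q s))\<^sup>2"
      by (metis norm_ge_zero power_mono power_mult_distrib)
    have 4: "(integral {0..S} (\<lambda>s. p s * q s))\<^sup>2 \<le> integral {0..S} (\<lambda>s. (p s)\<^sup>2) * 2"
    proof (rule Cauchy_Schwarz_integral_interval[OF pq])
      have "((\<lambda>s. (1 - s) powr (- (1/2))) has_integral (- 2 * (1 - S) powr (1/2) - (- 2 * (1 - 0) powr (1/2)))) {0..S}"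
      proof (rule fundamental_theorem_of_calculus)
        fix s assume s: "s \<in> {0..S}"
        have "((\<lambda>s. - 2 * (1 - s) powr (1/2)) has_real_derivative (1 - s) powr (- (1/2))) (at s within {0..S})"
          using s S by (auto intro!: derivative_eq_intros simp: powr_diff powr_minus field_simps powr_half_sqrt)
        then show "((\<lambda>s. - 2 * (1 - s) powr (1/2)) has_vector_derivative (1 - s) powr (- (1/2))) (at s within {0..S})"
          by (simp add: has_real_derivative_iff_has_vector_derivative)
      qed (use S in auto)
      moreover have "(q s)\<^sup>2 = (1 - s) powr (- (1/2))" for s
        by (simp add: q_def power2_eq_square powr_add[symmetric])
      ultimately show "integral {0..S} (\<lambda>s. (q s)\<^sup>2) \<le> 2"
        by (simp add: integral_unique)
    qed simp
    have "integral {0..S} (\<lambda>s. (p s)\<^sup>2) \<le> T"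
      unfolding p_def by (rule T[OF S])
    with 4 have "(integral {0..S} (\<lambda>s. p s * q s))\<^sup>2 \<le> 2 * T" by linarith
    from order_trans[OF 3 mult_left_mono[OF this]] show ?thesis by (simp add: algebra_simps)
  qed
  \<comment> \<open>The boundary term at 1 vanishes although F' may blow up there: the factor 1 - s
    beats the growth of order -1/4. At 1 itself only continuity of \<open>F\<close> is available,
    since f is merely continuous up to the circle.\<close>
  have "((\<lambda>s. of_real (1 - s) * (A * exp (u s))) \<longlongrightarrow> 0) (at_left 1)"
  proof (rule Lim_null_comparison)
    show "((\<lambda>s. norm A * (1 - s) powr (3/4)) \<longlongrightarrow> 0) (at_left (1::real))"
      by (auto intro!: tendsto_eq_intros simp: eventually_at_filter)
    have "norm (of_real (1 - s) * (A * exp (u s))) \<le> norm A * (1 - s) powr (3/4)" if s: "0 < s" "s < 1" for s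
    proof -
      have "norm (of_real (1 - s) * (A * exp (u s))) = norm A * ((1 - s) * norm (exp (u s)))"
        using s by (simp add: norm_mult norm_of_real del: norm_exp_eq_Re of_real_diff)
      also have "\<dots> \<le> norm A * ((1 - s) powr 1 * (1 - s) powr (- (1/4)))"
        using s eu[of s] by (auto intro!: mult_left_mono)
      finally show ?thesis by (simp only: powr_add[symmetric]) simp
    qed
    then show "\<forall>\<^sub>F s in at_left 1. norm (of_real (1 - s) * (A * exp (u s))) \<le> norm A * (1 - s) powr (3/4)"
      by (intro eventually_at_leftI[of 0]) auto
  qed
  moreover have "(F \<longlongrightarrow> F 1) (at_left 1)"
    using cF by (simp add: continuous_on_Icc_at_leftD)
  ultimately have "(\<Phi> \<longlongrightarrow> F 1 + 0) (at_left 1)"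
    unfolding \<Phi>_def by (intro tendsto_add)
  then have "((\<lambda>S. (norm (\<Phi> S - \<Phi> 0))\<^sup>2) \<longlongrightarrow> (norm (F 1 - \<Phi> 0))\<^sup>2) (at_left 1)"
    by (auto intro!: tendsto_intros)
  moreover have "\<forall>\<^sub>F S in at_left 1. (norm (\<Phi> S - \<Phi> 0))\<^sup>2 \<le> 2 * (norm A)\<^sup>2 * T"
    using bound by (intro eventually_at_leftI[of 0]) auto
  ultimately have "(norm (F 1 - \<Phi> 0))\<^sup>2 \<le> 2 * (norm A)\<^sup>2 * T"
    by (rule tendsto_upperbound) simp
  then show ?thesis by (simp add: \<Phi>_def u0 algebra_simps)
qed

section \<open>Dyadic chords and their bending\<close>

text \<open>Jordan's inequality: a concave graph lies above its chord.\<close>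

lemma sin_ge_linear:
  assumes "0 \<le> x" "x \<le> pi / 2"
  shows "2 * x / pi \<le> sin x"
proof -
  have "concave_on {0..pi/2} sin"
  proof (rule f''_le0_imp_concave)
    show "(sin has_real_derivative cos x) (at x)" "(cos has_real_derivative - sin x) (at x)" for x :: real
      by (auto intro!: derivative_eq_intros)
    show "- sin x \<le> 0" if "x \<in> {0..pi/2}" for x
      using that by (auto intro!: sin_ge_zero)
  qed auto
  then have "(1 - 2 * x / pi) * sin 0 + (2 * x / pi) * sin (pi / 2) \<le> sin ((1 - 2 * x / pi) *\<^sub>R 0 + (2 * x / pi) *\<^sub>R (pi / 2))"
    using assms by (intro concave_onD) (auto simp: field_simps)
  then show ?thesis by simp
qed

lemma dist_cis: "dist (cis (2 * pi * x)) (cis (2 * pi * y)) = 2 * \<bar>sin (pi * (x - y))\<bar>"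
proof -
  have "cis (2 * pi * x) = cis (2 * pi * y) * cis (2 * pi * (x - y))"
    unfolding cis_mult by (simp add: algebra_simps)
  then have "dist (cis (2 * pi * x)) (cis (2 * pi * y)) = norm (cis (2 * pi * y) * (cis (2 * pi * (x - y)) - 1))"
    by (simp only: dist_norm right_diff_distrib mult_1_right)
  also have "\<dots> = norm (exp (\<i> * of_real (2 * pi * (x - y))) - 1)"
    by (simp only: norm_mult norm_cis mult_1_left) (simp only: cis_conv_exp)
  also have "\<dots> = 2 * \<bar>sin (pi * (x - y))\<bar>"
    by (subst dist_exp_i_1) simp
  finally show ?thesis .
qed

lemma dist_cis_le: "dist (cis (2 * pi * x)) (cis (2 * pi * y)) \<le> 8 * \<bar>x - y\<bar>"
proof -
  have "\<bar>sin (pi * (x - y))\<bar> \<le> \<bar>pi * (x - y)\<bar>" by (rule abs_sin_x_le_abs_x)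
  also have "\<dots> \<le> 4 * \<bar>x - y\<bar>"
    unfolding abs_mult using pi_less_4 by (intro mult_right_mono) auto
  finally show ?thesis by (simp add: dist_cis)
qed

lemma dist_cis_ge:
  assumes "\<bar>x - y\<bar> \<le> 1/2"
  shows "4 * \<bar>x - y\<bar> \<le> dist (cis (2 * pi * x)) (cis (2 * pi * y))"
proof -
  have "2 * (pi * \<bar>x - y\<bar>) / pi \<le> sin (pi * \<bar>x - y\<bar>)"
    using assms by (intro sin_ge_linear) auto
  also have "sin (pi * \<bar>x - y\<bar>) = sin \<bar>pi * (x - y)\<bar>"
    by (simp add: abs_mult)
  also have "\<dots> \<le> \<bar>sin (pi * (x - y))\<bar>"
    by (cases "pi * (x - y) \<ge> 0") auto
  finally show ?thesis by (simp add: dist_cis)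
qed

lemma cis_add_int: "cis (2 * pi * (x + of_int m)) = cis (2 * pi * x)"
proof -
  have "cis (2 * pi * (x + of_int m)) = cis (2 * pi * x) * cis (2 * pi * of_int m)"
    by (simp add: cis_mult algebra_simps)
  then show ?thesis by (simp add: cis_multiple_2pi)
qed

text \<open>The converse of \<open>dist_cis_le\<close> up to the period: points close on the circle
  have parameters close modulo integers. For equal points it yields equality of the parameters
  modulo an integer.\<close>

lemma cis_near:
  obtains m :: int where "4 * \<bar>x - y - of_int m\<bar> \<le> dist (cis (2 * pi * x)) (cis (2 * pi * y))"
proof -
  define m where "m = round (x - y)"
  have "\<bar>x - (y + of_int m)\<bar> \<le> 1/2"
    using of_int_round_abs_le[of "x - y"] by (simp add: m_def abs_minus_commute algebra_simps)
  from dist_cis_ge[OF this] show ?thesis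
    by (intro that[of m]) (simp only: cis_add_int diff_diff_eq)
qed

text \<open>The index \<open>k\<close> is not reduced modulo 2^n, so that the right endpoint of the
  arc \<open>(n, k)\<close> is \<open>dpt n (Suc k)\<close> also for the last arc.\<close>

definition dpt :: "nat \<Rightarrow> nat \<Rightarrow> complex" where
  "dpt n k = cis (2 * pi * (real k / 2 ^ n))"

lemma norm_dpt [simp]: "norm (dpt n k) = 1" by (simp add: dpt_def)

lemma dpt_double: "dpt (Suc n) (2 * k) = dpt n k" by (simp add: dpt_def)

lemma dist_dpt_le: "norm (dpt n k - dpt n l) \<le> 8 * \<bar>real k - real l\<bar> / 2 ^ n"
  using dist_cis_le[of "real k / 2 ^ n" "real l / 2 ^ n"]
  by (simp add: dpt_def dist_norm diff_divide_distrib[symmetric])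

lemma dpt_mid_dist:
  assumes "e \<le> 2"
  shows "norm (dpt (Suc n) (2 * k + e) - dpt (Suc n) (2 * k + 1)) \<le> 4 / 2 ^ n"
proof -
  have "\<bar>real (2 * k + e) - real (2 * k + 1)\<bar> \<le> 1" using assms by auto
  then have "8 * \<bar>real (2 * k + e) - real (2 * k + 1)\<bar> / 2 ^ Suc n \<le> 8 * 1 / 2 ^ Suc n"
    by (intro divide_right_mono mult_left_mono) auto
  also have "\<dots> = 4 / 2 ^ n" by simp
  finally show ?thesis using dist_dpt_le order_trans by blast
qed

section \<open>Conformal maps with a branch h of log f'\<close>

locale conformal_log =
  fixes f h :: "complex \<Rightarrow> complex"
  assumes f_hol: "f holomorphic_on ball 0 1"
    and f_cont: "continuous_on (cball 0 1) f"
    and f_inj: "inj_on f (cball 0 1)"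
    and h_hol: "h holomorphic_on ball 0 1"
    and exp_h: "\<And>z. z \<in> ball 0 1 \<Longrightarrow> exp (h z) = deriv f z"
begin

definition apex :: "nat \<Rightarrow> nat \<Rightarrow> complex" where
  "apex n k = of_real (1 - 1 / 2 ^ n) * dpt (Suc n) (2 * k + 1)"

text \<open>The segment from the apex of the box over a dyadic arc to its left endpoint, its midpoint or its
  right endpoint for \<open>e = 0, 1, 2\<close>.\<close>

definition seg :: "nat \<Rightarrow> nat \<Rightarrow> nat \<Rightarrow> real \<Rightarrow> complex" where
  "seg n k e s = apex n k + of_real s * (dpt (Suc n) (2 * k + e) - apex n k)"

lemma norm_apex: "norm (apex n k) = 1 - 1 / 2 ^ n"
  unfolding apex_def norm_mult norm_dpt norm_of_real by simp

lemma apex_endpoint_dist: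
  assumes "e \<le> 2"
  shows "norm (dpt (Suc n) (2 * k + e) - apex n k) \<le> 5 / 2 ^ n"
proof -
  have "dpt (Suc n) (2 * k + e) - apex n k
      = (dpt (Suc n) (2 * k + e) - dpt (Suc n) (2 * k + 1)) + of_real (1 / 2 ^ n) * dpt (Suc n) (2 * k + 1)"
    by (simp add: apex_def algebra_simps)
  also have "norm \<dots> \<le> 4 / 2 ^ n + 1 / 2 ^ n"
    using dpt_mid_dist[OF assms, of n k] by (intro norm_triangle_mono) (auto simp: norm_mult norm_divide norm_power)
  finally show ?thesis by simp
qed

text \<open>The segment approaches its endpoint nontangentially: its height above the circle and its
  distance to the endpoint are both comparable to (1 - s) / 2^n. The lower bound is convexity of the
  norm; the factor 5 comes from the length of the segment.\<close>

lemma seg_bounds: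
  assumes e: "e \<le> 2" and s: "0 \<le> s" "s \<le> 1"
  shows "(1 - s) / 2 ^ n \<le> 1 - norm (seg n k e s)"
    and "1 - norm (seg n k e s) \<le> 5 * (1 - s) / 2 ^ n"
    and "norm (seg n k e s - dpt (Suc n) (2 * k + e)) \<le> 5 * (1 - s) / 2 ^ n"
proof -
  let ?\<zeta> = "dpt (Suc n) (2 * k + e)"
  have "seg n k e s = of_real (1 - s) * apex n k + of_real s * ?\<zeta>"
    by (simp add: seg_def algebra_simps)
  then have "norm (seg n k e s) \<le> norm (of_real (1 - s) * apex n k) + norm (of_real s * ?\<zeta>)"
    by (metis norm_triangle_ineq)
  also have "\<dots> = (1 - s) * (1 - 1 / 2 ^ n) + s"
    using s unfolding norm_mult norm_of_real norm_dpt norm_apex by simp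
  finally show "(1 - s) / 2 ^ n \<le> 1 - norm (seg n k e s)" by (simp add: algebra_simps)
  have "seg n k e s - ?\<zeta> = of_real (1 - s) * (apex n k - ?\<zeta>)"
    by (simp add: seg_def algebra_simps)
  then have "norm (seg n k e s - ?\<zeta>) = (1 - s) * norm (?\<zeta> - apex n k)"
    using s by (simp only: norm_mult norm_of_real norm_minus_commute)
  also have "\<dots> \<le> (1 - s) * (5 / 2 ^ n)"
    using s by (intro mult_left_mono apex_endpoint_dist e) auto
  finally show *: "norm (seg n k e s - ?\<zeta>) \<le> 5 * (1 - s) / 2 ^ n" by (simp add: algebra_simps)
  have "1 \<le> norm (seg n k e s) + norm (?\<zeta> - seg n k e s)"
    using norm_triangle_sub[of ?\<zeta> "seg n k e s"] by simp
  then show "1 - norm (seg n k e s) \<le> 5 * (1 - s) / 2 ^ n"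
    using * by (simp add: norm_minus_commute)
qed

definition chord :: "nat \<Rightarrow> nat \<Rightarrow> real" where
  "chord n k = norm (f (dpt n k) - f (dpt n (Suc k)))"

definition second_diff :: "nat \<Rightarrow> nat \<Rightarrow> real" where
  "second_diff n k = norm (f (dpt (Suc n) (2 * k)) - 2 * f (dpt (Suc n) (2 * k + 1)) + f (dpt (Suc n) (2 * k + 2)))"

definition bend :: "nat \<Rightarrow> nat \<Rightarrow> real" where
  "bend n k = second_diff n k / chord n k"

text \<open>Cut off to the disc because \<open>deriv h\<close> is arbitrary outside; the cut-off
  makes the function Borel measurable on the whole plane.\<close>

definition energy :: "complex \<Rightarrow> ennreal" where
  "energy w = ennreal ((norm (deriv h w))\<^sup>2) * indicator (ball 0 1) w"

lemma measurable_energy [measurable]: "energy \<in> borel_measurable borel"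
proof -
  have "continuous_on (ball 0 1) (\<lambda>w. (norm (deriv h w))\<^sup>2)"
    by (intro continuous_intros holomorphic_on_imp_continuous_on holomorphic_deriv[OF h_hol]) auto
  then have "(\<lambda>w. indicator (ball 0 1) w *\<^sub>R (norm (deriv h w))\<^sup>2) \<in> borel_measurable borel"
    by (intro borel_measurable_continuous_on_indicator) auto
  then have "(\<lambda>w. ennreal (indicator (ball 0 1) w *\<^sub>R (norm (deriv h w))\<^sup>2)) \<in> borel_measurable borel"
    by measurable
  also have "(\<lambda>w. ennreal (indicator (ball 0 1) w *\<^sub>R (norm (deriv h w))\<^sup>2)) = energy"
    by (auto simp: fun_eq_iff energy_def split: split_indicator)
  finally show ?thesis .
qed

abbreviation energy_on :: "complex set \<Rightarrow> ennreal" where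
  "energy_on A \<equiv> \<integral>\<^sup>+ w\<in>A. energy w \<partial>lborel"

abbreviation weighted_energy :: "(real \<Rightarrow> real) \<Rightarrow> complex set \<Rightarrow> ennreal" where
  "weighted_energy \<Omega> A \<equiv> \<integral>\<^sup>+ w\<in>A. energy w * ennreal (\<Omega> (1 - norm w)) \<partial>lborel"

text \<open>The square of \<open>deriv h\<close> is itself holomorphic, so the mean value inequality
  applies to it and its right side becomes an energy.\<close>

lemma norm_dh_square_le:
  assumes "ball z (2 * r) \<subseteq> ball 0 1" "r > 0"
  shows "ennreal ((norm (deriv h z))\<^sup>2) \<le> ennreal (4 / r\<^sup>2) * energy_on (ball z (2 * r))"
proof -
  have "deriv h holomorphic_on ball z (2 * r)"
    using holomorphic_on_subset[OF holomorphic_deriv[OF h_hol]] assms by auto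
  then have "(\<lambda>w. (deriv h w)\<^sup>2) holomorphic_on ball z (2 * r)"
    by (rule holomorphic_on_power)
  from norm_holomorphic_le_integral[OF this assms(2)]
  have "ennreal ((norm (deriv h z))\<^sup>2) \<le> ennreal (4 / r\<^sup>2) * (\<integral>\<^sup>+ w\<in>ball z (2 * r). ennreal ((norm (deriv h w))\<^sup>2) \<partial>lborel)"
    by (simp add: norm_power)
  also have "(\<integral>\<^sup>+ w\<in>ball z (2 * r). ennreal ((norm (deriv h w))\<^sup>2) \<partial>lborel) = energy_on (ball z (2 * r))"
    using assms(1) by (intro nn_integral_cong) (auto simp: energy_def split: split_indicator)
  finally show ?thesis .
qed

text \<open>Kept as a set of pairs, parameter and point, so that the order of integration can be
  exchanged. The section at s is the disc on which the mean value inequality is used at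
  \<open>seg n k e s\<close>; its radius is half the lower bound for the distance to the
  circle.\<close>

definition cone :: "nat \<Rightarrow> nat \<Rightarrow> nat \<Rightarrow> (real \<times> complex) set" where
  "cone n k e = {(s, w). 0 \<le> s \<and> s < 1 \<and> dist (seg n k e s) w < (1 - s) / 2 ^ Suc n}"

lemma sets_cone [measurable]: "cone n k e \<in> sets (borel \<Otimes>\<^sub>M borel)"
proof -
  have "cone n k e = {p. 0 \<le> fst p} \<inter> {p. fst p < 1} \<inter> {p. dist (seg n k e (fst p)) (snd p) < (1 - fst p) / 2 ^ Suc n}"
    by (auto simp: cone_def)
  moreover have "closed {p :: real \<times> complex. 0 \<le> fst p}" "open {p :: real \<times> complex. fst p < 1}"
     "open {p :: real \<times> complex. dist (seg n k e (fst p)) (snd p) < (1 - fst p) / 2 ^ Suc n}"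
    unfolding seg_def by (auto intro!: closed_Collect_le open_Collect_less continuous_intros)
  ultimately have "cone n k e \<in> sets borel" by auto
  then show ?thesis unfolding borel_prod .
qed

definition cone_energy :: "nat \<Rightarrow> nat \<Rightarrow> nat \<Rightarrow> ennreal" where
  "cone_energy n k e = (\<integral>\<^sup>+ s. \<integral>\<^sup>+ w. energy w * indicator (cone n k e) (s, w) \<partial>lborel \<partial>lborel)"

text \<open>\<open>boundary_taylor_bound\<close> is used with two values of \<open>T\<close>. The
  pointwise bound on h' gives a remainder small relative to \<open>A\<close>, which keeps chords
  from collapsing; the mean value inequality gives a remainder in terms of energy, which can be
  summed over arcs.\<close>

lemma taylor_seg:
  fixes n k e
  defines "\<zeta> \<equiv> dpt (Suc n) (2 * k + e)"
  defines "A \<equiv> deriv f (apex n k) * (\<zeta> - apex n k)"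
  defines "R \<equiv> f \<zeta> - f (apex n k) - A"
  assumes e: "e \<le> 2"
    and small: "\<And>z. z \<in> ball 0 1 \<Longrightarrow> 1 - norm z \<le> 5 / 2 ^ n \<Longrightarrow> norm (deriv h z) * (1 - norm z) \<le> \<eta>"
    and \<eta>: "\<eta> \<le> 1/20"
  shows "(norm R)\<^sup>2 \<le> 2 * (norm A)\<^sup>2 * (5 * \<eta>)\<^sup>2"
    and "ennreal ((norm R)\<^sup>2) \<le> ennreal (3200 * (norm A)\<^sup>2) * cone_energy n k e"
proof -
  define F where "F s = f (seg n k e s)" for s
  define u where "u s = h (seg n k e s) - h (apex n k)" for s
  define H where "H s = deriv h (seg n k e s) * (\<zeta> - apex n k)" for s
  have seg01: "seg n k e 0 = apex n k" "seg n k e 1 = \<zeta>"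
    by (auto simp: seg_def \<zeta>_def)
  have inball: "seg n k e s \<in> ball 0 1" if "0 \<le> s" "s < 1" for s
  proof -
    have "0 < (1 - s) / 2 ^ n" using that by simp
    also have "\<dots> \<le> 1 - norm (seg n k e s)"
      using seg_bounds(1)[OF e, of s n k] that by simp
    finally show ?thesis by simp
  qed
  have incball: "seg n k e s \<in> cball 0 1" if "0 \<le> s" "s \<le> 1" for s
  proof -
    have "0 \<le> (1 - s) / 2 ^ n" using that by simp
    also have "\<dots> \<le> 1 - norm (seg n k e s)"
      using seg_bounds(1)[OF e, of s n k] that by simp
    finally show ?thesis by simp
  qed
  have dseg: "(seg n k e has_vector_derivative (\<zeta> - apex n k)) (at s)" for s
    unfolding seg_def \<zeta>_def by (auto intro!: derivative_eq_intros)
  have cseg: "continuous_on X (seg n k e)" for X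
    unfolding seg_def by (intro continuous_intros)
  have cF: "continuous_on {0..1} F"
    unfolding F_def by (rule continuous_on_compose2[OF f_cont cseg]) (use incball in auto)
  have dF: "(F has_vector_derivative A * exp (u s)) (at s)" if s: "0 \<le> s" "s < 1" for s
  proof -
    have "(f has_field_derivative deriv f (seg n k e s)) (at (seg n k e s))"
      using holomorphic_derivI[OF f_hol _ inball[OF s]] by simp
    from field_vector_diff_chain_at[OF dseg this]
    have "(F has_vector_derivative (\<zeta> - apex n k) * deriv f (seg n k e s)) (at s)"
      by (simp add: F_def[abs_def] o_def)
    moreover have "deriv f (seg n k e s) = deriv f (apex n k) * exp (u s)"
      using exp_h[OF inball[OF s]] exp_h[OF inball[of 0]] exp_not_eq_zero[of "h (apex n k)"]
      by (simp add: u_def exp_diff seg01)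
    ultimately show ?thesis by (simp add: A_def mult_ac)
  qed
  have du: "(u has_vector_derivative H s) (at s)" if s: "0 \<le> s" "s < 1" for s
  proof -
    have "(h has_field_derivative deriv h (seg n k e s)) (at (seg n k e s))"
      using holomorphic_derivI[OF h_hol _ inball[OF s]] by simp
    from field_vector_diff_chain_at[OF dseg this]
    have "((\<lambda>s. h (seg n k e s)) has_vector_derivative H s) (at s)"
      by (simp add: H_def o_def mult.commute)
    then show ?thesis unfolding u_def by (auto intro!: derivative_eq_intros)
  qed
  have u0: "u 0 = 0" by (simp add: u_def seg01)
  have cH: "continuous_on {0..<1} H"
    unfolding H_def using inball
    by (intro continuous_intros continuous_on_compose2[OF holomorphic_on_imp_continuous_on[OF holomorphic_deriv[OF h_hol]] cseg]) auto
  have \<zeta>apex: "norm (\<zeta> - apex n k) \<le> 5 / 2 ^ n"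
    unfolding \<zeta>_def by (rule apex_endpoint_dist[OF e])
  have Hb: "norm (H s) * (1 - s) \<le> 5 * \<eta>" if s: "0 \<le> s" "s < 1" for s
  proof -
    have "norm (H s) * (1 - s) \<le> norm (deriv h (seg n k e s)) * (5 / 2 ^ n) * (1 - s)"
      unfolding H_def norm_mult using s \<zeta>apex by (intro mult_right_mono mult_left_mono) auto
    also have "\<dots> = 5 * (norm (deriv h (seg n k e s)) * ((1 - s) / 2 ^ n))" by simp
    also have "\<dots> \<le> 5 * (norm (deriv h (seg n k e s)) * (1 - norm (seg n k e s)))"
      using seg_bounds(1)[OF e, of s n k] s by (intro mult_left_mono) auto
    also have "\<dots> \<le> 5 * \<eta>"
    proof -
      have "5 * (1 - s) / 2 ^ n \<le> 5 / 2 ^ n" using s by (intro divide_right_mono) auto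
      then show ?thesis
        using small[OF inball[OF s]] seg_bounds(2)[OF e, of s n k] s by auto
    qed
    finally show ?thesis .
  qed
  have R: "R = F 1 - F 0 - A" by (simp add: R_def F_def seg01)
  note taylor = boundary_taylor_bound[OF cF dF du u0 cH Hb]
  \<comment> \<open>The factor 5 from the length of the segment turns
    \<open>\<eta> \<le> 1/20\<close> into the bound 1/4 required by
    \<open>boundary_taylor_bound\<close>.\<close>
  have \<kappa>: "5 * \<eta> \<le> 1/4" using \<eta> by simp
  have cp: "continuous_on {0..S} (\<lambda>s. (norm (H s) * (1 - s))\<^sup>2)" if "S < 1" for S
    using that by (intro continuous_intros continuous_on_subset[OF cH]) auto
  show "(norm R)\<^sup>2 \<le> 2 * (norm A)\<^sup>2 * (5 * \<eta>)\<^sup>2"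
    unfolding R
  proof (rule taylor[OF _ _ _ _ _ _ \<kappa>])
    fix S :: real assume S: "0 \<le> S" "S < 1"
    have "integral {0..S} (\<lambda>s. (norm (H s) * (1 - s))\<^sup>2) \<le> integral {0..S} (\<lambda>s. (5 * \<eta>)\<^sup>2)"
      using S Hb by (intro integral_le integrable_continuous_interval cp power_mono) auto
    also have "\<dots> = S * (5 * \<eta>)\<^sup>2" using S by simp
    also have "\<dots> \<le> 1 * (5 * \<eta>)\<^sup>2" using S by (intro mult_right_mono) auto
    finally show "integral {0..S} (\<lambda>s. (norm (H s) * (1 - s))\<^sup>2) \<le> (5 * \<eta>)\<^sup>2" by simp
  qed auto
  have E: "ennreal (integral {0..S} (\<lambda>s. (norm (H s) * (1 - s))\<^sup>2)) \<le> ennreal 1600 * cone_energy n k e"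
    if S: "0 \<le> S" "S < 1" for S
  proof -
    have "ennreal (integral {0..S} (\<lambda>s. (norm (H s) * (1 - s))\<^sup>2))
        = (\<integral>\<^sup>+ s. ennreal ((norm (H s) * (1 - s))\<^sup>2) * indicator {0..S} s \<partial>lborel)"
      using integrable_integral[OF integrable_continuous_interval[OF cp[OF S(2)]]]
      by (intro nn_integral_has_integral_lebesgue'[symmetric]) auto
    also have "\<dots> \<le> (\<integral>\<^sup>+ s. ennreal 1600 * (\<integral>\<^sup>+ w. energy w * indicator (cone n k e) (s, w) \<partial>lborel) \<partial>lborel)"
    proof (rule nn_integral_mono)
      fix s :: real
      show "ennreal ((norm (H s) * (1 - s))\<^sup>2) * indicator {0..S} s
          \<le> ennreal 1600 * (\<integral>\<^sup>+ w. energy w * indicator (cone n k e) (s, w) \<partial>lborel)"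
      proof (cases "s \<in> {0..S}")
        case True
        with S have s: "0 \<le> s" "s < 1" by auto
        \<comment> \<open>\<open>2 * r\<close> is the radius of the disc in \<open>cone\<close>.
          Since \<open>norm (H s) * (1 - s)\<close> is at most
          \<open>20 * r * norm (deriv h (seg n k e s))\<close>, the mean value constant
          \<open>4 / r\<^sup>2\<close> leaves 400 * 4 = 1600.\<close>
        define r where "r = (1 - s) / (4 * 2 ^ n)"
        have r: "r > 0" "2 * r = (1 - s) / 2 ^ Suc n" using s by (auto simp: r_def field_simps)
        have sub: "ball (seg n k e s) (2 * r) \<subseteq> ball 0 1"
        proof
          fix w assume "w \<in> ball (seg n k e s) (2 * r)"
          then have "norm w < norm (seg n k e s) + 2 * r"
            using norm_triangle_sub[of w "seg n k e s"] by (simp add: dist_norm norm_minus_commute)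
          moreover have "2 * r \<le> (1 - s) / 2 ^ n" using r s by (simp add: field_simps)
          ultimately show "w \<in> ball 0 1" using seg_bounds(1)[OF e, of s n k] s by simp
        qed
        have "norm (H s) * (1 - s) \<le> norm (deriv h (seg n k e s)) * (5 / 2 ^ n) * (1 - s)"
          unfolding H_def norm_mult using s \<zeta>apex by (intro mult_right_mono mult_left_mono) auto
        also have "\<dots> = 20 * r * norm (deriv h (seg n k e s))" by (simp add: r_def field_simps)
        finally have "(norm (H s) * (1 - s))\<^sup>2 \<le> (20 * r * norm (deriv h (seg n k e s)))\<^sup>2"
          using s by (intro power_mono) auto
        also have "\<dots> = 400 * r\<^sup>2 * (norm (deriv h (seg n k e s)))\<^sup>2"
          by (simp add: power_mult_distrib)
        finally have "ennreal ((norm (H s) * (1 - s))\<^sup>2) \<le> ennreal (400 * r\<^sup>2) * ennreal ((norm (deriv h (seg n k e s)))\<^sup>2)"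
          by (simp add: ennreal_mult[symmetric] ennreal_leI)
        also have "\<dots> \<le> ennreal (400 * r\<^sup>2) * (ennreal (4 / r\<^sup>2) * energy_on (ball (seg n k e s) (2 * r)))"
          by (intro mult_left_mono norm_dh_square_le sub r) auto
        also have "\<dots> = ennreal 1600 * energy_on (ball (seg n k e s) (2 * r))"
          using r by (subst mult.assoc[symmetric], subst ennreal_mult[symmetric]) auto
        also have "energy_on (ball (seg n k e s) (2 * r)) = (\<integral>\<^sup>+ w. energy w * indicator (cone n k e) (s, w) \<partial>lborel)"
          using s unfolding r(2) by (intro nn_integral_cong) (auto simp: cone_def split: split_indicator)
        finally show ?thesis using True by simp
      qed auto
    qed
    also have "\<dots> = ennreal 1600 * cone_energy n k e"
      unfolding cone_energy_def by (rule nn_integral_cmult) measurable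
    finally show ?thesis .
  qed
  show "ennreal ((norm R)\<^sup>2) \<le> ennreal (3200 * (norm A)\<^sup>2) * cone_energy n k e"
  \<comment> \<open>In \<open>ennreal\<close> zero times infinity is 0, so for infinite energy the
    case \<open>A = 0\<close> has to be settled by the first bound.\<close>
  proof (cases "cone_energy n k e = \<infinity>")
    case True
    then show ?thesis
    proof (cases "A = 0")
      case True
      have "(norm R)\<^sup>2 \<le> 2 * (norm A)\<^sup>2 * (5 * \<eta>)\<^sup>2" by fact
      then show ?thesis using \<open>A = 0\<close> by simp
    qed (simp add: ennreal_mult_top)
  next
    case False
    then obtain c where c: "cone_energy n k e = ennreal c" "0 \<le> c"
      by (cases "cone_energy n k e") auto
    have "(norm R)\<^sup>2 \<le> 2 * (norm A)\<^sup>2 * (1600 * c)"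
      unfolding R
    proof (rule taylor[OF _ _ _ _ _ _ \<kappa>])
      fix S :: real assume S: "0 \<le> S" "S < 1"
      show "integral {0..S} (\<lambda>s. (norm (H s) * (1 - s))\<^sup>2) \<le> 1600 * c"
        using E[OF S] c by (subst ennreal_le_iff[symmetric]) (simp_all add: ennreal_mult)
    qed auto
    then show ?thesis using c by (simp add: ennreal_mult[symmetric] ennreal_leI)
  qed
qed

lemma f_dpt_inj: "dpt n k \<noteq> dpt n l \<Longrightarrow> f (dpt n k) \<noteq> f (dpt n l)"
  using inj_onD[OF f_inj, of "dpt n k" "dpt n l"] by auto

lemma dist_dpt_Suc_ge:
  assumes "n \<ge> 1"
  shows "4 / 2 ^ n \<le> norm (dpt n k - dpt n (Suc k))"
proof -
  have "(2::real) ^ 1 \<le> 2 ^ n" using assms by (intro power_increasing) auto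
  then have "\<bar>real k / 2 ^ n - real (Suc k) / 2 ^ n\<bar> \<le> 1/2"
    by (simp add: diff_divide_distrib[symmetric] field_simps)
  from dist_cis_ge[OF this] show ?thesis
    by (simp add: dpt_def dist_norm diff_divide_distrib[symmetric])
qed

lemma chord_pos:
  assumes "n \<ge> 1"
  shows "chord n k > 0"
proof -
  have "0 < (4::real) / 2 ^ n" by simp
  also note dist_dpt_Suc_ge[OF assms, of k]
  finally show ?thesis
    using f_dpt_inj[of n k "Suc k"] by (simp add: chord_def)
qed

text \<open>For the midpoint m of a circular arc with endpoints a and b one has a b = m^2, so the
  second difference factors, up to a unimodular factor, into the two first differences. This makes
  it quadratic in the length.\<close>

lemma dpt_second_difference:
  "norm (dpt (Suc n) (2 * k) - 2 * dpt (Suc n) (2 * k + 1) + dpt (Suc n) (2 * k + 2)) \<le> 16 / (2 ^ n)\<^sup>2"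
proof -
  define m a b where "m = dpt (Suc n) (2 * k + 1)" and "a = dpt (Suc n) (2 * k)" and "b = dpt (Suc n) (2 * k + 2)"
  have "a * b = m * m"
    unfolding a_def b_def m_def dpt_def cis_mult
    by (rule arg_cong[of _ _ cis]) (simp add: add_divide_distrib algebra_simps)
  then have "(a - 2 * m + b) * m = - ((a - m) * (b - m))"
    by (simp add: algebra_simps)
  then have "norm (a - 2 * m + b) * norm m = norm (a - m) * norm (b - m)"
    by (simp only: norm_mult[symmetric] norm_minus_cancel)
  also have "\<dots> \<le> (4 / 2 ^ n) * (4 / 2 ^ n)"
    using dpt_mid_dist[of 0 n k] dpt_mid_dist[of 2 n k]
    by (intro mult_mono) (auto simp: a_def b_def m_def)
  finally show ?thesis by (simp add: a_def b_def m_def power2_eq_square)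
qed

text \<open>The linear part of the expansion at the apex contributes only the second difference of
  three points of the circle, of order \<open>d\<^sup>2\<close>; the rest of
  \<open>second_diff\<close> consists of remainders. Division by a chord of at least
  \<open>3 * d * D\<close> gives 16/3 <= 6 and 4 * 36 / 3 = 48 in the first bound. The energy form
  of the remainders gives the second, with 1024/9 <= 120 and 2 * 80000 = 160000.\<close>

lemma bend_bounds:
  assumes n: "n \<ge> 1"
    and small: "\<And>z. z \<in> ball 0 1 \<Longrightarrow> 1 - norm z \<le> 5 / 2 ^ n \<Longrightarrow> norm (deriv h z) * (1 - norm z) \<le> \<eta>"
    and \<eta>: "\<eta> \<le> 1/72" "\<eta> \<ge> 0"
  shows "bend n k \<le> 6 / 2 ^ n + 48 * \<eta>"
    and "ennreal ((bend n k)\<^sup>2) \<le> ennreal (120 / 4 ^ n) + ennreal 160000 * (\<Sum>e\<le>2. cone_energy n k e)"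
proof -
  define d :: real where "d = 1 / 2 ^ n"
  define D where "D = norm (deriv f (apex n k))"
  define \<zeta> where "\<zeta> e = dpt (Suc n) (2 * k + e)" for e
  define A where "A e = deriv f (apex n k) * (\<zeta> e - apex n k)" for e
  define R where "R e = f (\<zeta> e) - f (apex n k) - A e" for e
  have d: "0 < d" "d \<le> 1" by (auto simp: d_def)
  have "apex n k \<in> ball 0 1" using d norm_apex[of n k] by (simp add: d_def)
  then have D: "D > 0" using exp_h[of "apex n k"] exp_not_eq_zero by (metis D_def zero_less_norm_iff)
  have A: "norm (A e) \<le> 5 * d * D" if "e \<le> 2" for e
    using mult_left_mono[OF apex_endpoint_dist[OF that, of n k], of D] D
    by (simp add: A_def norm_mult D_def[symmetric] \<zeta>_def d_def mult_ac)
  have A2: "(norm (A e))\<^sup>2 \<le> 25 * d\<^sup>2 * D\<^sup>2" if "e \<le> 2" for e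
    using power_mono[OF A[OF that], of 2] by (simp add: power_mult_distrib)
  have R: "norm (R e) \<le> 36 * d * D * \<eta>" if e: "e \<le> 2" for e
  proof (rule power2_le_imp_le)
    have "(norm (R e))\<^sup>2 \<le> 2 * (norm (A e))\<^sup>2 * (5 * \<eta>)\<^sup>2"
      unfolding R_def A_def \<zeta>_def using \<eta> by (intro taylor_seg(1)[OF e small]) auto
    also have "\<dots> \<le> 2 * (25 * d\<^sup>2 * D\<^sup>2) * (5 * \<eta>)\<^sup>2"
      by (intro mult_right_mono mult_left_mono A2 e) auto
    also have "\<dots> = 1250 * (d * D * \<eta>)\<^sup>2" by (simp add: power_mult_distrib)
    also have "\<dots> \<le> 1296 * (d * D * \<eta>)\<^sup>2" by (intro mult_right_mono) auto
    also have "\<dots> = (36 * d * D * \<eta>)\<^sup>2" by (simp add: power_mult_distrib)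
    finally show "(norm (R e))\<^sup>2 \<le> (36 * d * D * \<eta>)\<^sup>2" .
  qed (use d D \<eta> in auto)
  have RE: "ennreal ((norm (R e))\<^sup>2) \<le> ennreal (80000 * d\<^sup>2 * D\<^sup>2) * cone_energy n k e" if e: "e \<le> 2" for e
  proof -
    have "ennreal ((norm (R e))\<^sup>2) \<le> ennreal (3200 * (norm (A e))\<^sup>2) * cone_energy n k e"
      unfolding R_def A_def \<zeta>_def using \<eta> by (intro taylor_seg(2)[OF e small]) auto
    also have "\<dots> \<le> ennreal (80000 * d\<^sup>2 * D\<^sup>2) * cone_energy n k e"
      using A2[OF e] by (intro mult_right_mono ennreal_leI) (linarith | simp)+
    finally show ?thesis .
  qed
  have f\<zeta>: "f (\<zeta> e) = f (apex n k) + deriv f (apex n k) * (\<zeta> e - apex n k) + R e" for e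
    by (simp add: R_def A_def)
  have \<zeta>s: "dpt n k = \<zeta> 0" "dpt n (Suc k) = \<zeta> 2"
    using dpt_double[of n k] dpt_double[of n "Suc k"] by (auto simp: \<zeta>_def)
  \<comment> \<open>The linear part of the chord is at least \<open>4 * d * D\<close>, and the two
    remainders take away at most \<open>72 * \<eta> * d * D\<close>; hence the bound 1/72 for
    \<open>\<eta>\<close>.\<close>
  have chord: "chord n k \<ge> 3 * d * D"
  proof -
    have "4 * d * D \<le> norm (\<zeta> 0 - \<zeta> 2) * D"
      using mult_right_mono[OF dist_dpt_Suc_ge[OF n, of k], of D] D by (simp add: \<zeta>s d_def)
    also have "\<dots> = norm ((f (\<zeta> 0) - f (\<zeta> 2)) - (R 0 - R 2))"
      unfolding f\<zeta> D_def norm_mult[symmetric] by (simp add: algebra_simps)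
    also have "\<dots> \<le> chord n k + (norm (R 0) + norm (R 2))"
      unfolding chord_def \<zeta>s by (rule order_trans[OF norm_triangle_ineq4 add_mono[OF order_refl norm_triangle_ineq4]])
    also have "\<dots> \<le> chord n k + (36 * d * D * \<eta> + 36 * d * D * \<eta>)"
      by (intro add_mono R) auto
    finally have "4 * d * D \<le> chord n k + d * D * (72 * \<eta>)" by (simp add: mult_ac)
    also have "d * D * (72 * \<eta>) \<le> d * D * 1" using d D \<eta> by (intro mult_left_mono) auto
    finally show ?thesis by (simp add: mult_ac)
  qed
  have c0: "chord n k > 0" by (rule chord_pos[OF n])
  have sd: "second_diff n k \<le> 16 * d\<^sup>2 * D + (norm (R 0) + 2 * norm (R 1) + norm (R 2))"
  proof -
    have "second_diff n k = norm (f (\<zeta> 0) - 2 * f (\<zeta> 1) + f (\<zeta> 2))"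
      by (simp add: second_diff_def \<zeta>_def)
    also have "\<dots> = norm (deriv f (apex n k) * (\<zeta> 0 - 2 * \<zeta> 1 + \<zeta> 2) + (R 0 - 2 * R 1 + R 2))"
      unfolding f\<zeta> by (simp add: algebra_simps)
    also have "\<dots> \<le> norm (deriv f (apex n k) * (\<zeta> 0 - 2 * \<zeta> 1 + \<zeta> 2)) + norm (R 0 - 2 * R 1 + R 2)"
      by (rule norm_triangle_ineq)
    also have "norm (deriv f (apex n k) * (\<zeta> 0 - 2 * \<zeta> 1 + \<zeta> 2)) \<le> D * (16 * d\<^sup>2)"
      using dpt_second_difference[of n k] unfolding norm_mult D_def
      by (intro mult_left_mono) (auto simp: \<zeta>_def d_def power_divide)
    also have "norm (R 0 - 2 * R 1 + R 2) \<le> norm (R 0) + norm (2 * R 1) + norm (R 2)"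
      by (rule order_trans[OF norm_triangle_ineq add_mono[OF norm_triangle_ineq4 order_refl]])
    finally show ?thesis by (simp add: mult_ac norm_mult)
  qed
  have "second_diff n k \<le> 16 * d\<^sup>2 * D + (36 * d * D * \<eta> + 2 * (36 * d * D * \<eta>) + 36 * d * D * \<eta>)"
    by (rule order_trans[OF sd]) (intro add_mono mult_left_mono order_refl R, auto)
  also have "\<dots> = (16 / 3 * d + 48 * \<eta>) * (3 * d * D)"
    by (simp add: algebra_simps power2_eq_square)
  also have "\<dots> \<le> (6 * d + 48 * \<eta>) * chord n k"
    using d D \<eta> chord by (intro mult_mono) auto
  finally show "bend n k \<le> 6 / 2 ^ n + 48 * \<eta>"
    using c0 by (simp add: bend_def d_def pos_divide_le_eq)
  \<comment> \<open>Cauchy-Schwarz for the four summands x, a, 2 b and c.\<close>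
  have sq4: "(x + (a + 2 * b + c))\<^sup>2 \<le> 4 * x\<^sup>2 + 16 * (a\<^sup>2 + b\<^sup>2 + c\<^sup>2)" for x a b c :: real
  proof -
    have "4 * x\<^sup>2 + 16 * (a\<^sup>2 + b\<^sup>2 + c\<^sup>2) - (x + (a + 2 * b + c))\<^sup>2
        = (x - a)\<^sup>2 + (x - 2 * b)\<^sup>2 + (x - c)\<^sup>2 + (a - 2 * b)\<^sup>2 + (a - c)\<^sup>2 + (2 * b - c)\<^sup>2 + 12 * a\<^sup>2 + 12 * c\<^sup>2"
      by (simp add: power2_eq_square algebra_simps)
    moreover have "0 \<le> \<dots>" by simp
    ultimately show ?thesis by linarith
  qed
  have "(bend n k)\<^sup>2 = (second_diff n k)\<^sup>2 / (chord n k)\<^sup>2"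
    by (simp add: bend_def power_divide)
  also have "\<dots> \<le> (16 * d\<^sup>2 * D + (norm (R 0) + 2 * norm (R 1) + norm (R 2)))\<^sup>2 / (3 * d * D)\<^sup>2"
    using d D chord sd by (intro frac_le power_mono) (auto simp: second_diff_def)
  also have "\<dots> \<le> (4 * (16 * d\<^sup>2 * D)\<^sup>2 + 16 * ((norm (R 0))\<^sup>2 + (norm (R 1))\<^sup>2 + (norm (R 2))\<^sup>2)) / (3 * d * D)\<^sup>2"
    by (intro divide_right_mono sq4) auto
  also have "\<dots> = 1024 / 9 * d\<^sup>2 + 16 / 9 * (((norm (R 0))\<^sup>2 + (norm (R 1))\<^sup>2 + (norm (R 2))\<^sup>2) / (d\<^sup>2 * D\<^sup>2))"
    using d D by (simp add: power_mult_distrib field_simps)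
  also have "\<dots> \<le> 120 * d\<^sup>2 + 2 / (d\<^sup>2 * D\<^sup>2) * (\<Sum>e\<le>2. (norm (R e))\<^sup>2)"
  proof -
    have sum: "(\<Sum>e\<le>2. (norm (R e))\<^sup>2) = (norm (R 0))\<^sup>2 + (norm (R 1))\<^sup>2 + (norm (R 2))\<^sup>2"
      by (simp add: numeral_2_eq_2)
    have "16 / 9 * (x / y) \<le> 2 / y * x" if "0 \<le> x" "0 \<le> y" for x y :: real
    proof -
      have "16 / 9 * (x / y) \<le> 2 * (x / y)" using that by (intro mult_right_mono) auto
      then show ?thesis by simp
    qed
    moreover have "1024 / 9 * d\<^sup>2 \<le> 120 * d\<^sup>2" by simp
    ultimately show ?thesis
      unfolding sum by (rule add_mono[rotated]) auto
  qed
  finally have "ennreal ((bend n k)\<^sup>2) \<le> ennreal (120 * d\<^sup>2 + 2 / (d\<^sup>2 * D\<^sup>2) * (\<Sum>e\<le>2. (norm (R e))\<^sup>2))"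
    by (rule ennreal_leI)
  also have "\<dots> = ennreal (120 * d\<^sup>2) + ennreal (2 / (d\<^sup>2 * D\<^sup>2)) * (\<Sum>e\<le>2. ennreal ((norm (R e))\<^sup>2))"
  proof -
    have "0 \<le> 120 * d\<^sup>2" "0 \<le> 2 / (d\<^sup>2 * D\<^sup>2)" "0 \<le> (\<Sum>e\<le>2. (norm (R e))\<^sup>2)"
      by (auto intro: sum_nonneg)
    then show ?thesis
      by (simp only: ennreal_plus ennreal_mult mult_nonneg_nonneg sum_ennreal zero_le_power2)
  qed
  also have "\<dots> \<le> ennreal (120 * d\<^sup>2) + ennreal (2 / (d\<^sup>2 * D\<^sup>2)) * (\<Sum>e\<le>2. ennreal (80000 * d\<^sup>2 * D\<^sup>2) * cone_energy n k e)"
    by (intro add_mono order_refl mult_left_mono sum_mono RE) auto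
  also have "\<dots> = ennreal (120 * d\<^sup>2) + ennreal (2 / (d\<^sup>2 * D\<^sup>2) * (80000 * d\<^sup>2 * D\<^sup>2)) * (\<Sum>e\<le>2. cone_energy n k e)"
    using d D by (simp add: sum_distrib_left[symmetric] mult.assoc[symmetric] ennreal_mult[symmetric])
  also have "2 / (d\<^sup>2 * D\<^sup>2) * (80000 * d\<^sup>2 * D\<^sup>2) = 160000"
    using d D by simp
  also have "120 * d\<^sup>2 = 120 / 4 ^ n"
    by (simp add: d_def power_divide power2_eq_square flip: power_mult_distrib)
  finally show "ennreal ((bend n k)\<^sup>2) \<le> ennreal (120 / 4 ^ n) + ennreal 160000 * (\<Sum>e\<le>2. cone_energy n k e)" .
qed

end

section \<open>Overlap of the cones\<close>

definition mid :: "nat \<Rightarrow> nat \<Rightarrow> complex" where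
  "mid n k = dpt (Suc n) (2 * k + 1)"

lemma norm_mid [simp]: "norm (mid n k) = 1"
  by (simp add: mid_def)

lemma mid_cis: "mid n k = cis (2 * pi * ((real k + 1/2) / 2 ^ n))"
proof -
  have "real (2 * k + 1) / 2 ^ Suc n = (real k + 1/2) / 2 ^ n"
    by (simp add: field_simps)
  then show ?thesis by (simp only: mid_def dpt_def)
qed

text \<open>Two such midpoints are within 20 / 2^n of each other, so by \<open>cis_near\<close>
  their indices differ by at most 5 modulo 2^n. As n >= 3 gives 5 < 2^n, only the shifts m = -1, 0,
  1 occur, with 11 indices each.\<close>

lemma card_mid_near:
  assumes "n \<ge> 3"
  shows "card {k. k < 2 ^ n \<and> norm (w - mid n k) \<le> 10 / 2 ^ n} \<le> 33"
proof (cases "{k. k < 2 ^ n \<and> norm (w - mid n k) \<le> 10 / 2 ^ n} = {}")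
  case False
  then obtain k where k: "k < 2 ^ n" "norm (w - mid n k) \<le> 10 / 2 ^ n" by auto
  define S :: "int set" where "S = (\<Union>m\<in>{-1, 0, 1}. {int k - m * 2 ^ n - 5 .. int k - m * 2 ^ n + 5})"
  have "int l \<in> S" if l: "l < 2 ^ n" "norm (w - mid n l) \<le> 10 / 2 ^ n" for l
  proof -
    obtain m :: int where m: "4 * \<bar>(real k + 1/2) / 2 ^ n - (real l + 1/2) / 2 ^ n - of_int m\<bar> \<le> dist (mid n k) (mid n l)"
      using cis_near unfolding mid_cis by blast
    also have "dist (mid n k) (mid n l) \<le> dist w (mid n k) + dist w (mid n l)"
      by (rule dist_triangle3)
    also have "\<dots> \<le> 20 / 2 ^ n" using k l by (simp add: dist_norm)
    finally have "\<bar>(real k - real l) / 2 ^ n - of_int m\<bar> \<le> 5 / 2 ^ n"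
      by (simp add: diff_divide_distrib add_divide_distrib)
    then have "\<bar>(real k - real l) / 2 ^ n - of_int m\<bar> * 2 ^ n \<le> 5" by (simp add: field_simps)
    also have "\<bar>(real k - real l) / 2 ^ n - of_int m\<bar> * 2 ^ n = \<bar>((real k - real l) / 2 ^ n - of_int m) * 2 ^ n\<bar>"
      by (simp add: abs_mult)
    also have "((real k - real l) / 2 ^ n - of_int m) * 2 ^ n = real k - real l - of_int m * 2 ^ n"
      by (simp add: field_simps)
    finally have "\<bar>real k - real l - of_int m * 2 ^ n\<bar> \<le> 5" .
    then have "\<bar>real_of_int (int k - int l - m * 2 ^ n)\<bar> \<le> 5" by simp
    then have *: "\<bar>int k - int l - m * 2 ^ n\<bar> \<le> 5" by linarith
    have "(8::int) \<le> 2 ^ n"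
      using power_increasing[OF assms, of "2::int"] by simp
    moreover have "\<bar>int k - int l\<bar> < 2 ^ n"
    proof -
      have "int k < int (2 ^ n)" "int l < int (2 ^ n)" using k l by (simp_all only: of_nat_less_iff)
      then have "int k < 2 ^ n" "int l < 2 ^ n" by (simp_all only: of_nat_power of_nat_numeral)
      then show ?thesis by linarith
    qed
    ultimately have "\<bar>m * 2 ^ n\<bar> < 2 * 2 ^ n" using * by linarith
    then have "\<bar>m\<bar> < 2" by (simp add: abs_mult)
    then have "m \<in> {-1, 0, 1}" by auto
    with * show ?thesis unfolding S_def by (intro UN_I[of m]) auto
  qed
  then have "card {k. k < 2 ^ n \<and> norm (w - mid n k) \<le> 10 / 2 ^ n} \<le> card S"
    by (intro card_inj_on_le[of int]) (blast | simp add: S_def inj_on_def)+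
  also have "\<dots> \<le> (\<Sum>m\<in>{-1, 0, 1 :: int}. card {int k - m * 2 ^ n - 5 .. int k - m * 2 ^ n + 5})"
    unfolding S_def by (rule card_UN_le) simp
  also have "\<dots> = 33" by simp
  finally show ?thesis .
next
  case True
  then show ?thesis by (simp only: card.empty)
qed

text \<open>This fixes the indexing used throughout: the arcs j generations below
  \<open>(n, k)\<close> are \<open>(n + j, k * 2 ^ j + i)\<close> with
  \<open>i < 2 ^ j\<close>.\<close>

lemma descendant_less: "k < 2 ^ n \<Longrightarrow> i < 2 ^ j \<Longrightarrow> k * 2 ^ j + i < (2::nat) ^ (n + j)"
proof -
  assume k: "k < 2 ^ n" and "i < 2 ^ j"
  then have "k * 2 ^ j + i < Suc k * 2 ^ j" by simp
  also have "\<dots> \<le> 2 ^ n * 2 ^ j" using k by (intro mult_right_mono) auto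
  finally show ?thesis by (simp add: power_add)
qed

lemma mid_descendant_dist:
  assumes "i < 2 ^ j"
  shows "norm (mid (n0 + j) (k0 * 2 ^ j + i) - mid n0 k0) \<le> 4 / 2 ^ n0"
proof -
  have "(real (k0 * 2 ^ j + i) + 1/2) / 2 ^ (n0 + j) - (real k0 + 1/2) / 2 ^ n0 = ((real i + 1/2) / 2 ^ j - 1/2) / 2 ^ n0"
    by (simp add: power_add field_simps)
  moreover have "real i + 1/2 \<le> 2 ^ j"
  proof -
    have "real (Suc i) \<le> real (2 ^ j)" using assms by (intro of_nat_mono) simp
    then show ?thesis by simp
  qed
  then have "\<bar>(real i + 1/2) / 2 ^ j - 1/2\<bar> \<le> 1/2"
    by (auto simp: abs_le_iff field_simps)
  ultimately have "\<bar>(real (k0 * 2 ^ j + i) + 1/2) / 2 ^ (n0 + j) - (real k0 + 1/2) / 2 ^ n0\<bar> \<le> (1/2) / 2 ^ n0"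
    using divide_right_mono[of "\<bar>(real i + 1/2) / 2 ^ j - 1/2\<bar>" "1/2" "2 ^ n0"] by (simp add: abs_divide)
  then have "8 * \<bar>(real (k0 * 2 ^ j + i) + 1/2) / 2 ^ (n0 + j) - (real k0 + 1/2) / 2 ^ n0\<bar> \<le> 4 / 2 ^ n0"
    by simp
  then show ?thesis
    using dist_cis_le[of "(real (k0 * 2 ^ j + i) + 1/2) / 2 ^ (n0 + j)" "(real k0 + 1/2) / 2 ^ n0"]
    unfolding mid_cis dist_norm by (auto intro: order_trans)
qed

text \<open>The last summand dominates, because going back one generation costs at least a factor
  \<sigma> / 2 < 1. The constant C = 2 / (2 - \<sigma>) is the sum of that geometric series and
  satisfies C \<sigma> / 2 + 1 = C, which is the induction step.\<close>

lemma weighted_sum_le: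
  fixes wt :: "nat \<Rightarrow> real"
  assumes wt: "\<And>n. n0 \<le> n \<Longrightarrow> 0 \<le> wt n" "\<And>n. n0 \<le> n \<Longrightarrow> wt n \<le> \<sigma> * wt (Suc n)" and \<sigma>: "0 \<le> \<sigma>" "\<sigma> < 2"
    and "n0 \<le> N"
  shows "(\<Sum>n=n0..N. wt n * 2 ^ n) \<le> 2 / (2 - \<sigma>) * wt N * 2 ^ N"
  using \<open>n0 \<le> N\<close>
proof (induction N rule: dec_induct)
  case base
  have "1 * (wt n0 * 2 ^ n0) \<le> 2 / (2 - \<sigma>) * (wt n0 * 2 ^ n0)"
    using \<sigma> wt(1)[of n0] by (intro mult_right_mono) auto
  then show ?case by simp
next
  case (step N)
  have "(\<Sum>n=n0..Suc N. wt n * 2 ^ n) \<le> 2 / (2 - \<sigma>) * wt N * 2 ^ N + wt (Suc N) * 2 ^ Suc N"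
    using step by simp
  also have "\<dots> \<le> 2 / (2 - \<sigma>) * (\<sigma> * wt (Suc N)) * 2 ^ N + wt (Suc N) * 2 ^ Suc N"
    using \<sigma> step by (intro add_mono mult_right_mono mult_left_mono wt(2)) auto
  also have "\<dots> = 2 / (2 - \<sigma>) * wt (Suc N) * 2 ^ Suc N"
    using \<sigma> by (simp add: field_simps)
  finally show ?case .
qed

context conformal_log
begin

text \<open>The length of the set of parameters s whose disc contains w, that is, the weight with
  which the energy at w is counted in \<open>cone_energy\<close>.\<close>

definition slice :: "nat \<Rightarrow> nat \<Rightarrow> nat \<Rightarrow> complex \<Rightarrow> ennreal" where
  "slice n k e w = (\<integral>\<^sup>+ s. indicator (cone n k e) (s, w) \<partial>lborel)"

lemma measurable_slice [measurable]: "slice n k e \<in> borel_measurable borel"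
proof -
  have "(\<lambda>w. \<integral>\<^sup>+ s. indicator (cone n k e) (s, w) \<partial>(lborel :: real measure)) \<in> borel_measurable borel"
    by (rule lborel.borel_measurable_nn_integral) (simp add: case_prod_beta' borel_prod[symmetric])
  then show ?thesis unfolding slice_def .
qed

lemma cone_energy_eq: "cone_energy n k e = (\<integral>\<^sup>+ w. energy w * slice n k e w \<partial>lborel)"
proof -
  have "cone_energy n k e = (\<integral>\<^sup>+ w. \<integral>\<^sup>+ s. energy w * indicator (cone n k e) (s, w) \<partial>lborel \<partial>lborel)"
    unfolding cone_energy_def
    by (rule lborel_pair.Fubini'[symmetric]) (simp add: case_prod_beta')
  also have "\<dots> = (\<integral>\<^sup>+ w. energy w * slice n k e w \<partial>lborel)"
    unfolding slice_def by (intro nn_integral_cong nn_integral_cmult) measurable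
  finally show ?thesis .
qed

text \<open>If w lies in the disc with parameter s, its height is at least half of
  \<open>(1 - s) / 2 ^ n\<close>, so s runs through an interval of length
  \<open>2 * 2 ^ n * (1 - norm w)\<close> ending at 1. In units of \<open>1 / 2 ^ n\<close>, the
  radius 10 adds up at most 1 for the disc, 5 for the way to the endpoint and 4 from there to the
  midpoint.\<close>

lemma slice_le:
  assumes e: "e \<le> 2"
  shows "slice n k e w \<le> ennreal (2 * 2 ^ n * (1 - norm w)) * indicator {w. norm (w - mid n k) \<le> 10 / 2 ^ n} w"
proof -
  have s: "1 - 2 * 2 ^ n * (1 - norm w) \<le> s \<and> s \<le> 1 \<and> norm (w - mid n k) \<le> 10 / 2 ^ n" if "(s, w) \<in> cone n k e" for s
  proof -
    from that have s: "0 \<le> s" "s < 1" and d: "dist (seg n k e s) w < (1 - s) / 2 ^ Suc n"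
      by (auto simp: cone_def)
    note b = seg_bounds[OF e s(1) less_imp_le[OF s(2)], of n k]
    have "norm w \<le> norm (seg n k e s) + (1 - s) / 2 ^ Suc n"
      using d norm_triangle_sub[of w "seg n k e s"] by (simp add: dist_norm norm_minus_commute)
    then have "(1 - s) / 2 ^ Suc n \<le> 1 - norm w"
      using b(1) by (simp add: field_simps)
    then have "1 - 2 * 2 ^ n * (1 - norm w) \<le> s" by (simp add: field_simps)
    moreover have "norm (w - mid n k) \<le> 10 / 2 ^ n"
    proof -
      have "norm (w - mid n k) \<le> dist w (seg n k e s) + dist (seg n k e s) (dpt (Suc n) (2 * k + e)) + dist (dpt (Suc n) (2 * k + e)) (mid n k)"
        unfolding dist_norm[symmetric, of w] by (metis add_right_mono dist_triangle order_trans)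
      also have "\<dots> \<le> (1 - s) / 2 ^ Suc n + 5 * (1 - s) / 2 ^ n + 4 / 2 ^ n"
        using d b(3) dpt_mid_dist[OF e, of n k] by (intro add_mono) (auto simp: dist_norm norm_minus_commute mid_def)
      also have "\<dots> \<le> 1 / 2 ^ n + 5 / 2 ^ n + 4 / 2 ^ n"
        using s by (intro add_mono frac_le) auto
      finally show ?thesis by simp
    qed
    ultimately show ?thesis using s by auto
  qed
  show ?thesis
  proof (cases "norm (w - mid n k) \<le> 10 / 2 ^ n \<and> norm w \<le> 1")
    case True
    have "slice n k e w \<le> (\<integral>\<^sup>+ t. indicator {1 - 2 * 2 ^ n * (1 - norm w)..1} t \<partial>lborel)"
      unfolding slice_def using s by (intro nn_integral_mono) (auto split: split_indicator)
    also have "\<dots> = ennreal (2 * 2 ^ n * (1 - norm w))"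
      using True by simp
    finally show ?thesis using True by simp
  next
    case False
    have "indicator (cone n k e) (t, w) = (0::ennreal)" for t
    proof -
      have "(t, w) \<notin> cone n k e"
      proof
        assume c: "(t, w) \<in> cone n k e"
        from s[OF c] False have "norm w > 1" by auto
        then have "2 * 2 ^ n * (1 - norm w) < 0" by (intro mult_pos_neg) auto
        with s[OF c] show False by linarith
      qed
      then show ?thesis by simp
    qed
    then show ?thesis by (simp add: slice_def)
  qed
qed

text \<open>At most 33 midpoints of generation n are near enough to count. As they lie on the
  circle, there are none unless w itself has height at most \<open>10 / 2 ^ n\<close>.\<close>

lemma sum_slice_le:
  assumes n: "n \<ge> 3" and K: "K \<subseteq> {..<2 ^ n}" and e: "e \<le> 2" and w: "norm w < 1"
  shows "(\<Sum>k\<in>K. slice n k e w) \<le> ennreal (66 * 2 ^ n * (1 - norm w)) * indicator {w. 1 - norm w \<le> 10 / 2 ^ n} w"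
proof -
  define B where "B = {k. k < 2 ^ n \<and> norm (w - mid n k) \<le> 10 / 2 ^ n}"
  have fin: "finite K" "finite B" using K finite_subset by (auto simp: B_def)
  have "(\<Sum>k\<in>K. slice n k e w) \<le> (\<Sum>k\<in>K. if k \<in> B then ennreal (2 * 2 ^ n * (1 - norm w)) else 0)"
  proof (rule sum_mono)
    fix k assume "k \<in> K"
    with K have "k < 2 ^ n" by auto
    with slice_le[OF e, of n k w] show "slice n k e w \<le> (if k \<in> B then ennreal (2 * 2 ^ n * (1 - norm w)) else 0)"
      by (cases "norm (w - mid n k) \<le> 10 / 2 ^ n") (auto simp: B_def)
  qed
  also have "\<dots> = (\<Sum>k\<in>K \<inter> B. ennreal (2 * 2 ^ n * (1 - norm w)))"
    by (rule sum.inter_restrict[OF fin(1), symmetric])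
  also have "\<dots> \<le> (\<Sum>k\<in>B. ennreal (2 * 2 ^ n * (1 - norm w)))"
    using fin by (intro sum_mono2) auto
  also have "\<dots> = of_nat (card B) * ennreal (2 * 2 ^ n * (1 - norm w))" by simp
  also have "\<dots> \<le> ennreal (66 * 2 ^ n * (1 - norm w)) * indicator {w. 1 - norm w \<le> 10 / 2 ^ n} w"
  proof (cases "B = {}")
    case False
    then obtain k where "norm (w - mid n k) \<le> 10 / 2 ^ n" by (auto simp: B_def)
    then have "1 - norm w \<le> 10 / 2 ^ n"
      using norm_triangle_ineq2[of "mid n k" w] by (simp add: norm_minus_commute)
    moreover have "ennreal (real (card B)) * ennreal (2 * 2 ^ n * (1 - norm w)) \<le> ennreal 33 * ennreal (2 * 2 ^ n * (1 - norm w))"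
      using card_mid_near[OF n, of w] by (intro mult_right_mono ennreal_leI) (auto simp: B_def)
    moreover have "ennreal 33 * ennreal (2 * 2 ^ n * (1 - norm w)) = ennreal (66 * 2 ^ n * (1 - norm w))"
      using w by (subst ennreal_mult[symmetric]) auto
    ultimately show ?thesis by (simp add: ennreal_of_nat_eq_real_of_nat)
  qed simp
  finally show ?thesis .
qed

text \<open>Here and below \<open>wt n\<close> is the weight of an arc of length \<open>1 / 2 ^ n\<close> and \<open>\<Omega> t\<close> the weight of a point
  at distance \<open>t\<close> from the circle; \<open>\<sigma> < 2\<close> is where \<open>p < 1\<close> is needed.\<close>

lemma slice_sum_le:
  fixes wt \<Omega> :: "nat \<Rightarrow> real" and K \<sigma> :: real
  assumes n0: "n0 \<ge> 3" and k0: "k0 < 2 ^ n0"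
    and wt: "\<And>n. n0 \<le> n \<Longrightarrow> 0 \<le> wt n" "\<And>n. n0 \<le> n \<Longrightarrow> wt n \<le> \<sigma> * wt (Suc n)" and \<sigma>: "0 \<le> \<sigma>" "\<sigma> < 2"
    and w: "norm w < 1"
    and B: "\<And>N. n0 \<le> N \<Longrightarrow> 1 - norm w \<le> 10 / 2 ^ N \<Longrightarrow> 10 / 2 ^ Suc N < 1 - norm w \<Longrightarrow> wt N \<le> B"
  shows "(\<Sum>j. ennreal (wt (n0 + j)) * (\<Sum>i<2^j. \<Sum>e\<le>2. slice (n0 + j) (k0 * 2 ^ j + i) e w))
    \<le> ennreal (3960 / (2 - \<sigma>) * B) * indicator (cball (mid n0 k0) (14 / 2 ^ n0)) w"
    (is "(\<Sum>j. ?a j) \<le> _")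
proof -
  define t where "t = 1 - norm w"
  have t: "0 < t" "t \<le> 1" using w by (auto simp: t_def)
  \<comment> \<open>198 = 3 * 66, for the three segments of each arc.\<close>
  have a: "?a j \<le> ennreal (198 * t * (wt (n0 + j) * 2 ^ (n0 + j))) * indicator {j. t \<le> 10 / 2 ^ (n0 + j)} j" for j
  proof -
    have inj: "inj_on ((+) (k0 * 2 ^ j)) {..<2^j}" by (auto simp: inj_on_def)
    have "(\<Sum>i<2^j. slice (n0 + j) (k0 * 2 ^ j + i) e w) \<le> ennreal (66 * 2 ^ (n0 + j) * t) * indicator {w. 1 - norm w \<le> 10 / 2 ^ (n0 + j)} w"
      if e: "e \<le> 2" for e
      using sum_slice_le[OF _ _ e w, of "n0 + j" "(+) (k0 * 2 ^ j) ` {..<2^j}"] n0 descendant_less[OF k0]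
      unfolding sum.reindex[OF inj] t_def by (auto simp: o_def)
    then have "(\<Sum>e\<le>2. \<Sum>i<2^j. slice (n0 + j) (k0 * 2 ^ j + i) e w) \<le> (\<Sum>e\<le>(2::nat). ennreal (66 * 2 ^ (n0 + j) * t) * indicator {w. 1 - norm w \<le> 10 / 2 ^ (n0 + j)} w)"
      by (intro sum_mono) auto
    also have "\<dots> = ennreal 3 * ennreal (66 * 2 ^ (n0 + j) * t) * indicator {j. t \<le> 10 / 2 ^ (n0 + j)} j"
      by (simp add: t_def mult_ac split: split_indicator)
    also have "\<dots> = ennreal (198 * 2 ^ (n0 + j) * t) * indicator {j. t \<le> 10 / 2 ^ (n0 + j)} j"
      using t by (subst ennreal_mult[symmetric]) (auto simp: mult_ac)
    finally have "?a j \<le> ennreal (wt (n0 + j)) * (ennreal (198 * 2 ^ (n0 + j) * t) * indicator {j. t \<le> 10 / 2 ^ (n0 + j)} j)"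
      by (subst sum.swap) (intro mult_left_mono, auto)
    also have "\<dots> = ennreal (198 * t * (wt (n0 + j) * 2 ^ (n0 + j))) * indicator {j. t \<le> 10 / 2 ^ (n0 + j)} j"
      using t wt(1)[of "n0 + j"] by (subst mult.assoc[symmetric], subst ennreal_mult[symmetric]) (auto simp: mult_ac)
    finally show ?thesis .
  qed
  show ?thesis
  proof (cases "w \<in> cball (mid n0 k0) (14 / 2 ^ n0)")
    case False
    \<comment> \<open>14 = 10 + 4: a cone stays within \<open>10 / 2 ^ n0\<close> of the midpoint of
      its arc, which is within \<open>4 / 2 ^ n0\<close> of \<open>mid n0 k0\<close>.\<close>
    have "slice (n0 + j) (k0 * 2 ^ j + i) e w = 0" if "i < 2 ^ j" "e \<le> 2" for i j e
    proof -
      have "\<not> norm (w - mid (n0 + j) (k0 * 2 ^ j + i)) \<le> 10 / 2 ^ (n0 + j)"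
      proof
        assume "norm (w - mid (n0 + j) (k0 * 2 ^ j + i)) \<le> 10 / 2 ^ (n0 + j)"
        also have "\<dots> \<le> 10 / 2 ^ n0" by (intro divide_left_mono power_increasing) auto
        finally have "norm (w - mid n0 k0) \<le> 10 / 2 ^ n0 + 4 / 2 ^ n0"
          using mid_descendant_dist[OF that(1), of n0 k0] norm_diff_triangle_ineq
            norm_triangle_mono[of "w - mid (n0 + j) (k0 * 2 ^ j + i)" "10 / 2 ^ n0" "mid (n0 + j) (k0 * 2 ^ j + i) - mid n0 k0" "4 / 2 ^ n0"] by simp
        with False show False by (simp add: dist_norm norm_minus_commute)
      qed
      with slice_le[OF that(2), of "n0 + j" "k0 * 2 ^ j + i" w] show ?thesis by simp
    qed
    then have "?a j = 0" for j by (simp add: sum.neutral)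
    then show ?thesis by (simp only: suminf_zero zero_le)
  next
    case True
    have "\<exists>N. 10 / 2 ^ Suc N < t"
    proof -
      obtain N where "(1/2) ^ N < t / 10" using real_arch_pow_inv[of "t / 10" "1/2"] t by auto
      then have "10 / 2 ^ N < t" by (simp add: power_divide field_simps)
      moreover have "10 / 2 ^ Suc N \<le> 10 / (2::real) ^ N" by (intro divide_left_mono power_increasing) auto
      ultimately show ?thesis by (intro exI[of _ N]) linarith
    qed
    \<comment> \<open>\<open>N\<close> is the last generation in which a cone can contain
      \<open>w\<close>: the height of \<open>w\<close> is at most \<open>10 / 2 ^ N\<close> but
      exceeds \<open>10 / 2 ^ Suc N\<close>.\<close>
    then obtain N where N: "10 / 2 ^ Suc N < t" "\<And>m. m < N \<Longrightarrow> \<not> 10 / 2 ^ Suc m < t"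
      using exists_least_iff[of "\<lambda>N. 10 / 2 ^ Suc N < t"] by blast
    have tN: "t \<le> 10 / 2 ^ N"
    proof (cases N)
      case 0 then show ?thesis using t by simp
    next
      case (Suc m) then show ?thesis using N(2)[of m] by simp
    qed
    have big: "\<not> t \<le> 10 / 2 ^ n" if "N < n" for n
    proof -
      have "10 / 2 ^ n \<le> 10 / (2::real) ^ Suc N" using that by (intro divide_left_mono power_increasing) auto
      with N(1) show ?thesis by linarith
    qed
    show ?thesis
    proof (cases "n0 \<le> N")
      case False
      then have "?a j = 0" for j using a[of j] big[of "n0 + j"] by simp
      then show ?thesis by (simp only: suminf_zero zero_le)
    next
      case n0N: True
      have "?a j = 0" if "j \<notin> {..N - n0}" for j
        using a[of j] big[of "n0 + j"] that by simp
      then have "(\<Sum>j. ?a j) = (\<Sum>j\<le>N - n0. ?a j)" by (intro suminf_finite) auto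
      also have "\<dots> \<le> (\<Sum>j\<le>N - n0. ennreal (198 * t * (wt (n0 + j) * 2 ^ (n0 + j))))"
        by (intro sum_mono order_trans[OF a]) (simp split: split_indicator)
      also have "\<dots> = ennreal (\<Sum>j\<le>N - n0. 198 * t * (wt (n0 + j) * 2 ^ (n0 + j)))"
        using t wt(1) by (intro sum_ennreal) auto
      also have "(\<Sum>j\<le>N - n0. 198 * t * (wt (n0 + j) * 2 ^ (n0 + j))) = 198 * t * (\<Sum>n=n0..N. wt n * 2 ^ n)"
        unfolding sum_distrib_left using n0N
        by (intro sum.reindex_bij_witness[of _ "\<lambda>n. n - n0" "\<lambda>j. n0 + j"]) auto
      also have "\<dots> \<le> 198 * t * (2 / (2 - \<sigma>) * wt N * 2 ^ N)"
        using t by (intro mult_left_mono weighted_sum_le wt \<sigma> n0N) auto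
      \<comment> \<open>The power of 2 is absorbed by the height: \<open>t * 2 ^ N \<le> 10\<close>,
        and 198 * 2 * 10 = 3960.\<close>
      also have "\<dots> = (396 / (2 - \<sigma>) * wt N) * (t * 2 ^ N)" by simp
      also have "\<dots> \<le> (396 / (2 - \<sigma>) * wt N) * 10"
        using tN \<sigma> wt(1)[OF n0N] by (intro mult_left_mono) (auto simp: field_simps)
      also have "\<dots> = 3960 / (2 - \<sigma>) * wt N" by simp
      also have "\<dots> \<le> 3960 / (2 - \<sigma>) * B"
        using \<sigma> n0N tN N(1) by (intro mult_left_mono B) (auto simp: t_def)
      finally show ?thesis using True by (simp add: ennreal_leI)
    qed
  qed
qed

text \<open>Sums and integral are interchanged and \<open>slice_sum_le\<close> is applied at each w
  with \<open>B = K * \<Omega> (1 - norm w)\<close>. The hypothesis \<open>wt\<Omega>\<close>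
  compares the weight of generation N with the weight of points at heights between
  \<open>5 / 2 ^ N\<close> and \<open>10 / 2 ^ N\<close>, for which N is the last generation that
  counts.\<close>

lemma cone_energy_sum_le:
  fixes wt :: "nat \<Rightarrow> real" and \<Omega> :: "real \<Rightarrow> real" and K \<sigma> :: real
  assumes n0: "n0 \<ge> 3" and k0: "k0 < 2 ^ n0"
    and wt: "\<And>n. n0 \<le> n \<Longrightarrow> 0 \<le> wt n" "\<And>n. n0 \<le> n \<Longrightarrow> wt n \<le> \<sigma> * wt (Suc n)" and \<sigma>: "0 \<le> \<sigma>" "\<sigma> < 2"
    and \<Omega> [measurable]: "\<Omega> \<in> borel_measurable borel" and K: "K \<ge> 0"
    and wt\<Omega>: "\<And>N t. n0 \<le> N \<Longrightarrow> 0 < t \<Longrightarrow> t \<le> 10 / 2 ^ N \<Longrightarrow> 10 / 2 ^ Suc N < t \<Longrightarrow> wt N \<le> K * \<Omega> t"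
  shows "(\<Sum>j. ennreal (wt (n0 + j)) * (\<Sum>i<2^j. \<Sum>e\<le>2. cone_energy (n0 + j) (k0 * 2 ^ j + i) e))
    \<le> ennreal (3960 / (2 - \<sigma>) * K) * weighted_energy \<Omega> (cball (mid n0 k0) (14 / 2 ^ n0))"
proof -
  let ?s = "\<lambda>w. \<Sum>j. ennreal (wt (n0 + j)) * (\<Sum>i<2^j. \<Sum>e\<le>2. slice (n0 + j) (k0 * 2 ^ j + i) e w)"
  have "(\<Sum>j. ennreal (wt (n0 + j)) * (\<Sum>i<2^j. \<Sum>e\<le>2. cone_energy (n0 + j) (k0 * 2 ^ j + i) e))
    = (\<integral>\<^sup>+ w. energy w * ?s w \<partial>lborel)"
  proof -
    have "energy w * ?s w
      = (\<Sum>j. \<Sum>i<2^j. \<Sum>e\<le>2. ennreal (wt (n0 + j)) * (energy w * slice (n0 + j) (k0 * 2 ^ j + i) e w))" for w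
      unfolding ennreal_suminf_cmult[symmetric] sum_distrib_left by (simp only: mult.left_commute)
    then show ?thesis
      unfolding cone_energy_eq by (simp add: nn_integral_suminf nn_integral_sum nn_integral_cmult sum_distrib_left)
  qed
  also have "\<dots> \<le> (\<integral>\<^sup>+ w. ennreal (3960 / (2 - \<sigma>) * K) * (energy w * ennreal (\<Omega> (1 - norm w)) * indicator (cball (mid n0 k0) (14 / 2 ^ n0)) w) \<partial>lborel)"
  proof (rule nn_integral_mono)
    fix w :: complex
    show "energy w * ?s w
      \<le> ennreal (3960 / (2 - \<sigma>) * K) * (energy w * ennreal (\<Omega> (1 - norm w)) * indicator (cball (mid n0 k0) (14 / 2 ^ n0)) w)"
    proof (cases "norm w < 1")
      case True
      have "?s w
        \<le> ennreal (3960 / (2 - \<sigma>) * (K * \<Omega> (1 - norm w))) * indicator (cball (mid n0 k0) (14 / 2 ^ n0)) w"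
        using True by (intro slice_sum_le n0 k0 wt \<sigma> wt\<Omega>) auto
      also have "ennreal (3960 / (2 - \<sigma>) * (K * \<Omega> (1 - norm w))) = ennreal (3960 / (2 - \<sigma>) * K) * ennreal (\<Omega> (1 - norm w))"
        using \<sigma> K by (subst ennreal_mult'[symmetric]) (auto simp: mult.assoc)
      finally show ?thesis
        by (auto intro!: mult_left_mono order_trans[OF mult_left_mono] simp: mult_ac)
    qed (simp add: energy_def)
  qed
  also have "\<dots> = ennreal (3960 / (2 - \<sigma>) * K) * weighted_energy \<Omega> (cball (mid n0 k0) (14 / 2 ^ n0))"
  proof (rule nn_integral_cmult)
    have [measurable]: "cball (mid n0 k0) (14 / 2 ^ n0) \<in> sets borel" by simp
    show "(\<lambda>w. energy w * ennreal (\<Omega> (1 - norm w)) * indicator (cball (mid n0 k0) (14 / 2 ^ n0)) w) \<in> borel_measurable lborel"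
      by measurable
  qed
  finally show ?thesis .
qed

end

section \<open>Length of dyadic polygons\<close>

text \<open>With s = |a| + |b| and c = |a + b| the parallelogram law gives s^2 - c^2 <= |a - b|^2,
  and s - c is at most (s^2 - c^2) / c.\<close>

lemma norm_excess_le:
  fixes a b :: complex
  assumes "a + b \<noteq> 0"
  shows "norm a + norm b \<le> norm (a + b) + (norm (a - b))\<^sup>2 / norm (a + b)"
proof -
  define s c where "s = norm a + norm b" and "c = norm (a + b)"
  have c: "0 < c" "c \<le> s" using assms by (auto simp: c_def s_def norm_triangle_ineq)
  have "(norm (a + b))\<^sup>2 + (norm (a - b))\<^sup>2 = 2 * (norm a)\<^sup>2 + 2 * (norm b)\<^sup>2"
    unfolding cmod_power2 by (simp add: power2_eq_square algebra_simps)
  moreover have "s\<^sup>2 + (norm a - norm b)\<^sup>2 = 2 * (norm a)\<^sup>2 + 2 * (norm b)\<^sup>2"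
    by (simp add: s_def power2_eq_square algebra_simps)
  moreover have "0 \<le> (norm a - norm b)\<^sup>2" by simp
  ultimately have "s\<^sup>2 - c\<^sup>2 \<le> (norm (a - b))\<^sup>2" unfolding c_def by linarith
  moreover have "(s - c) * c \<le> (s - c) * (s + c)" using c by (intro mult_left_mono) auto
  ultimately have "(s - c) * c \<le> (norm (a - b))\<^sup>2"
    by (simp add: power2_eq_square algebra_simps)
  then show ?thesis using c by (simp add: s_def[symmetric] c_def[symmetric] field_simps)
qed

lemma sum_lessThan_double:
  fixes g :: "nat \<Rightarrow> 'a :: comm_monoid_add"
  shows "(\<Sum>i<2 * m. g i) = (\<Sum>i<m. g (2 * i) + g (2 * i + 1))"
  by (induction m) (simp_all add: add.assoc)

context conformal_log
begin

lemma bend_nonneg: "0 \<le> bend n k"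
  by (simp add: bend_def chord_def second_diff_def)

text \<open>The half chords satisfy 2 a = (a + b) + (a - b) and 2 b = (a + b) - (a - b), so each is
  close to half the chord when the bend is small; their sum is governed by
  \<open>norm_excess_le\<close>.\<close>

lemma chord_children:
  assumes n: "n \<ge> 1"
  shows "chord (Suc n) (2 * k) + chord (Suc n) (2 * k + 1) \<le> chord n k * (1 + (bend n k)\<^sup>2)"
    and "chord (Suc n) (2 * k) \<le> (1 + bend n k) / 2 * chord n k"
    and "chord (Suc n) (2 * k + 1) \<le> (1 + bend n k) / 2 * chord n k"
proof -
  define a b where "a = f (dpt (Suc n) (2 * k)) - f (dpt (Suc n) (2 * k + 1))"
    and "b = f (dpt (Suc n) (2 * k + 1)) - f (dpt (Suc n) (2 * k + 2))"
  have ab: "chord (Suc n) (2 * k) = norm a" "chord (Suc n) (2 * k + 1) = norm b"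
    by (simp_all add: chord_def a_def b_def)
  have c: "chord n k = norm (a + b)"
    using dpt_double[of n k] dpt_double[of n "Suc k"] by (simp add: chord_def a_def b_def)
  have d: "second_diff n k = norm (a - b)"
    by (simp add: second_diff_def a_def b_def algebra_simps)
  have c0: "norm (a + b) > 0" using chord_pos[OF n, of k] c by simp
  have bend: "norm (a - b) = bend n k * norm (a + b)"
    using c0 by (simp add: bend_def c d)
  show "chord (Suc n) (2 * k) + chord (Suc n) (2 * k + 1) \<le> chord n k * (1 + (bend n k)\<^sup>2)"
    using norm_excess_le[of a b] c0 unfolding ab c bend by (simp add: power2_eq_square algebra_simps)
  have "(a + b) + (a - b) = 2 * a" "(a + b) - (a - b) = 2 * b" by simp_all
  then have "norm ((a + b) + (a - b)) = 2 * norm a" "norm ((a + b) - (a - b)) = 2 * norm b"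
    by (simp_all only: norm_mult norm_numeral)
  then have "2 * norm a \<le> norm (a + b) + norm (a - b)" "2 * norm b \<le> norm (a + b) + norm (a - b)"
    using norm_triangle_ineq norm_triangle_ineq4 by metis+
  then show "chord (Suc n) (2 * k) \<le> (1 + bend n k) / 2 * chord n k"
    and "chord (Suc n) (2 * k + 1) \<le> (1 + bend n k) / 2 * chord n k"
    unfolding ab c bend by (simp_all add: algebra_simps)
qed

lemma chord_decay:
  assumes n0: "n0 \<ge> 1" and bend: "\<And>n k. n \<ge> n0 \<Longrightarrow> bend n k \<le> \<epsilon>" and i: "i < 2 ^ j"
  shows "chord (n0 + j) (k0 * 2 ^ j + i) \<le> ((1 + \<epsilon>) / 2) ^ j * chord n0 k0"
  using i
proof (induction j arbitrary: i)
  case (Suc j)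
  \<comment> \<open>The parent of the arc; even and odd \<open>i\<close> are its two halves.\<close>
  define m where "m = k0 * 2 ^ j + i div 2"
  have "i div 2 < 2 ^ j" using Suc.prems by auto
  note IH = Suc.IH[OF this, folded m_def]
  have eps: "0 \<le> \<epsilon>" using bend[of n0 k0] bend_nonneg[of n0 k0] by auto
  have "k0 * 2 ^ Suc j + i = 2 * m \<or> k0 * 2 ^ Suc j + i = 2 * m + 1"
    unfolding m_def by (cases "even i") (auto elim!: evenE oddE)
  then have "chord (n0 + Suc j) (k0 * 2 ^ Suc j + i) \<le> (1 + bend (n0 + j) m) / 2 * chord (n0 + j) m"
    using chord_children(2,3)[of "n0 + j" m] n0 by auto
  also have "\<dots> \<le> (1 + \<epsilon>) / 2 * (((1 + \<epsilon>) / 2) ^ j * chord n0 k0)"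
    using eps bend[of "n0 + j" m] bend_nonneg[of "n0 + j" m] IH
    by (intro mult_mono) (auto simp: chord_def)
  finally show ?case by simp
qed simp

lemma polygon_length_le:
  assumes n0: "n0 \<ge> 1" and bend: "\<And>n k. n \<ge> n0 \<Longrightarrow> bend n k \<le> \<epsilon>"
  shows "(\<Sum>i<2^j. chord (n0 + j) (k0 * 2 ^ j + i))
    \<le> chord n0 k0 * (1 + (\<Sum>l<j. ((1 + \<epsilon>) / 2) ^ l * (\<Sum>i<2^l. (bend (n0 + l) (k0 * 2 ^ l + i))\<^sup>2)))"
proof (induction j)
  case (Suc j)
  let ?q = "(1 + \<epsilon>) / 2"
  have "(\<Sum>i<2^Suc j. chord (n0 + Suc j) (k0 * 2 ^ Suc j + i))
      = (\<Sum>i<2^j. chord (Suc (n0 + j)) (2 * (k0 * 2 ^ j + i)) + chord (Suc (n0 + j)) (2 * (k0 * 2 ^ j + i) + 1))"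
    using sum_lessThan_double[of "\<lambda>i. chord (n0 + Suc j) (k0 * 2 ^ Suc j + i)" "2 ^ j"]
    by (simp add: algebra_simps)
  also have "\<dots> \<le> (\<Sum>i<2^j. chord (n0 + j) (k0 * 2 ^ j + i) * (1 + (bend (n0 + j) (k0 * 2 ^ j + i))\<^sup>2))"
    using n0 by (intro sum_mono chord_children) auto
  also have "\<dots> = (\<Sum>i<2^j. chord (n0 + j) (k0 * 2 ^ j + i)) + (\<Sum>i<2^j. chord (n0 + j) (k0 * 2 ^ j + i) * (bend (n0 + j) (k0 * 2 ^ j + i))\<^sup>2)"
    by (simp add: distrib_left sum.distrib)
  also have "\<dots> \<le> chord n0 k0 * (1 + (\<Sum>l<j. ?q ^ l * (\<Sum>i<2^l. (bend (n0 + l) (k0 * 2 ^ l + i))\<^sup>2)))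
      + (\<Sum>i<2^j. (?q ^ j * chord n0 k0) * (bend (n0 + j) (k0 * 2 ^ j + i))\<^sup>2)"
    by (intro add_mono Suc.IH sum_mono mult_right_mono chord_decay n0 bend) auto
  also have "\<dots> = chord n0 k0 * (1 + (\<Sum>l<Suc j. ?q ^ l * (\<Sum>i<2^l. (bend (n0 + l) (k0 * 2 ^ l + i))\<^sup>2)))"
    by (simp add: sum_distrib_left[symmetric] algebra_simps)
  finally show ?case .
qed simp

end

text \<open>Round the partition points down to multiples of \<open>1 / 2 ^ (n + j)\<close>. By the
  triangle inequality the polygon through the rounded points is no longer than the full dyadic
  polygon, hence at most \<open>S\<close>. As j grows the rounded points converge, and continuity of
  \<open>\<gamma>\<close> carries the bound over to the given partition.\<close>

lemma dyadic_partition_sum_le: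
  fixes \<gamma> :: "real \<Rightarrow> complex"
  assumes cont: "continuous_on UNIV \<gamma>"
    and S: "\<And>j. (\<Sum>l\<in>{u * 2 ^ j..<v * 2 ^ j}. dist (\<gamma> (real l / 2 ^ (n + j))) (\<gamma> (real (Suc l) / 2 ^ (n + j)))) \<le> S"
    and mono: "mono_on {..N} \<tau>" and \<tau>: "\<tau> ` {..N} \<subseteq> {real u / 2 ^ n..real v / 2 ^ n}"
  shows "(\<Sum>i<N. dist (\<gamma> (\<tau> i)) (\<gamma> (\<tau> (Suc i)))) \<le> S"
proof -
  define p where "p j i = nat \<lfloor>\<tau> i * 2 ^ (n + j)\<rfloor>" for j i
  define c where "c j l = dist (\<gamma> (real l / 2 ^ (n + j))) (\<gamma> (real (Suc l) / 2 ^ (n + j)))" for j l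
  have range: "real u / 2 ^ n \<le> \<tau> i" "\<tau> i \<le> real v / 2 ^ n" if "i \<le> N" for i
    using \<tau> that by (auto simp: image_subset_iff)
  have \<tau>0: "0 \<le> \<tau> i" if "i \<le> N" for i
    using range[OF that] by (rule_tac order_trans[of _ "real u / 2 ^ n"]) auto
  have p_eq: "real (p j i) = of_int \<lfloor>\<tau> i * 2 ^ (n + j)\<rfloor>" if "i \<le> N" for i j
    using \<tau>0[OF that] by (simp add: p_def)
  have p_range: "u * 2 ^ j \<le> p j i" "p j i \<le> v * 2 ^ j" if "i \<le> N" for i j
  proof -
    have "real u / 2 ^ n * 2 ^ (n + j) \<le> \<tau> i * 2 ^ (n + j)" "\<tau> i * 2 ^ (n + j) \<le> real v / 2 ^ n * 2 ^ (n + j)"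
      by (rule mult_right_mono[OF range(1)[OF that]], simp) (rule mult_right_mono[OF range(2)[OF that]], simp)
    then have "of_int (int (u * 2 ^ j)) \<le> \<tau> i * 2 ^ (n + j)" "\<tau> i * 2 ^ (n + j) \<le> of_int (int (v * 2 ^ j))"
      by (simp_all add: power_add)
    then have "int (u * 2 ^ j) \<le> \<lfloor>\<tau> i * 2 ^ (n + j)\<rfloor>" "\<lfloor>\<tau> i * 2 ^ (n + j)\<rfloor> \<le> int (v * 2 ^ j)"
      by (simp_all only: le_floor_iff) (metis floor_mono floor_of_int)
    then show "u * 2 ^ j \<le> p j i" "p j i \<le> v * 2 ^ j"
      unfolding p_def by linarith+
  qed
  have p_mono: "p j i \<le> p j (Suc i)" if "i < N" for i j
    unfolding p_def using monotone_onD[OF mono, of i "Suc i"] that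
    by (intro nat_mono floor_mono mult_right_mono) auto
  have gap: "dist (\<gamma> (real a / 2 ^ (n + j))) (\<gamma> (real b / 2 ^ (n + j))) \<le> (\<Sum>l\<in>{a..<b}. c j l)" if "a \<le> b" for a b j
    using that
  proof (induction b rule: dec_induct)
    case (step b)
    have "dist (\<gamma> (real a / 2 ^ (n + j))) (\<gamma> (real (Suc b) / 2 ^ (n + j))) \<le> (\<Sum>l\<in>{a..<b}. c j l) + c j b"
      unfolding c_def by (rule order_trans[OF dist_triangle add_mono[OF step.IH[unfolded c_def] order_refl]])
    then show ?case using step by simp
  qed simp
  have poly: "(\<Sum>i<N. dist (\<gamma> (real (p j i) / 2 ^ (n + j))) (\<gamma> (real (p j (Suc i)) / 2 ^ (n + j)))) \<le> S" for j
  proof -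
    have tel: "(\<Sum>i<M. \<Sum>l\<in>{p j i..<p j (Suc i)}. c j l) = (\<Sum>l\<in>{p j 0..<p j M}. c j l)" if "M \<le> N" for M
      using that
    proof (induction M)
      case (Suc M)
      have "p j 0 \<le> p j M"
        unfolding p_def using monotone_onD[OF mono, of 0 M] Suc
        by (intro nat_mono floor_mono mult_right_mono) auto
      then show ?case
        using Suc p_mono[of M j] by (simp add: sum.atLeastLessThan_concat)
    qed simp
    have "(\<Sum>i<N. dist (\<gamma> (real (p j i) / 2 ^ (n + j))) (\<gamma> (real (p j (Suc i)) / 2 ^ (n + j))))
        \<le> (\<Sum>i<N. \<Sum>l\<in>{p j i..<p j (Suc i)}. c j l)"
      by (intro sum_mono gap p_mono) auto
    also have "\<dots> = (\<Sum>l\<in>{p j 0..<p j N}. c j l)" by (rule tel) simp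
    also have "\<dots> \<le> (\<Sum>l\<in>{u * 2 ^ j..<v * 2 ^ j}. c j l)"
      using p_range[of 0 j] p_range[of N j] by (intro sum_mono2) (auto simp: c_def)
    also have "\<dots> \<le> S" unfolding c_def by (rule S)
    finally show ?thesis .
  qed
  have lim: "(\<lambda>j. real (p j i) / 2 ^ (n + j)) \<longlonglongrightarrow> \<tau> i" if "i \<le> N" for i
  proof (rule LIMSEQ_I)
    fix r :: real assume "r > 0"
    then obtain M where M: "(1/2) ^ M < r" using real_arch_pow_inv[of r "1/2"] by auto
    show "\<exists>no. \<forall>j\<ge>no. norm (real (p j i) / 2 ^ (n + j) - \<tau> i) < r"
    proof (intro exI[of _ M] allI impI)
      fix j assume "M \<le> j"
      have "\<bar>real (p j i) - \<tau> i * 2 ^ (n + j)\<bar> \<le> 1"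
        unfolding p_eq[OF that] by linarith
      then have "\<bar>(real (p j i) - \<tau> i * 2 ^ (n + j)) / 2 ^ (n + j)\<bar> \<le> 1 / 2 ^ (n + j)"
        unfolding abs_divide by (simp add: divide_right_mono)
      also have "(real (p j i) - \<tau> i * 2 ^ (n + j)) / 2 ^ (n + j) = real (p j i) / 2 ^ (n + j) - \<tau> i"
        by (simp add: diff_divide_distrib)
      also have "1 / 2 ^ (n + j) \<le> 1 / (2::real) ^ M"
        using \<open>M \<le> j\<close> by (intro divide_left_mono power_increasing) auto
      also have "\<dots> < r" using M by (simp add: power_divide)
      finally show "norm (real (p j i) / 2 ^ (n + j) - \<tau> i) < r" by simp
    qed
  qed
  have "(\<lambda>j. \<Sum>i<N. dist (\<gamma> (real (p j i) / 2 ^ (n + j))) (\<gamma> (real (p j (Suc i)) / 2 ^ (n + j))))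
      \<longlonglongrightarrow> (\<Sum>i<N. dist (\<gamma> (\<tau> i)) (\<gamma> (\<tau> (Suc i))))"
    by (intro tendsto_sum tendsto_dist continuous_on_tendsto_compose[OF cont] lim) auto
  then show ?thesis
    by (rule LIMSEQ_le_const2) (use poly in blast)
qed

section \<open>Subarcs of the Jordan curve\<close>

text \<open>By the Jordan curve theorem \<Gamma> is the frontier of its inside. The homeomorphism
  takes the open disc to the inside, so it takes what remains of the closed disc to what remains of
  the closure.\<close>

lemma conformal_onto_inside_sphere:
  assumes \<Gamma>: "closed_jordan_curve \<Gamma>" and f: "conformal_onto_inside f \<Gamma>"
  shows "continuous_on (cball 0 1) f" "inj_on f (cball 0 1)" "f ` sphere 0 1 = \<Gamma>"
proof -
  obtain g where g: "homeomorphism (cball 0 1) (closure (inside \<Gamma>)) f g"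
    using f by (auto simp: conformal_onto_inside_def)
  show "continuous_on (cball 0 1) f" and inj: "inj_on f (cball 0 1)"
    using g by (auto simp: homeomorphism_def intro: inj_on_inverseI)
  have "frontier (inside \<Gamma>) = \<Gamma>"
    using \<Gamma> Jordan_inside_outside unfolding closed_jordan_curve_def by metis
  then have cl: "closure (inside \<Gamma>) = inside \<Gamma> \<union> \<Gamma>"
    by (simp add: closure_Un_frontier)
  have "sphere 0 1 = cball 0 1 - ball (0::complex) 1" by auto
  then have "f ` sphere 0 1 = f ` cball 0 1 - f ` ball 0 1"
    using inj_on_image_set_diff[OF inj, of "cball 0 1" "ball 0 1"] by auto
  also have "\<dots> = (inside \<Gamma> \<union> \<Gamma>) - inside \<Gamma>"
    using f g cl by (simp add: conformal_onto_inside_def homeomorphism_def)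
  also have "\<dots> = \<Gamma>" using inside_no_overlap[of \<Gamma>] by blast
  finally show "f ` sphere 0 1 = \<Gamma>" .
qed

text \<open>Only the boundary homeomorphism enters the geometry of subarcs, so it is kept apart from
  the analytic assumptions of \<open>conformal_log\<close>.\<close>

locale circle_param =
  fixes \<Gamma> :: "complex set" and f :: "complex \<Rightarrow> complex"
  assumes f_circle_cont: "continuous_on (sphere 0 1) f"
    and f_circle_inj: "inj_on f (sphere 0 1)"
    and f_circle_image: "f ` sphere 0 1 = \<Gamma>"
begin

definition \<gamma> :: "real \<Rightarrow> complex" where
  "\<gamma> x = f (cis (2 * pi * x))"

lemma continuous_\<gamma>: "continuous_on X \<gamma>"
  unfolding \<gamma>_def
  by (rule continuous_on_compose2[OF f_circle_cont]) (auto simp: cis_conv_exp intro!: continuous_intros)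

lemma \<gamma>_add_int: "\<gamma> (x + of_int m) = \<gamma> x"
  by (simp only: \<gamma>_def cis_add_int)

lemma \<gamma>_eqD:
  assumes "\<gamma> x = \<gamma> y"
  obtains m :: int where "x = y + of_int m"
proof -
  have "cis (2 * pi * x) = cis (2 * pi * y)"
    using inj_onD[OF f_circle_inj assms[unfolded \<gamma>_def]] by simp
  then show ?thesis using cis_near[of x y] that by (auto simp: algebra_simps)
qed

text \<open>There are just two subarcs from \<open>\<gamma> a\<close> to \<open>\<gamma> b\<close>.
  Pull \<open>g\<close> back to the circle and lift it by a continuous logarithm to a real function
  starting at \<open>a\<close>. Injectivity makes the lift strictly monotone and keeps it from
  moving by 1, so it ends at \<open>b\<close> or at \<open>b - 1\<close>; the second case is the
  complementary subarc, run backwards.\<close>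

lemma lift_arc:
  assumes g: "joining_subarc \<Gamma> (\<gamma> a) (\<gamma> b) g" and ab: "a < b" "b < a + 1"
  obtains \<phi> where "mono_on {0..1} \<phi>" "\<phi> ` {0..1} = {a..b}" "\<And>t. t \<in> {0..1} \<Longrightarrow> g t = \<gamma> (\<phi> t)"
  | \<phi> where "antimono_on {0..1} \<phi>" "\<phi> ` {0..1} = {b - 1..a}" "\<And>t. t \<in> {0..1} \<Longrightarrow> g t = \<gamma> (\<phi> t)"
proof -
  obtain f' where f': "homeomorphism (sphere 0 1) \<Gamma> f f'"
    using homeomorphism_compact[OF compact_sphere f_circle_cont f_circle_image f_circle_inj] by blast
  have g': "arc g" "path_image g \<subseteq> \<Gamma>" "g 0 = \<gamma> a" "g 1 = \<gamma> b"
    using g by (auto simp: joining_subarc_def pathstart_def pathfinish_def)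
  define G where "G t = f' (g t)" for t
  have gin: "g t \<in> \<Gamma>" if "t \<in> {0..1}" for t
    using g'(2) that by (auto simp: path_image_def)
  have G: "G t \<in> sphere 0 1" "f (G t) = g t" if "t \<in> {0..1}" for t
    using f' gin[OF that] by (auto simp: G_def homeomorphism_def)
  have "continuous_on {0..1} g" using g'(1) by (simp add: arc_def path_def)
  then have "continuous_on {0..1} G"
    unfolding G_def using f' gin
    by (intro continuous_on_compose2[of \<Gamma> f' "{0..1}" g]) (auto simp: homeomorphism_def)
  moreover have "contractible {0..1::real}" by (intro convex_imp_contractible) simp
  moreover have "G t \<noteq> 0" if "t \<in> {0..1}" for t using G(1)[OF that] by auto
  ultimately obtain L where L: "continuous_on {0..1} L" "\<And>t. t \<in> {0..1} \<Longrightarrow> G t = exp (L t)"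
    using continuous_logarithm_on_contractible by metis
  define \<psi> where "\<psi> t = Im (L t) / (2 * pi)" for t
  have G\<psi>: "G t = cis (2 * pi * \<psi> t)" if "t \<in> {0..1}" for t
  proof -
    have "norm (exp (L t)) = 1" using G(1)[OF that] L(2)[OF that] by simp
    then have "Re (L t) = 0" by simp
    then show ?thesis using L(2)[OF that] by (simp add: \<psi>_def exp_eq_polar)
  qed
  have g\<psi>: "g t = \<gamma> (\<psi> t)" if "t \<in> {0..1}" for t
    using G(2)[OF that] G\<psi>[OF that] by (simp add: \<gamma>_def)
  obtain m where m: "a = \<psi> 0 + of_int m"
    using \<gamma>_eqD[of a "\<psi> 0"] g\<psi>[of 0] g' by auto
  define \<phi> where "\<phi> t = \<psi> t + of_int m" for t
  have g\<phi>: "g t = \<gamma> (\<phi> t)" if "t \<in> {0..1}" for t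
    using g\<psi>[OF that] by (simp add: \<phi>_def \<gamma>_add_int)
  have \<phi>0: "\<phi> 0 = a" by (simp add: \<phi>_def m)
  obtain l where l: "\<phi> 1 = b + of_int l"
    using \<gamma>_eqD[of "\<phi> 1" b] g\<phi>[of 1] g' by auto
  have cont: "continuous_on {0..1} \<phi>"
    unfolding \<phi>_def \<psi>_def by (intro continuous_intros L(1)) auto
  \<comment> \<open>Values of the lift that differ by any integer k are excluded: k = 0 yields
    injectivity, k = 1 and k = -1 bound the range.\<close>
  have inj: "s = t" if "s \<in> {0..1}" "t \<in> {0..1}" "\<phi> s = \<phi> t + of_int k" for s t k
  proof -
    have "g s = g t" using that by (simp add: g\<phi> \<gamma>_add_int)
    then show ?thesis using g'(1) that by (auto simp: arc_def inj_on_def)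
  qed
  then have "inj_on \<phi> {0..1}" by (intro inj_onI) (metis add.right_neutral of_int_0)
  moreover have "is_interval {0..1::real}" by (rule is_interval_cc)
  ultimately consider "strict_mono_on {0..1} \<phi>" | "strict_antimono_on {0..1} \<phi>"
    using injective_eq_monotone_map cont by blast
  then show ?thesis
  proof cases
    case 1
    have "a < \<phi> 1" using strict_mono_onD[OF 1, of 0 1] \<phi>0 by simp
    have "\<phi> 1 < a + 1"
    proof (rule ccontr)
      assume "\<not> \<phi> 1 < a + 1"
      then obtain t where t: "0 \<le> t" "t \<le> 1" "\<phi> t = a + 1"
        using IVT'[of \<phi> 0 "a + 1" 1] \<phi>0 cont by auto
      then show False using inj[of t 0 1] \<phi>0 by auto
    qed
    with \<open>a < \<phi> 1\<close> l ab have "\<bar>of_int l :: real\<bar> < 1" by auto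
    then have \<phi>1: "\<phi> 1 = b" using l by auto
    have mono: "mono_on {0..1} \<phi>" using 1 by (rule strict_mono_on_imp_mono_on)
    have "\<phi> ` {0..1} = {a..b}"
    proof
      show "\<phi> ` {0..1} \<subseteq> {a..b}"
        using monotone_onD[OF mono, of 0] monotone_onD[OF mono, of _ 1] \<phi>0 \<phi>1 by auto
      show "{a..b} \<subseteq> \<phi> ` {0..1}"
        using IVT'[of \<phi> 0 _ 1] \<phi>0 \<phi>1 cont by fastforce
    qed
    then show ?thesis using that(1)[OF mono] g\<phi> by blast
  next
    case 2
    then have mono: "antimono_on {0..1} \<phi>" using strict_antimono_iff_antimono by blast
    have "\<phi> 1 < a" using monotone_onD[OF 2, of 0 1] \<phi>0 by simp
    have "a - 1 < \<phi> 1"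
    proof (rule ccontr)
      assume "\<not> a - 1 < \<phi> 1"
      then obtain t where t: "0 \<le> t" "t \<le> 1" "\<phi> t = a - 1"
        using IVT2'[of \<phi> 1 "a - 1" 0] \<phi>0 cont by auto
      then show False using inj[of t 0 "-1"] \<phi>0 by auto
    qed
    with \<open>\<phi> 1 < a\<close> l ab have "\<bar>of_int l + 1 :: real\<bar> < 1" by auto
    then have "l = - 1" by linarith
    then have \<phi>1: "\<phi> 1 = b - 1" using l by auto
    have "\<phi> ` {0..1} = {b - 1..a}"
    proof
      show "\<phi> ` {0..1} \<subseteq> {b - 1..a}"
        using monotone_onD[OF mono, of 0] monotone_onD[OF mono, of _ 1] \<phi>0 \<phi>1 by auto
      show "{b - 1..a} \<subseteq> \<phi> ` {0..1}"
        using IVT2'[of \<phi> 1 _ 0] \<phi>0 \<phi>1 cont by fastforce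
    qed
    then show ?thesis using that(2)[OF mono] g\<phi> by blast
  qed
qed

text \<open>A predicate rather than a length function, so that bounds can be passed between
  parameter intervals while the length itself may be infinite.\<close>

definition length_le :: "real \<Rightarrow> real \<Rightarrow> real \<Rightarrow> bool" where
  "length_le a b S \<longleftrightarrow> (\<forall>N \<tau>. mono_on {..N} \<tau> \<and> \<tau> ` {..N} \<subseteq> {a..b} \<longrightarrow>
     (\<Sum>i<N. dist (\<gamma> (\<tau> i)) (\<gamma> (\<tau> (Suc i)))) \<le> S)"

lemma length_le_subset: "length_le a b S \<Longrightarrow> a \<le> c \<Longrightarrow> d \<le> b \<Longrightarrow> length_le c d S"
  unfolding length_le_def by fastforce

lemma path_length_mono_le:
  assumes S: "length_le a b S" and \<phi>: "mono_on {0..1} \<phi>" "\<phi> ` {0..1} \<subseteq> {a..b}"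
    and g: "\<And>t. t \<in> {0..1} \<Longrightarrow> g t = \<gamma> (\<phi> t)"
  shows "path_length g \<le> ennreal S"
  unfolding path_length_def
proof (rule SUP_least, clarify)
  fix N :: nat and t :: "nat \<Rightarrow> real"
  assume t: "mono_on {..N} t" "t ` {..N} \<subseteq> {0..1}"
  have "(\<Sum>i<N. ennreal (dist (g (t i)) (g (t (Suc i))))) = ennreal (\<Sum>i<N. dist (\<gamma> (\<phi> (t i))) (\<gamma> (\<phi> (t (Suc i)))))"
    using t(2) by (subst sum_ennreal[symmetric]) (auto intro!: sum.cong simp: g image_subset_iff)
  also have "\<dots> \<le> ennreal S"
  proof (rule ennreal_leI)
    have "mono_on {..N} (\<lambda>i. \<phi> (t i))"
      using t \<phi>(1) by (auto simp: monotone_on_def image_subset_iff)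
    moreover have "(\<lambda>i. \<phi> (t i)) ` {..N} \<subseteq> {a..b}"
      using t(2) \<phi>(2) by (auto simp: image_subset_iff)
    ultimately show "(\<Sum>i<N. dist (\<gamma> (\<phi> (t i))) (\<gamma> (\<phi> (t (Suc i))))) \<le> S"
      using S unfolding length_le_def by blast
  qed
  finally show "(\<Sum>i<N. ennreal (dist (g (t i)) (g (t (Suc i))))) \<le> ennreal S" .
qed

text \<open>Reversing the partition makes it increasing, and shifting the parameter by the period 1
  turns \<open>{b - 1..a}\<close> into \<open>{b..a + 1}\<close>.\<close>

lemma path_length_antimono_le:
  assumes S: "length_le b (a + 1) S" and \<phi>: "antimono_on {0..1} \<phi>" "\<phi> ` {0..1} \<subseteq> {b - 1..a}"
    and g: "\<And>t. t \<in> {0..1} \<Longrightarrow> g t = \<gamma> (\<phi> t)"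
  shows "path_length g \<le> ennreal S"
  unfolding path_length_def
proof (rule SUP_least, clarify)
  fix N :: nat and t :: "nat \<Rightarrow> real"
  assume t: "mono_on {..N} t" "t ` {..N} \<subseteq> {0..1}"
  define \<tau> where "\<tau> i = \<phi> (t (N - i)) + 1" for i
  have \<gamma>\<tau>: "\<gamma> (\<tau> i) = \<gamma> (\<phi> (t (N - i)))" for i
    unfolding \<tau>_def using \<gamma>_add_int[of _ 1] by simp
  have "(\<Sum>i<N. ennreal (dist (g (t i)) (g (t (Suc i))))) = ennreal (\<Sum>i<N. dist (\<gamma> (\<phi> (t i))) (\<gamma> (\<phi> (t (Suc i)))))"
    using t(2) by (subst sum_ennreal[symmetric]) (auto intro!: sum.cong simp: g image_subset_iff)
  also have "(\<Sum>i<N. dist (\<gamma> (\<phi> (t i))) (\<gamma> (\<phi> (t (Suc i))))) = (\<Sum>i<N. dist (\<gamma> (\<tau> i)) (\<gamma> (\<tau> (Suc i))))"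
    unfolding \<gamma>\<tau> by (subst sum.nat_diff_reindex[symmetric]) (auto intro!: sum.cong simp: Suc_diff_Suc dist_commute)
  also have "ennreal \<dots> \<le> ennreal S"
  proof (rule ennreal_leI)
    have "mono_on {..N} \<tau>"
    proof (rule monotone_onI)
      fix i j assume "i \<in> {..N}" "j \<in> {..N}" "i \<le> j"
      then have "t (N - j) \<le> t (N - i)" using monotone_onD[OF t(1), of "N - j" "N - i"] by simp
      then show "\<tau> i \<le> \<tau> j"
        unfolding \<tau>_def using monotone_onD[OF \<phi>(1), of "t (N - j)" "t (N - i)"] t(2) by (auto simp: image_subset_iff)
    qed
    moreover have "\<tau> ` {..N} \<subseteq> {b..a + 1}"
    proof clarify
      fix i
      have "\<phi> (t (N - i)) \<in> {b - 1..a}" using t(2) \<phi>(2) by (auto simp: image_subset_iff)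
      then show "\<tau> i \<in> {b..a + 1}" by (auto simp: \<tau>_def)
    qed
    ultimately show "(\<Sum>i<N. dist (\<gamma> (\<tau> i)) (\<gamma> (\<tau> (Suc i)))) \<le> S"
      using S unfolding length_le_def by blast
  qed
  finally show "(\<Sum>i<N. ennreal (dist (g (t i)) (g (t (Suc i))))) \<le> ennreal S" .
qed

text \<open>The window from 0 to 2 contains both \<open>{a..b}\<close> and
  \<open>{b..a + 1}\<close>, so the bound holds whichever subarc is the smaller one.\<close>

lemma subarc_length_le_total:
  assumes "length_le 0 2 S" "0 \<le> a" "a < b" "b \<le> 1" "b < a + 1"
  shows "subarc_length \<Gamma> (\<gamma> a) (\<gamma> b) \<le> ennreal S"
  unfolding subarc_length_def
proof (rule SUP_least, clarify)
  fix g assume "smaller_subarc \<Gamma> (\<gamma> a) (\<gamma> b) g"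
  then have "joining_subarc \<Gamma> (\<gamma> a) (\<gamma> b) g" by (simp add: smaller_subarc_def)
  then show "path_length g \<le> ennreal S"
  proof (rule lift_arc[OF _ assms(3,5)])
    fix \<phi> assume "mono_on {0..1} \<phi>" "\<phi> ` {0..1} = {a..b}" "\<And>t. t \<in> {0..1} \<Longrightarrow> g t = \<gamma> (\<phi> t)"
    then show ?thesis
      using assms by (intro path_length_mono_le[OF length_le_subset[OF assms(1)], of a b \<phi>]) auto
  next
    fix \<phi> assume "antimono_on {0..1} \<phi>" "\<phi> ` {0..1} = {b - 1..a}" "\<And>t. t \<in> {0..1} \<Longrightarrow> g t = \<gamma> (\<phi> t)"
    then show ?thesis
      using assms by (intro path_length_antimono_le[OF length_le_subset[OF assms(1)], of b a \<phi>]) auto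
  qed
qed

text \<open>Supplies the competitor against which the minimality in \<open>smaller_subarc\<close> is
  tested.\<close>

lemma joining_subarc_\<gamma>:
  assumes ab: "a < b" "b < a + 1"
  shows "joining_subarc \<Gamma> (\<gamma> a) (\<gamma> b) (\<gamma> \<circ> linepath a b)" "path_image (\<gamma> \<circ> linepath a b) = \<gamma> ` {a..b}"
proof -
  have seg: "linepath a b ` {0..1} = {a..b}"
    using ab linepath_image_01[of a b] by (simp add: closed_segment_eq_real_ivl)
  have "inj_on \<gamma> {a..b}"
  proof (rule inj_onI)
    fix x y assume xy: "x \<in> {a..b}" "y \<in> {a..b}" "\<gamma> x = \<gamma> y"
    then obtain m :: int where m: "x = y + of_int m" using \<gamma>_eqD by blast
    with xy ab have "\<bar>of_int m :: real\<bar> < 1" by auto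
    with m show "x = y" by simp
  qed
  then have "inj_on (\<gamma> \<circ> linepath a b) {0..1}"
    using ab seg by (intro comp_inj_on inj_on_linepath) auto
  then have "arc (\<gamma> \<circ> linepath a b)"
    unfolding arc_def path_def using continuous_on_compose[OF continuous_on_linepath continuous_\<gamma>] by blast
  moreover have "range \<gamma> \<subseteq> \<Gamma>"
    unfolding \<gamma>_def f_circle_image[symmetric] by auto
  ultimately show "joining_subarc \<Gamma> (\<gamma> a) (\<gamma> b) (\<gamma> \<circ> linepath a b)"
    by (auto simp: joining_subarc_def path_image_def pathstart_def pathfinish_def linepath_def)
  show "path_image (\<gamma> \<circ> linepath a b) = \<gamma> ` {a..b}"
    unfolding path_image_def image_comp[symmetric] seg ..
qed

text \<open>The complementary subarc contains \<open>\<gamma> b\<close> and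
  \<open>\<gamma> (b + 1/4)\<close>, whose distance is bounded below uniformly in b by compactness.
  If b - a is so small that the image of \<open>{a..b}\<close> has diameter at most half that bound,
  the complementary subarc cannot be the one of smaller diameter.\<close>

lemma subarc_length_le_small:
  obtains \<delta> where "\<delta> > 0" "\<And>a b S. 0 \<le> b \<Longrightarrow> b \<le> 1 \<Longrightarrow> a < b \<Longrightarrow> b - a \<le> \<delta> \<Longrightarrow> length_le a b S \<Longrightarrow>
    subarc_length \<Gamma> (\<gamma> a) (\<gamma> b) \<le> ennreal S"
proof -
  define d where "d x = dist (\<gamma> x) (\<gamma> (x + 1/4))" for x
  have "continuous_on {0..1} d"
    unfolding d_def by (intro continuous_intros continuous_on_compose2[OF continuous_\<gamma>[of UNIV]]) auto
  then obtain x0 where x0: "x0 \<in> {0..1}" "\<And>x. x \<in> {0..1} \<Longrightarrow> d x0 \<le> d x"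
    using continuous_attains_inf[of "{0..1::real}" d] by auto
  have d0: "d x0 > 0"
  proof (rule ccontr)
    assume "\<not> d x0 > 0"
    then obtain m :: int where m: "x0 = x0 + 1/4 + of_int m"
      using \<gamma>_eqD[of x0 "x0 + 1/4"] by (auto simp: d_def)
    then have "of_int (4 * m + 1) = (0::real)" by simp
    then have "4 * m + 1 = 0" by (simp only: of_int_eq_0_iff)
    then show False by presburger
  qed
  have "uniformly_continuous_on {-1..1} \<gamma>"
    by (intro compact_uniformly_continuous continuous_\<gamma>) auto
  then obtain \<delta> where \<delta>: "\<delta> > 0" "\<And>x y. x \<in> {-1..1} \<Longrightarrow> y \<in> {-1..1} \<Longrightarrow> dist x y < \<delta> \<Longrightarrow> dist (\<gamma> x) (\<gamma> y) < d x0 / 2"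
    using d0 unfolding uniformly_continuous_on_def by (metis half_gt_zero)
  show ?thesis
  proof (rule that[of "min (\<delta> / 2) (1/2)"])
    fix a b S assume b: "0 \<le> b" "b \<le> 1" and ab: "a < b" "b - a \<le> min (\<delta> / 2) (1/2)" and S: "length_le a b S"
    show "subarc_length \<Gamma> (\<gamma> a) (\<gamma> b) \<le> ennreal S"
      unfolding subarc_length_def
    proof (rule SUP_least, clarify)
      fix g assume g: "smaller_subarc \<Gamma> (\<gamma> a) (\<gamma> b) g"
      have ab1: "b < a + 1" using ab by auto
      have jg: "joining_subarc \<Gamma> (\<gamma> a) (\<gamma> b) g" using g by (simp add: smaller_subarc_def)
      have "diameter (path_image g) \<le> diameter (\<gamma> ` {a..b})"
        using g joining_subarc_\<gamma>[OF ab(1) ab1] unfolding smaller_subarc_def by metis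
      also have "\<dots> \<le> d x0 / 2"
      proof (rule diameter_le)
        fix x y assume "x \<in> \<gamma> ` {a..b}" "y \<in> \<gamma> ` {a..b}"
        then obtain s t where st: "s \<in> {a..b}" "t \<in> {a..b}" "x = \<gamma> s" "y = \<gamma> t" by auto
        have "dist s t < \<delta>" using st ab \<delta>(1) by (auto simp: dist_real_def)
        then show "norm (x - y) \<le> d x0 / 2"
          using \<delta>(2)[of s t] st ab b by (auto simp: dist_norm)
      qed (use d0 in auto)
      finally have small: "diameter (path_image g) \<le> d x0 / 2" .
      from jg show "path_length g \<le> ennreal S"
      proof (rule lift_arc[OF _ ab(1) ab1])
        fix \<phi> assume "mono_on {0..1} \<phi>" "\<phi> ` {0..1} = {a..b}" "\<And>t. t \<in> {0..1} \<Longrightarrow> g t = \<gamma> (\<phi> t)"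
        then show ?thesis by (intro path_length_mono_le[OF S, of \<phi>]) auto
      next
        fix \<phi> assume \<phi>: "antimono_on {0..1} \<phi>" "\<phi> ` {0..1} = {b - 1..a}" "\<And>t. t \<in> {0..1} \<Longrightarrow> g t = \<gamma> (\<phi> t)"
        have "path_image g = \<gamma> ` {b - 1..a}"
          unfolding path_image_def \<phi>(2)[symmetric] image_image using \<phi>(3) by (rule image_cong[OF refl])
        moreover have "b - 1 \<in> {b - 1..a}" "b - 1 + 1/4 \<in> {b - 1..a}" using ab by auto
        ultimately have "\<gamma> (b - 1) \<in> path_image g" "\<gamma> (b - 1 + 1/4) \<in> path_image g" by blast+
        moreover have "\<gamma> (b - 1) = \<gamma> b" "\<gamma> (b - 1 + 1/4) = \<gamma> (b + 1/4)"
          using \<gamma>_add_int[of b "-1"] \<gamma>_add_int[of "b + 1/4" "-1"] by (auto simp: algebra_simps)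
        moreover have "bounded (path_image g)"
          using jg by (auto simp: joining_subarc_def intro: bounded_arc_image)
        ultimately have "d b \<le> diameter (path_image g)"
          unfolding d_def by (intro diameter_bounded_bound) auto
        then have False using small x0(2)[of b] b d0 by auto
        then show ?thesis ..
      qed
    qed
  qed (use \<delta> in auto)
qed

end

section \<open>Weighted sums over dyadic arcs\<close>

lemma suminf_shift_le_ennreal:
  fixes b :: "nat \<Rightarrow> ennreal"
  shows "(\<Sum>j. b (j + l)) \<le> (\<Sum>j. b j)"
proof (rule suminf_le_const)
  fix m
  have "(\<Sum>j<m. b (j + l)) = (\<Sum>j\<in>{l..<m + l}. b j)"
    using sum.shift_bounds_nat_ivl[of b 0 l m] by (simp add: lessThan_atLeast0)
  also have "\<dots> \<le> (\<Sum>j<m + l. b j)" by (intro sum_mono2) auto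
  also have "\<dots> \<le> (\<Sum>j. b j)" by (intro sum_le_suminf) auto
  finally show "(\<Sum>j<m. b (j + l)) \<le> (\<Sum>j. b j)" .
qed auto

lemma suminf_swap_ennreal:
  fixes f :: "nat \<Rightarrow> nat \<Rightarrow> ennreal"
  shows "(\<Sum>j. \<Sum>l. f j l) = (\<Sum>l. \<Sum>j. f j l)"
  using nn_integral_suminf[of "\<lambda>l j. f j l" "count_space UNIV"] by (simp add: nn_integral_count_space_nat)

text \<open>Since \<open>wt j \<le> \<sigma> ^ l * wt (j + l)\<close>, exchanging the sums leaves a
  geometric series in \<open>q * \<sigma>\<close>. In the application \<open>q\<close> is the decay
  rate of chords, slightly above 1/2, and \<open>e\<close> collects the squared bends by
  generation.\<close>

lemma geometric_convolution_le:
  fixes e :: "nat \<Rightarrow> ennreal" and wt :: "nat \<Rightarrow> real"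
  assumes wt: "\<And>j. 0 \<le> wt j" "\<And>j. wt j \<le> \<sigma> * wt (Suc j)" and \<sigma>: "0 \<le> \<sigma>" and q: "0 \<le> q" "q * \<sigma> < 1"
  shows "(\<Sum>j. ennreal (wt j) * (\<Sum>l. ennreal (q ^ l) * e (j + l))) \<le> ennreal (1 / (1 - q * \<sigma>)) * (\<Sum>j. ennreal (wt j) * e j)"
proof -
  have shift: "wt j \<le> \<sigma> ^ l * wt (j + l)" for j l
  proof (induction l)
    case (Suc l)
    have "\<sigma> ^ l * wt (j + l) \<le> \<sigma> ^ l * (\<sigma> * wt (Suc (j + l)))"
      using \<sigma> by (intro mult_left_mono wt) auto
    then show ?case using Suc by (simp add: mult_ac)
  qed simp
  have "(\<Sum>j. ennreal (wt j) * (\<Sum>l. ennreal (q ^ l) * e (j + l))) = (\<Sum>j. \<Sum>l. ennreal (wt j) * (ennreal (q ^ l) * e (j + l)))"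
    by simp
  also have "\<dots> \<le> (\<Sum>j. \<Sum>l. ennreal ((q * \<sigma>) ^ l) * (ennreal (wt (j + l)) * e (j + l)))"
  proof (intro suminf_le allI)
    fix j l
    have "q ^ l * wt j \<le> q ^ l * (\<sigma> ^ l * wt (j + l))"
      using q by (intro mult_left_mono shift) auto
    then have "ennreal (q ^ l * wt j) * e (j + l) \<le> ennreal ((q * \<sigma>) ^ l * wt (j + l)) * e (j + l)"
      by (intro mult_right_mono ennreal_leI) (auto simp: power_mult_distrib mult_ac)
    then show "ennreal (wt j) * (ennreal (q ^ l) * e (j + l)) \<le> ennreal ((q * \<sigma>) ^ l) * (ennreal (wt (j + l)) * e (j + l))"
      using q \<sigma> wt(1) by (simp add: ennreal_mult mult_ac)
  qed auto
  also have "\<dots> = (\<Sum>l. ennreal ((q * \<sigma>) ^ l) * (\<Sum>j. ennreal (wt (j + l)) * e (j + l)))"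
    by (subst suminf_swap_ennreal) simp
  also have "\<dots> \<le> (\<Sum>l. ennreal ((q * \<sigma>) ^ l) * (\<Sum>j. ennreal (wt j) * e j))"
    by (intro suminf_le allI mult_left_mono suminf_shift_le_ennreal) auto
  also have "\<dots> = (\<Sum>l. ennreal ((q * \<sigma>) ^ l)) * (\<Sum>j. ennreal (wt j) * e j)"
    by simp
  also have "(\<Sum>l. ennreal ((q * \<sigma>) ^ l)) = ennreal (1 / (1 - q * \<sigma>))"
    using q \<sigma> geometric_sums[of "q * \<sigma>"] by (intro suminf_ennreal_eq) auto
  finally show ?thesis .
qed

lemma sum_nested_lessThan:
  fixes g :: "nat \<Rightarrow> 'a :: comm_monoid_add"
  shows "(\<Sum>i<m. \<Sum>i'<n. g (i * n + i')) = (\<Sum>i<m * n. g i)"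
proof -
  have "(\<Sum>i'<n. g (i * n + i')) = sum g {i * n..<i * n + n}" for i
    using sum.shift_bounds_nat_ivl[of g 0 "i * n" n] by (simp add: lessThan_atLeast0 add.commute)
  then show ?thesis by (simp add: sum.nat_group)
qed

section \<open>Excess length of dyadic arcs in terms of bends\<close>

locale conformal_jordan = conformal_log f h + circle_param \<Gamma> f
  for \<Gamma> :: "complex set" and f h :: "complex \<Rightarrow> complex"
begin

definition bend_energy :: "nat \<Rightarrow> nat \<Rightarrow> nat \<Rightarrow> ennreal" where
  "bend_energy n k j = (\<Sum>i<2^j. ennreal ((bend (n + j) (k * 2 ^ j + i))\<^sup>2))"

lemma chord_\<gamma>: "chord n k = dist (\<gamma> (real k / 2 ^ n)) (\<gamma> (real (Suc k) / 2 ^ n))"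
  by (simp add: chord_def \<gamma>_def dpt_def dist_norm)

lemma sum_chord_le:
  assumes n: "n \<ge> 1" and bend: "\<And>n' k. n' \<ge> n \<Longrightarrow> bend n' k \<le> \<epsilon>"
    and X: "(\<Sum>l. ennreal (((1 + \<epsilon>) / 2) ^ l) * bend_energy n k l) \<le> ennreal X" "0 \<le> X"
  shows "(\<Sum>i<2^j. chord (n + j) (k * 2 ^ j + i)) \<le> chord n k * (1 + X)"
proof -
  let ?q = "(1 + \<epsilon>) / 2"
  have q: "0 \<le> ?q" using bend[of n k] bend_nonneg[of n k] by simp
  have be: "bend_energy n k l = ennreal (\<Sum>i<2^l. (bend (n + l) (k * 2 ^ l + i))\<^sup>2)" for l
    by (simp add: bend_energy_def sum_ennreal)
  have "ennreal (\<Sum>l<j. ?q ^ l * (\<Sum>i<2^l. (bend (n + l) (k * 2 ^ l + i))\<^sup>2)) = (\<Sum>l<j. ennreal (?q ^ l) * bend_energy n k l)"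
    unfolding be using q by (subst sum_ennreal[symmetric]) (auto intro!: sum.cong mult_nonneg_nonneg sum_nonneg simp: ennreal_mult sum_nonneg)
  also have "\<dots> \<le> (\<Sum>l. ennreal (?q ^ l) * bend_energy n k l)"
    by (intro sum_le_suminf) auto
  also note X(1)
  finally have "(\<Sum>l<j. ?q ^ l * (\<Sum>i<2^l. (bend (n + l) (k * 2 ^ l + i))\<^sup>2)) \<le> X"
    using X(2) by simp
  then have "chord n k * (1 + (\<Sum>l<j. ?q ^ l * (\<Sum>i<2^l. (bend (n + l) (k * 2 ^ l + i))\<^sup>2))) \<le> chord n k * (1 + X)"
    by (intro mult_left_mono) (auto simp: chord_def)
  with polygon_length_le[OF n bend] show ?thesis by (meson order_trans)
qed

lemma length_le_dyadic:
  assumes n: "n \<ge> 1" and bend: "\<And>n' k. n' \<ge> n \<Longrightarrow> bend n' k \<le> \<epsilon>"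
    and X: "(\<Sum>l. ennreal (((1 + \<epsilon>) / 2) ^ l) * bend_energy n k l) \<le> ennreal X" "0 \<le> X"
  shows "length_le (real k / 2 ^ n) (real (Suc k) / 2 ^ n) (chord n k * (1 + X))"
  unfolding length_le_def
proof (intro allI impI, elim conjE)
  fix N :: nat and \<tau> :: "nat \<Rightarrow> real"
  assume \<tau>: "mono_on {..N} \<tau>" "\<tau> ` {..N} \<subseteq> {real k / 2 ^ n..real (Suc k) / 2 ^ n}"
  show "(\<Sum>i<N. dist (\<gamma> (\<tau> i)) (\<gamma> (\<tau> (Suc i)))) \<le> chord n k * (1 + X)"
  proof (rule dyadic_partition_sum_le[OF continuous_\<gamma> _ \<tau>])
    fix j
    have "(\<Sum>l\<in>{k * 2 ^ j..<Suc k * 2 ^ j}. dist (\<gamma> (real l / 2 ^ (n + j))) (\<gamma> (real (Suc l) / 2 ^ (n + j))))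
        = (\<Sum>l\<in>{k * 2 ^ j..<Suc k * 2 ^ j}. chord (n + j) l)"
      by (simp only: chord_\<gamma>)
    also have "\<dots> = (\<Sum>i<2^j. chord (n + j) (k * 2 ^ j + i))"
      using sum.shift_bounds_nat_ivl[of "chord (n + j)" 0 "k * 2 ^ j" "2 ^ j"]
      by (simp add: lessThan_atLeast0 add.commute)
    also have "\<dots> \<le> chord n k * (1 + X)" by (rule sum_chord_le[OF n bend X])
    finally show "(\<Sum>l\<in>{k * 2 ^ j..<Suc k * 2 ^ j}. dist (\<gamma> (real l / 2 ^ (n + j))) (\<gamma> (real (Suc l) / 2 ^ (n + j)))) \<le> chord n k * (1 + X)" .
  qed
qed

lemma dyadic_Delta_eq:
  "dyadic_Delta \<Gamma> f (n, k) = (subarc_length \<Gamma> (\<gamma> (real k / 2 ^ n)) (\<gamma> (real (Suc k) / 2 ^ n)) - ennreal (chord n k)) / ennreal (chord n k)"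
  by (simp add: dyadic_Delta_def Delta_def Let_def chord_\<gamma> \<gamma>_def)

text \<open>On fine levels the subarc of smaller diameter is the image of the dyadic arc itself.\<close>

definition fine_level :: "nat \<Rightarrow> bool" where
  "fine_level n \<longleftrightarrow> n \<ge> 1 \<and> (\<forall>m\<ge>n. \<forall>k<2 ^ m. \<forall>S. length_le (real k / 2 ^ m) (real (Suc k) / 2 ^ m) S \<longrightarrow>
     subarc_length \<Gamma> (\<gamma> (real k / 2 ^ m)) (\<gamma> (real (Suc k) / 2 ^ m)) \<le> ennreal S)"

lemma ex_fine_level: "\<exists>n. fine_level n"
proof -
  obtain \<delta> where \<delta>: "\<delta> > 0" "\<And>a b S. 0 \<le> b \<Longrightarrow> b \<le> 1 \<Longrightarrow> a < b \<Longrightarrow> b - a \<le> \<delta> \<Longrightarrow> length_le a b S \<Longrightarrow>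
    subarc_length \<Gamma> (\<gamma> a) (\<gamma> b) \<le> ennreal S"
    by (rule subarc_length_le_small) blast
  obtain n where n: "(1/2) ^ n < \<delta>" using real_arch_pow_inv[of \<delta> "1/2"] \<delta>(1) by auto
  have "subarc_length \<Gamma> (\<gamma> (real k / 2 ^ m)) (\<gamma> (real (Suc k) / 2 ^ m)) \<le> ennreal S"
    if m: "n \<le> m" and k: "k < 2 ^ m" and S: "length_le (real k / 2 ^ m) (real (Suc k) / 2 ^ m) S" for m k S
  proof (rule \<delta>(2)[OF _ _ _ _ S])
    have "real (Suc k) \<le> real (2 ^ m)" using k by (simp only: of_nat_le_iff Suc_le_eq)
    then show "real (Suc k) / 2 ^ m \<le> 1" by simp
    have "1 / 2 ^ m \<le> 1 / (2::real) ^ n"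
      using m by (intro divide_left_mono power_increasing) auto
    then show "real (Suc k) / 2 ^ m - real k / 2 ^ m \<le> \<delta>"
      using n by (simp add: diff_divide_distrib[symmetric] power_divide)
  qed (auto simp: divide_strict_right_mono)
  then have "fine_level (max 1 n)" by (auto simp: fine_level_def)
  then show ?thesis ..
qed

lemma dyadic_Delta_le:
  assumes n: "fine_level n1" "n1 \<le> n" and k: "k < 2 ^ n" and bend: "\<And>n' k. n' \<ge> n \<Longrightarrow> bend n' k \<le> \<epsilon>"
  shows "dyadic_Delta \<Gamma> f (n, k) \<le> (\<Sum>l. ennreal (((1 + \<epsilon>) / 2) ^ l) * bend_energy n k l)" (is "_ \<le> ?X")
proof (cases "?X = \<infinity>")
  case False
  have n1: "n \<ge> 1" using n by (simp add: fine_level_def)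
  obtain X where X: "?X = ennreal X" "0 \<le> X" using False by (cases ?X) auto
  have c: "chord n k > 0" by (rule chord_pos[OF n1])
  have "length_le (real k / 2 ^ n) (real (Suc k) / 2 ^ n) (chord n k * (1 + X))"
    using X by (intro length_le_dyadic[OF n1 bend]) auto
  then have "subarc_length \<Gamma> (\<gamma> (real k / 2 ^ n)) (\<gamma> (real (Suc k) / 2 ^ n)) \<le> ennreal (chord n k * (1 + X))"
    using n k unfolding fine_level_def by blast
  then have "subarc_length \<Gamma> (\<gamma> (real k / 2 ^ n)) (\<gamma> (real (Suc k) / 2 ^ n)) - ennreal (chord n k)
      \<le> ennreal (chord n k * (1 + X)) - ennreal (chord n k)"
    by (rule ennreal_minus_mono) simp
  also have "\<dots> = ennreal (chord n k * X)"
    using c by (subst ennreal_minus) (auto simp: algebra_simps)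
  finally have "dyadic_Delta \<Gamma> f (n, k) \<le> ennreal (chord n k * X) / ennreal (chord n k)"
    unfolding dyadic_Delta_eq by (rule divide_right_mono_ennreal)
  also have "\<dots> = ennreal X" using c X(2) by (subst divide_ennreal) auto
  finally show ?thesis using X by simp
qed simp

text \<open>The arcs j + l generations down are regrouped by their ancestors j generations down;
  this produces the shifted index of \<open>geometric_convolution_le\<close>.\<close>

lemma sum_bend_energy: "(\<Sum>i<2^j. bend_energy (n + j) (k * 2 ^ j + i) l) = bend_energy n k (j + l)"
proof -
  have "(\<Sum>i<2^j. bend_energy (n + j) (k * 2 ^ j + i) l)
      = (\<Sum>i<2^j. \<Sum>i'<2^l. ennreal ((bend (n + (j + l)) (k * 2 ^ (j + l) + (i * 2 ^ l + i')))\<^sup>2))"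
    by (simp add: bend_energy_def power_add algebra_simps)
  also have "\<dots> = bend_energy n k (j + l)"
    unfolding bend_energy_def
    using sum_nested_lessThan[of "\<lambda>i. ennreal ((bend (n + (j + l)) (k * 2 ^ (j + l) + i))\<^sup>2)" "2 ^ l" "2 ^ j"]
    by (simp add: power_add)
  finally show ?thesis .
qed

abbreviation Delta_sum :: "(nat \<Rightarrow> real) \<Rightarrow> nat \<Rightarrow> nat \<Rightarrow> ennreal" where
  "Delta_sum wt n k \<equiv> (\<Sum>j. ennreal (wt (n + j)) * (\<Sum>i<2^j. dyadic_Delta \<Gamma> f (n + j, k * 2 ^ j + i)))"

abbreviation bend_sum :: "(nat \<Rightarrow> real) \<Rightarrow> nat \<Rightarrow> nat \<Rightarrow> ennreal" where
  "bend_sum wt n k \<equiv> (\<Sum>j. ennreal (wt (n + j)) * bend_energy n k j)"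

lemma weighted_Delta_sum_le:
  assumes n: "fine_level n1" "n1 \<le> n" and k: "k < 2 ^ n" and bend: "\<And>n' k. n' \<ge> n \<Longrightarrow> bend n' k \<le> \<epsilon>"
    and wt: "\<And>m. n \<le> m \<Longrightarrow> 0 \<le> wt m" "\<And>m. n \<le> m \<Longrightarrow> wt m \<le> \<sigma> * wt (Suc m)" and \<sigma>: "0 \<le> \<sigma>" "(1 + \<epsilon>) / 2 * \<sigma> < 1"
  shows "Delta_sum wt n k
      \<le> ennreal (1 / (1 - (1 + \<epsilon>) / 2 * \<sigma>)) * bend_sum wt n k"
proof -
  let ?q = "(1 + \<epsilon>) / 2"
  have q: "0 \<le> ?q" using bend[of n k] bend_nonneg[of n k] by simp
  have "(\<Sum>i<2^j. dyadic_Delta \<Gamma> f (n + j, k * 2 ^ j + i)) \<le> (\<Sum>l. ennreal (?q ^ l) * bend_energy n k (j + l))" for j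
  proof -
    have "(\<Sum>i<2^j. dyadic_Delta \<Gamma> f (n + j, k * 2 ^ j + i)) \<le> (\<Sum>i<2^j. \<Sum>l. ennreal (?q ^ l) * bend_energy (n + j) (k * 2 ^ j + i) l)"
      using n k by (intro sum_mono dyadic_Delta_le[OF n(1)] bend descendant_less) auto
    also have "\<dots> = (\<Sum>l. \<Sum>i<2^j. ennreal (?q ^ l) * bend_energy (n + j) (k * 2 ^ j + i) l)"
      by (subst suminf_sum) auto
    also have "\<dots> = (\<Sum>l. ennreal (?q ^ l) * bend_energy n k (j + l))"
      by (simp add: sum_distrib_left[symmetric] sum_bend_energy)
    finally show ?thesis .
  qed
  then have "Delta_sum wt n k
      \<le> (\<Sum>j. ennreal (wt (n + j)) * (\<Sum>l. ennreal (?q ^ l) * bend_energy n k (j + l)))"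
    by (intro suminf_le allI mult_left_mono) auto
  also have "\<dots> \<le> ennreal (1 / (1 - ?q * \<sigma>)) * bend_sum wt n k"
    using wt \<sigma> q by (intro geometric_convolution_le) auto
  finally show ?thesis .
qed

text \<open>The first term stems from the curvature of the circle itself: each of the 2^j arcs of
  generation n + j brings the term 120 / 4^(n + j) of \<open>bend_bounds\<close>. The second term is
  what \<open>cone_energy_sum_le\<close> makes of the cone energies.\<close>

lemma weighted_bend_energy_le:
  fixes wt :: "nat \<Rightarrow> real" and \<Omega> :: "real \<Rightarrow> real" and K \<sigma> :: real
  assumes n: "n \<ge> 3" and k: "k < 2 ^ n"
    and small: "\<And>z. z \<in> ball 0 1 \<Longrightarrow> 1 - norm z \<le> 5 / 2 ^ n \<Longrightarrow> norm (deriv h z) * (1 - norm z) \<le> \<eta>"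
    and \<eta>: "\<eta> \<le> 1/72" "\<eta> \<ge> 0"
    and wt: "\<And>m. n \<le> m \<Longrightarrow> 0 \<le> wt m" "\<And>m. n \<le> m \<Longrightarrow> wt m \<le> \<sigma> * wt (Suc m)" and \<sigma>: "0 \<le> \<sigma>" "\<sigma> < 2"
    and \<Omega>: "\<Omega> \<in> borel_measurable borel" and K: "K \<ge> 0"
    and wt\<Omega>: "\<And>N t. n \<le> N \<Longrightarrow> 0 < t \<Longrightarrow> t \<le> 10 / 2 ^ N \<Longrightarrow> 10 / 2 ^ Suc N < t \<Longrightarrow> wt N \<le> K * \<Omega> t"
  shows "bend_sum wt n k \<le> ennreal (120 / 2 ^ n) * (\<Sum>j. ennreal (wt (n + j) / 2 ^ (n + j)))
    + ennreal (640000000 / (2 - \<sigma>) * K) * weighted_energy \<Omega> (cball (mid n k) (14 / 2 ^ n))"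
proof -
  let ?c = "\<lambda>j. \<Sum>i<2^j. \<Sum>e\<le>2. cone_energy (n + j) (k * 2 ^ j + i) e"
  have small': "norm (deriv h z) * (1 - norm z) \<le> \<eta>" if "z \<in> ball 0 1" "1 - norm z \<le> 5 / 2 ^ (n + j)" for z j
  proof -
    have "5 / 2 ^ (n + j) \<le> 5 / (2::real) ^ n" by (intro divide_left_mono power_increasing) auto
    then show ?thesis using that by (intro small) auto
  qed
  have be: "bend_energy n k j \<le> ennreal (120 / 2 ^ n * (1 / 2 ^ (n + j))) + ennreal 160000 * ?c j" for j
  proof -
    have "bend_energy n k j \<le> (\<Sum>i<(2::nat)^j. ennreal (120 / 4 ^ (n + j)) + ennreal 160000 * (\<Sum>e\<le>2. cone_energy (n + j) (k * 2 ^ j + i) e))"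
      unfolding bend_energy_def using n by (intro sum_mono bend_bounds(2)[OF _ small' \<eta>]) auto
    also have "\<dots> = (\<Sum>i<(2::nat)^j. ennreal (120 / 4 ^ (n + j))) + ennreal 160000 * ?c j"
      by (simp add: sum.distrib sum_distrib_left)
    also have "(\<Sum>i<(2::nat)^j. ennreal (120 / 4 ^ (n + j))) = ennreal (2 ^ j * (120 / 4 ^ (n + j)))"
      by (subst sum_ennreal) auto
    also have "2 ^ j * (120 / 4 ^ (n + j)) = 120 / 2 ^ n * (1 / (2::real) ^ (n + j))"
    proof -
      have "(4::real) ^ (n + j) = 2 ^ n * 2 ^ j * 2 ^ (n + j)"
        by (metis power_add power_mult_distrib mult_2 numeral_Bit0 numeral_times_numeral semiring_norm(12,13) mult.right_neutral numeral_One mult_numeral_1)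
      then show ?thesis by simp
    qed
    finally show ?thesis .
  qed
  have "bend_sum wt n k
      \<le> (\<Sum>j. ennreal (120 / 2 ^ n) * ennreal (wt (n + j) / 2 ^ (n + j)) + ennreal 160000 * (ennreal (wt (n + j)) * ?c j))"
  proof (intro suminf_le allI)
    fix j
    have "ennreal (wt (n + j)) * bend_energy n k j \<le> ennreal (wt (n + j)) * (ennreal (120 / 2 ^ n * (1 / 2 ^ (n + j))) + ennreal 160000 * ?c j)"
      by (intro mult_left_mono be) auto
    also have "\<dots> = ennreal (wt (n + j)) * ennreal (120 / 2 ^ n * (1 / 2 ^ (n + j))) + ennreal 160000 * (ennreal (wt (n + j)) * ?c j)"
      by (simp only: distrib_left mult.left_commute)
    also have "ennreal (wt (n + j)) * ennreal (120 / 2 ^ n * (1 / 2 ^ (n + j))) = ennreal (120 / 2 ^ n) * ennreal (wt (n + j) / 2 ^ (n + j))"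
      using wt(1)[of "n + j"] by (simp add: ennreal_mult[symmetric] mult_ac)
    finally show "ennreal (wt (n + j)) * bend_energy n k j \<le> ennreal (120 / 2 ^ n) * ennreal (wt (n + j) / 2 ^ (n + j)) + ennreal 160000 * (ennreal (wt (n + j)) * ?c j)" .
  qed auto
  also have "\<dots> = ennreal (120 / 2 ^ n) * (\<Sum>j. ennreal (wt (n + j) / 2 ^ (n + j))) + ennreal 160000 * (\<Sum>j. ennreal (wt (n + j)) * ?c j)"
    by (subst suminf_add[symmetric]) (simp_all only: summableI ennreal_suminf_cmult)
  also have "\<dots> \<le> ennreal (120 / 2 ^ n) * (\<Sum>j. ennreal (wt (n + j) / 2 ^ (n + j))) + ennreal 160000 * (ennreal (3960 / (2 - \<sigma>) * K) * weighted_energy \<Omega> (cball (mid n k) (14 / 2 ^ n)))"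
    using cone_energy_sum_le[where wt = wt, OF n k wt \<sigma> \<Omega> K wt\<Omega>] by (intro add_mono order_refl mult_left_mono) auto
  also have "ennreal 160000 * (ennreal (3960 / (2 - \<sigma>) * K) * weighted_energy \<Omega> (cball (mid n k) (14 / 2 ^ n)))
     = ennreal (160000 * (3960 / (2 - \<sigma>) * K)) * weighted_energy \<Omega> (cball (mid n k) (14 / 2 ^ n))"
    using \<sigma> K by (subst mult.assoc[symmetric], subst ennreal_mult[symmetric]) auto
  \<comment> \<open>160000 * 3960, rounded up.\<close>
  also have "\<dots> \<le> ennreal (640000000 / (2 - \<sigma>) * K) * weighted_energy \<Omega> (cball (mid n k) (14 / 2 ^ n))"
    using \<sigma> K by (intro mult_right_mono ennreal_leI) (auto simp: divide_simps)
  finally show ?thesis by (simp add: add_mono)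
qed

end

section \<open>The two function classes\<close>

lemma infsum_ennreal_le:
  fixes G :: "'a \<Rightarrow> ennreal"
  assumes "\<And>F. finite F \<Longrightarrow> F \<subseteq> A \<Longrightarrow> sum G F \<le> B"
  shows "infsum G A \<le> B"
  using assms by (intro infsum_le_finite_sums nonneg_summable_on_complete) auto

definition descendants :: "nat \<Rightarrow> nat \<Rightarrow> (nat \<times> nat) set" where
  "descendants n k = {(n + j, k * 2 ^ j + i) | j i. i < 2 ^ j}"

lemma sum_descendants_le:
  fixes G :: "nat \<times> nat \<Rightarrow> ennreal"
  assumes F: "finite F" "F \<subseteq> descendants n k"
  shows "sum G F \<le> (\<Sum>j. \<Sum>i<2^j. G (n + j, k * 2 ^ j + i))"
proof -
  obtain M where M: "\<And>x. x \<in> fst ` F \<Longrightarrow> x < M"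
    using F(1) finite_nat_set_iff_bounded[of "fst ` F"] by auto
  define \<rho> where "\<rho> = (\<lambda>(j, i). (n + j, k * 2 ^ j + i))"
  define D where "D = (SIGMA j:{..<M}. {..<(2::nat)^j})"
  have fin: "finite D" unfolding D_def by (intro finite_SigmaI) auto
  have "F \<subseteq> \<rho> ` D"
  proof
    fix x assume "x \<in> F"
    then obtain j i where ji: "x = (n + j, k * 2 ^ j + i)" "i < 2 ^ j" using F(2) by (auto simp: descendants_def)
    with \<open>x \<in> F\<close> M[of "n + j"] have "(j, i) \<in> D" by (force simp: D_def)
    then show "x \<in> \<rho> ` D" using ji by (force simp: \<rho>_def)
  qed
  then have "sum G F \<le> sum G (\<rho> ` D)"
    using fin by (intro sum_mono2) auto
  also have "\<dots> = (\<Sum>x\<in>D. G (\<rho> x))"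
    by (rule sum.reindex[unfolded o_def]) (auto simp: inj_on_def \<rho>_def)
  also have "\<dots> = (\<Sum>j<M. \<Sum>i<2^j. G (n + j, k * 2 ^ j + i))"
    unfolding D_def \<rho>_def by (subst sum.Sigma) (auto simp: case_prod_beta')
  also have "\<dots> \<le> (\<Sum>j. \<Sum>i<2^j. G (n + j, k * 2 ^ j + i))"
    by (intro sum_le_suminf) auto
  finally show ?thesis .
qed

text \<open>Keeping \<open>x\<close> strictly between 0 and 1 excludes the point of the circle that
  has two parameters in the unit interval, and with it the integer ambiguity.\<close>

lemma circle_arc_parameter:
  assumes "cis (2 * pi * x) \<in> circle_arc a b" "0 \<le> a" "b \<le> 1" "0 < x" "x < 1"
  shows "a \<le> x \<and> x \<le> b"
proof -
  obtain y where y: "y \<in> {a..b}" "cis (2 * pi * x) = cis (2 * pi * y)"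
    using assms(1) by (auto simp: circle_arc_def)
  obtain m :: int where "4 * \<bar>x - y - of_int m\<bar> \<le> dist (cis (2 * pi * x)) (cis (2 * pi * y))"
    by (rule cis_near)
  then have m: "x = y + of_int m" using y by simp
  then have "\<bar>of_int m :: real\<bar> < 1" using y assms by auto
  then have "m = 0" by (simp flip: of_int_abs)
  then show ?thesis using m y by simp
qed

text \<open>Inclusion of point sets becomes inequalities between indices by sampling interior points
  of the smaller arc, since an endpoint may be the point with parameters 0 and 1. Two samples
  compare the lengths; once generations are ordered, the midpoint identifies the ancestor.\<close>

lemma dyadic_subarc_descendant:
  assumes J: "(n, k) \<in> dyadic_indices" and I: "I \<in> dyadic_indices" and sub: "dyadic_arc I \<subseteq> dyadic_arc (n, k)"
  shows "I \<in> descendants n k"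
proof -
  obtain m l where ml: "I = (m, l)" by (cases I)
  have kn: "k < 2 ^ n" "n \<ge> 1" and lm: "l < 2 ^ m" "m \<ge> 1" using J I ml by (auto simp: dyadic_indices_def)
  have "real (Suc k) \<le> real (2 ^ n)" "real (Suc l) \<le> real (2 ^ m)"
    using kn lm by (simp_all only: of_nat_le_iff Suc_le_eq)
  then have k1: "real (Suc k) / 2 ^ n \<le> 1" and l1: "real (Suc l) / 2 ^ m \<le> 1"
    by simp_all
  have range: "real k / 2 ^ n \<le> (real l + s) / 2 ^ m \<and> (real l + s) / 2 ^ m \<le> real (Suc k) / 2 ^ n"
    if s: "0 < s" "s < 1" for s :: real
  proof (rule circle_arc_parameter)
    have "cis (2 * pi * ((real l + s) / 2 ^ m)) \<in> dyadic_arc I"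
      unfolding ml dyadic_arc_def circle_arc_def using s
      by (auto intro!: image_eqI[where x = "(real l + s) / 2 ^ m"] divide_right_mono)
    then show "cis (2 * pi * ((real l + s) / 2 ^ m)) \<in> circle_arc (real k / 2 ^ n) (real (Suc k) / 2 ^ n)"
      using sub by (auto simp: dyadic_arc_def)
    have "(real l + s) / 2 ^ m < real (Suc l) / 2 ^ m" using s by (intro divide_strict_right_mono) auto
    then show "(real l + s) / 2 ^ m < 1" using l1 by linarith
  qed (use k1 s in auto)
  \<comment> \<open>If the contained arc belonged to a coarser generation it would be at least twice
    as long as \<open>(n, k)\<close>, while the samples at 1/5 and 4/5 show that 3/5 of it fits
    inside.\<close>
  have nm: "n \<le> m"
  proof (rule ccontr)
    assume "\<not> n \<le> m"
    then have "(2::real) ^ Suc m \<le> 2 ^ n" by (intro power_increasing) auto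
    then have "1 / (2::real) ^ n \<le> 1 / 2 ^ Suc m" by (intro divide_left_mono) auto
    moreover have "(real l + 4/5) / 2 ^ m - (real l + 1/5) / 2 ^ m \<le> real (Suc k) / 2 ^ n - real k / 2 ^ n"
      using range[of "1/5"] range[of "4/5"] by simp
    then have "(3/5) / 2 ^ m \<le> 1 / (2::real) ^ n"
      by (simp add: diff_divide_distrib[symmetric])
    ultimately have "(3/5) / 2 ^ m \<le> (1/2) / (2::real) ^ m" by simp
    then show False by (simp add: field_simps)
  qed
  define j where "j = m - n"
  have m: "m = n + j" using nm by (simp add: j_def)
  have r: "real k * 2 ^ j \<le> real l + 1/2" "real l + 1/2 \<le> real (Suc k) * 2 ^ j"
  proof -
    have e: "((real l + 1/2) / 2 ^ j) / 2 ^ n = (real l + 1/2) / 2 ^ m" by (simp add: m power_add)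
    have "real k / 2 ^ n \<le> ((real l + 1/2) / 2 ^ j) / 2 ^ n \<and> ((real l + 1/2) / 2 ^ j) / 2 ^ n \<le> real (Suc k) / 2 ^ n"
      unfolding e by (rule range) auto
    then have "real k \<le> (real l + 1/2) / 2 ^ j" "(real l + 1/2) / 2 ^ j \<le> real (Suc k)"
      unfolding divide_le_cancel by simp_all
    then show "real k * 2 ^ j \<le> real l + 1/2" "real l + 1/2 \<le> real (Suc k) * 2 ^ j"
      by (simp_all add: pos_le_divide_eq pos_divide_le_eq)
  qed
  have "real (k * 2 ^ j) < real (l + 1)" using r by simp
  then have 1: "k * 2 ^ j \<le> l" by linarith
  have "real l < real (Suc k) * 2 ^ j" using r(2) by linarith
  then have "real l < real (Suc k * 2 ^ j)" by (simp only: of_nat_mult of_nat_power of_nat_numeral)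
  then have "l < Suc k * 2 ^ j" by (simp only: of_nat_less_iff)
  then have "l - k * 2 ^ j < 2 ^ j" using 1 by simp
  moreover have "l = k * 2 ^ j + (l - k * 2 ^ j)" using 1 by simp
  ultimately show ?thesis unfolding ml m descendants_def by blast
qed

text \<open>Radial projection to the circle moves w by at most r, so the projection is within 2 r of
  the centre and, by \<open>cis_near\<close>, within r / 2 in the parameter. An arc of length r
  therefore suffices, and its box also reaches down to height r.\<close>

lemma cball_Int_ball_subset_carleson_box:
  assumes r: "0 < r" "r < 1"
  shows "cball (cis (2 * pi * x)) r \<inter> ball 0 1 \<subseteq> carleson_box (x - r / 2) (x + r / 2)"
proof
  fix w assume w: "w \<in> cball (cis (2 * pi * x)) r \<inter> ball 0 1"
  then have wx: "norm (w - cis (2 * pi * x)) \<le> r" and w1: "norm w < 1"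
    by (auto simp: dist_norm norm_minus_commute)
  have n: "1 - norm w \<le> r" using norm_triangle_ineq2[of "cis (2 * pi * x)" w] wx by (simp add: norm_minus_commute)
  then have w0: "w \<noteq> 0" using r by auto
  define y where "y = Arg w / (2 * pi)"
  have "w = of_real (norm w) * cis (Arg w)" using w0 by (metis rcis_cmod_Arg rcis_def)
  then have u: "w / of_real (norm w) = cis (2 * pi * y)" "w = of_real (norm w) * cis (2 * pi * y)"
    using w0 by (auto simp: y_def field_simps)
  have "dist (cis (2 * pi * y)) w = norm (of_real (1 - norm w) * cis (2 * pi * y))"
    by (subst u(2)) (simp add: dist_norm algebra_simps)
  also have "\<dots> = 1 - norm w" using w1 unfolding norm_mult norm_of_real norm_cis by simp
  finally have "dist (cis (2 * pi * y)) (cis (2 * pi * x)) \<le> 2 * r"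
    using dist_triangle[of "cis (2 * pi * y)" "cis (2 * pi * x)" w] n wx by (simp add: dist_norm)
  obtain m :: int where "4 * \<bar>y - x - of_int m\<bar> \<le> dist (cis (2 * pi * y)) (cis (2 * pi * x))"
    by (rule cis_near)
  also have "\<dots> \<le> 2 * r" by fact
  finally have "\<bar>(y - of_int m) - x\<bar> \<le> r / 2" by (simp add: algebra_simps)
  then have "y - of_int m \<in> {x - r / 2..x + r / 2}" unfolding abs_le_iff by (simp add: algebra_simps)
  moreover have "cis (2 * pi * y) = cis (2 * pi * (y - of_int m))"
    using cis_add_int[of y "- m"] by simp
  ultimately have "w / of_real (norm w) \<in> circle_arc (x - r / 2) (x + r / 2)"
    unfolding u(1) circle_arc_def by blast
  then show "w \<in> carleson_box (x - r / 2) (x + r / 2)"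
    using n w1 by (simp add: carleson_box_def)
qed

lemma Q_p0_bound:
  assumes h: "h \<in> Q_p0 p" and e: "e > 0"
  obtains \<delta> where "\<delta> > 0" "\<And>a b. a < b \<Longrightarrow> b - a \<le> 1 \<Longrightarrow> b - a \<le> \<delta> \<Longrightarrow>
    (\<integral>\<^sup>+ z\<in>carleson_box a b. ennreal ((norm (deriv h z))\<^sup>2 * (1 - (norm z)\<^sup>2) powr p) \<partial>lborel) \<le> ennreal (e * (b - a) powr p)"
proof -
  define I where "I a b = (\<integral>\<^sup>+ z\<in>carleson_box a b. ennreal ((norm (deriv h z))\<^sup>2 * (1 - (norm z)\<^sup>2) powr p) \<partial>lborel)" for a b
  have "((\<lambda>\<delta>. SUP (a, b)\<in>{(a, b). a < b \<and> b - a \<le> 1 \<and> b - a \<le> \<delta>}. ennreal (1 / (b - a) powr p) * I a b) \<longlongrightarrow> 0) (at_right 0)"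
    using h by (simp add: Q_p0_def I_def)
  then have "\<forall>\<^sub>F \<delta> in at_right 0. (SUP (a, b)\<in>{(a, b). a < b \<and> b - a \<le> 1 \<and> b - a \<le> \<delta>}. ennreal (1 / (b - a) powr p) * I a b) < ennreal e"
    using e by (intro order_tendstoD(2)) auto
  then obtain d where d: "d > 0" "\<And>\<delta>. 0 < \<delta> \<Longrightarrow> \<delta> < d \<Longrightarrow> (SUP (a, b)\<in>{(a, b). a < b \<and> b - a \<le> 1 \<and> b - a \<le> \<delta>}. ennreal (1 / (b - a) powr p) * I a b) < ennreal e"
    unfolding eventually_at_right_field by auto
  show ?thesis
  proof (rule that[of "d / 2", folded I_def])
    fix a b :: real assume ab: "a < b" "b - a \<le> 1" "b - a \<le> d / 2"
    have pos: "(b - a) powr p > 0" using ab by simp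
    have "ennreal (1 / (b - a) powr p) * I a b \<le> (SUP (a, b)\<in>{(a, b). a < b \<and> b - a \<le> 1 \<and> b - a \<le> d / 2}. ennreal (1 / (b - a) powr p) * I a b)"
      using ab by (intro SUP_upper2[of "(a, b)"]) auto
    also have "\<dots> \<le> ennreal e" using d by (intro less_imp_le d(2)) auto
    finally have "ennreal ((b - a) powr p) * (ennreal (1 / (b - a) powr p) * I a b) \<le> ennreal ((b - a) powr p) * ennreal e"
      by (rule mult_left_mono) simp
    moreover have "ennreal ((b - a) powr p) * (ennreal (1 / (b - a) powr p) * I a b) = I a b"
      using pos by (subst mult.assoc[symmetric], subst ennreal_mult[symmetric]) auto
    ultimately show "I a b \<le> ennreal (e * (b - a) powr p)"
      using e by (simp add: ennreal_mult[symmetric] mult.commute)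
  qed (use d in auto)
qed

section \<open>Energy near the circle and the smallness of (1 - |z|) |h'(z)|\<close>

context conformal_log
begin

text \<open>With t the height of z, the mean value inequality on the disc of radius t / 2 around z
  bounds |h'(z)|^2 by 64 / t^2 times the energy of the disc; hence the 64. The lower bound
  \<open>c\<close> for the weight passes from the energy to the weighted energy.\<close>

lemma bloch_le_of_energy:
  assumes z: "z \<in> ball 0 1" and c: "c > 0" and \<eta>: "\<eta> > 0"
    and \<Omega>: "\<And>w. w \<in> ball z ((1 - norm z) / 2) \<Longrightarrow> c \<le> \<Omega> (1 - norm w)"
    and I: "weighted_energy \<Omega> (ball z ((1 - norm z) / 2)) \<le> ennreal (c * \<eta>\<^sup>2 / 64)"
  shows "norm (deriv h z) * (1 - norm z) \<le> \<eta>"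
proof -
  define t where "t = 1 - norm z"
  have t: "t > 0" using z by (simp add: t_def)
  have "ball z (t / 2) \<subseteq> ball 0 1"
  proof
    fix w assume "w \<in> ball z (t / 2)"
    then show "w \<in> ball 0 1"
      using norm_triangle_sub[of w z] t by (simp add: dist_norm norm_minus_commute t_def)
  qed
  then have 1: "ennreal ((norm (deriv h z))\<^sup>2) \<le> ennreal (4 / (t / 4)\<^sup>2) * energy_on (ball z (t / 2))"
    using norm_dh_square_le[of z "t / 4"] t by simp
  have "ennreal c * energy_on (ball z (t / 2)) = (\<integral>\<^sup>+ w. ennreal c * (energy w * indicator (ball z (t / 2)) w) \<partial>lborel)"
  proof (rule nn_integral_cmult[symmetric])
    have [measurable]: "ball z (t / 2) \<in> sets borel" by simp
    show "(\<lambda>w. energy w * indicator (ball z (t / 2)) w) \<in> borel_measurable lborel" by measurable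
  qed
  also have "\<dots> \<le> weighted_energy \<Omega> (ball z (t / 2))"
    using \<Omega> by (intro nn_integral_mono)
      (auto simp: t_def mult.commute[of "ennreal c"] intro!: mult_left_mono ennreal_leI split: split_indicator)
  also have "\<dots> \<le> ennreal (c * \<eta>\<^sup>2 / 64)" using I by (simp add: t_def)
  finally have 2: "ennreal c * energy_on (ball z (t / 2)) \<le> ennreal (c * \<eta>\<^sup>2 / 64)" .
  have "ennreal (c * t\<^sup>2 / 64) * ennreal ((norm (deriv h z))\<^sup>2) \<le> ennreal (c * t\<^sup>2 / 64) * (ennreal (4 / (t / 4)\<^sup>2) * energy_on (ball z (t / 2)))"
    by (intro mult_left_mono 1) simp
  also have "\<dots> = ennreal c * energy_on (ball z (t / 2))"
    using t c by (subst mult.assoc[symmetric], subst ennreal_mult[symmetric]) (auto simp: power_divide)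
  also note 2
  finally have "ennreal (c * t\<^sup>2 / 64 * (norm (deriv h z))\<^sup>2) \<le> ennreal (c * \<eta>\<^sup>2 / 64)"
    using c by (subst ennreal_mult) auto
  then have "c * t\<^sup>2 / 64 * (norm (deriv h z))\<^sup>2 \<le> c * \<eta>\<^sup>2 / 64"
    using c by (subst (asm) ennreal_le_iff) auto
  then have "c * (norm (deriv h z) * t)\<^sup>2 \<le> c * \<eta>\<^sup>2" by (simp add: power_mult_distrib mult_ac)
  then have "(norm (deriv h z) * t)\<^sup>2 \<le> \<eta>\<^sup>2" using c by simp
  then show ?thesis using \<eta> unfolding t_def by (rule_tac power2_le_imp_le) auto
qed

abbreviation powr_energy :: "real \<Rightarrow> complex set \<Rightarrow> ennreal" where
  "powr_energy p \<equiv> weighted_energy (\<lambda>t. t powr p)"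

text \<open>The centre is an arbitrary point of the circle, so the uniformity in \<open>Q_p0\<close>
  over all arcs is used. The weights are compared by 1 - |w| <= 1 - |w|^2.\<close>

lemma Q_p0_cball_energy:
  assumes h: "h \<in> Q_p0 p" and p: "0 < p" and e: "e > 0"
  obtains \<delta> where "\<delta> > 0" "\<And>x r. 0 < r \<Longrightarrow> r \<le> \<delta> \<Longrightarrow>
    powr_energy p (cball (cis (2 * pi * x)) r) \<le> ennreal (e * r powr p)"
proof -
  obtain \<delta> where \<delta>: "\<delta> > 0" "\<And>a b. a < b \<Longrightarrow> b - a \<le> 1 \<Longrightarrow> b - a \<le> \<delta> \<Longrightarrow>
    (\<integral>\<^sup>+ z\<in>carleson_box a b. ennreal ((norm (deriv h z))\<^sup>2 * (1 - (norm z)\<^sup>2) powr p) \<partial>lborel) \<le> ennreal (e * (b - a) powr p)"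
    by (rule Q_p0_bound[OF h e]) blast
  show ?thesis
  proof (rule that[of "min \<delta> (1/2)"])
    fix x r :: real assume r: "0 < r" "r \<le> min \<delta> (1/2)"
    have "powr_energy p (cball (cis (2 * pi * x)) r)
        \<le> (\<integral>\<^sup>+ z\<in>carleson_box (x - r / 2) (x + r / 2). ennreal ((norm (deriv h z))\<^sup>2 * (1 - (norm z)\<^sup>2) powr p) \<partial>lborel)"
    proof (rule nn_integral_mono)
      fix w
      show "energy w * ennreal ((1 - norm w) powr p) * indicator (cball (cis (2 * pi * x)) r) w
         \<le> ennreal ((norm (deriv h w))\<^sup>2 * (1 - (norm w)\<^sup>2) powr p) * indicator (carleson_box (x - r / 2) (x + r / 2)) w"
      proof (cases "w \<in> cball (cis (2 * pi * x)) r \<inter> ball 0 1")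
        case True
        then have "w \<in> carleson_box (x - r / 2) (x + r / 2)"
          using cball_Int_ball_subset_carleson_box[of r x] r by auto
        moreover have "(1 - norm w) powr p \<le> (1 - (norm w)\<^sup>2) powr p"
        proof (rule powr_mono2)
          have "(norm w)\<^sup>2 \<le> norm w * 1" unfolding power2_eq_square using True by (intro mult_left_mono) auto
          then show "1 - norm w \<le> 1 - (norm w)\<^sup>2" by simp
        qed (use p True in auto)
        ultimately show ?thesis
          using True by (auto simp: energy_def ennreal_mult[symmetric] intro!: ennreal_leI mult_left_mono)
      qed (auto simp: energy_def split: split_indicator)
    qed
    also have "\<dots> \<le> ennreal (e * ((x + r / 2) - (x - r / 2)) powr p)"
      using r by (intro \<delta>(2)) auto
    finally show "powr_energy p (cball (cis (2 * pi * x)) r) \<le> ennreal (e * r powr p)"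
      by simp
  qed (use \<delta> in auto)
qed

lemma Q_p0_little_bloch:
  assumes h: "h \<in> Q_p0 p" and p: "0 < p" "p < 1" and \<eta>: "\<eta> > 0"
  obtains \<delta> where "\<delta> > 0" "\<And>z. z \<in> ball 0 1 \<Longrightarrow> 1 - norm z \<le> \<delta> \<Longrightarrow> norm (deriv h z) * (1 - norm z) \<le> \<eta>"
proof -
  \<comment> \<open>The disc of radius t / 2 around z lies in a ball of radius 2 t centred on the
    circle, and \<open>(2 * t) powr p\<close> is at most 4 times \<open>(t / 2) powr p\<close>; so
    256 = 4 * 64.\<close>
  define e where "e = \<eta>\<^sup>2 / 256"
  have e: "e > 0" using \<eta> by (simp add: e_def)
  obtain \<delta> where \<delta>: "\<delta> > 0" "\<And>x r. 0 < r \<Longrightarrow> r \<le> \<delta> \<Longrightarrow>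
    powr_energy p (cball (cis (2 * pi * x)) r) \<le> ennreal (e * r powr p)"
    by (rule Q_p0_cball_energy[OF h p(1) e]) blast
  show ?thesis
  proof (rule that[of "\<delta> / 2"])
    fix z :: complex assume z: "z \<in> ball 0 1" and zd: "1 - norm z \<le> \<delta> / 2"
    define t where "t = 1 - norm z"
    have t: "0 < t" "t \<le> \<delta> / 2" using z zd by (auto simp: t_def)
    define x where "x = Arg z / (2 * pi)"
    have zx: "z = of_real (norm z) * cis (2 * pi * x)" using rcis_cmod_Arg[of z] by (simp add: x_def rcis_def)
    have "dist z (cis (2 * pi * x)) = norm (of_real (norm z - 1) * cis (2 * pi * x))"
      by (subst zx) (simp add: dist_norm algebra_simps)
    also have "\<dots> = t" using t unfolding norm_mult norm_of_real norm_cis by (simp add: t_def)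
    finally have dz: "dist z (cis (2 * pi * x)) = t" .
    have "norm (deriv h z) * t \<le> \<eta>"
    proof (rule bloch_le_of_energy[OF z _ \<eta>, folded t_def, where c = "(t / 2) powr p" and \<Omega> = "\<lambda>t. t powr p"])
      show "(t / 2) powr p > 0" using t by simp
      fix w assume "w \<in> ball z (t / 2)"
      then have "norm w \<le> norm z + t / 2"
        using norm_triangle_sub[of w z] by (simp add: dist_norm norm_minus_commute)
      then show "(t / 2) powr p \<le> (1 - norm w) powr p"
        using t p by (intro powr_mono2) (auto simp: t_def field_simps)
    next
      have "ball z (t / 2) \<subseteq> cball (cis (2 * pi * x)) (2 * t)"
      proof
        fix w assume "w \<in> ball z (t / 2)"
        then show "w \<in> cball (cis (2 * pi * x)) (2 * t)"
          using dist_triangle[of "cis (2 * pi * x)" w z] dz t by (simp add: dist_commute)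
      qed
      then have "powr_energy p (ball z (t / 2)) \<le> powr_energy p (cball (cis (2 * pi * x)) (2 * t))"
        by (intro nn_integral_mono) (auto split: split_indicator)
      also have "\<dots> \<le> ennreal (e * (2 * t) powr p)" using t by (intro \<delta>(2)) auto
      also have "e * (2 * t) powr p \<le> (t / 2) powr p * \<eta>\<^sup>2 / 64"
      proof -
        have "(2 * t) powr p = (4 * (t / 2)) powr p" by simp
        also have "\<dots> = 4 powr p * (t / 2) powr p" by (rule powr_mult)
        also have "\<dots> \<le> 4 powr 1 * (t / 2) powr p" using p by (intro mult_right_mono powr_mono) auto
        finally have "e * (2 * t) powr p \<le> e * (4 * (t / 2) powr p)" using e by (intro mult_left_mono) auto
        then show ?thesis by (simp add: e_def mult_ac)
      qed
      finally show "powr_energy p (ball z (t / 2)) \<le> ennreal ((t / 2) powr p * \<eta>\<^sup>2 / 64)"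
        by (simp add: ennreal_leI)
    qed
    then show "norm (deriv h z) * (1 - norm z) \<le> \<eta>" by (simp add: t_def)
  qed (use \<delta> in auto)
qed

end

section \<open>Part (i): sums over the dyadic subarcs of a short arc\<close>

context conformal_jordan
begin

lemma bend_le:
  assumes n: "n \<ge> 1"
    and small: "\<And>z. z \<in> ball 0 1 \<Longrightarrow> 1 - norm z \<le> 5 / 2 ^ n \<Longrightarrow> norm (deriv h z) * (1 - norm z) \<le> \<eta>"
    and \<eta>: "\<eta> \<le> 1/72" "\<eta> \<ge> 0" "48 * \<eta> \<le> \<epsilon> / 2" and \<epsilon>: "6 / 2 ^ n \<le> \<epsilon> / 2" and m: "n \<le> m"
  shows "bend m k \<le> \<epsilon>"
proof -
  have le: "c / 2 ^ m \<le> c / (2::real) ^ n" if "c \<ge> 0" for c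
    using m that by (intro divide_left_mono power_increasing) auto
  have "bend m k \<le> 6 / 2 ^ m + 48 * \<eta>"
    using n m le[of 5] by (intro bend_bounds(1) small \<eta>) auto
  also have "\<dots> \<le> 6 / 2 ^ n + 48 * \<eta>" using le[of 6] by simp
  finally show ?thesis using \<eta> \<epsilon> by linarith
qed

lemma suminf_descendants_weighted:
  "(\<Sum>j. \<Sum>i<2^j. dyadic_Delta \<Gamma> f (n + j, k * 2 ^ j + i) * ennreal (wt (n + j)))
    = Delta_sum wt n k"
  by (simp add: sum_distrib_left mult.commute)

text \<open>Three requirements on the generation meet: bends so small that the convolution with the
  chord decay converges, energy near the arc at most a small multiple of its length to the power p,
  and arcs so short that the curvature of the circle contributes little.\<close>

lemma Q_p0_dyadic_sum_small:
  assumes h: "h \<in> Q_p0 p" and p: "0 < p" "p < 1" and \<epsilon>: "\<epsilon> > 0"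
  obtains n4 where "\<And>n k. n4 \<le> n \<Longrightarrow> k < 2 ^ n \<Longrightarrow>
    ennreal (1 / (1 / 2 ^ n) powr p) * (\<Sum>j. \<Sum>i<2^j. dyadic_Delta \<Gamma> f (n + j, k * 2 ^ j + i) * ennreal ((1 / 2 ^ (n + j)) powr p)) \<le> ennreal \<epsilon>"
proof -
  define \<sigma> :: real where "\<sigma> = 2 powr p"
  have \<sigma>: "1 \<le> \<sigma>" "\<sigma> < 2"
    using p powr_less_mono[of p 1 "2::real"] by (auto simp: \<sigma>_def ge_one_powr_ge_zero)
  \<comment> \<open>Makes \<open>(1 + \<epsilon>0) / 2 * \<sigma>\<close> equal to 1/2 + \<sigma> /
    4, which is below 1 since \<sigma> < 2.\<close>
  define \<epsilon>0 where "\<epsilon>0 = (2 / \<sigma> - 1) / 2"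
  have \<epsilon>0: "\<epsilon>0 > 0" using \<sigma> by (simp add: \<epsilon>0_def)
  have q: "(1 + \<epsilon>0) / 2 * \<sigma> < 1" using \<sigma> by (simp add: \<epsilon>0_def field_simps)
  define \<eta> where "\<eta> = min (1/72) (\<epsilon>0 / 96)"
  have \<eta>: "0 < \<eta>" "\<eta> \<le> 1/72" "48 * \<eta> \<le> \<epsilon>0 / 2" using \<epsilon>0 by (auto simp: \<eta>_def)
  obtain n1 where n1: "fine_level n1" using ex_fine_level ..
  obtain \<delta>1 where \<delta>1: "\<delta>1 > 0" "\<And>z. z \<in> ball 0 1 \<Longrightarrow> 1 - norm z \<le> \<delta>1 \<Longrightarrow> norm (deriv h z) * (1 - norm z) \<le> \<eta>"
    by (rule Q_p0_little_bloch[OF h p \<eta>(1)]) blast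
  define C1 where "C1 = 1 / (1 - (1 + \<epsilon>0) / 2 * \<sigma>)"
  define C2 where "C2 = 640000000 / (2 - \<sigma>) * 1"
  have C: "C1 > 0" "C2 > 0" using q \<sigma> by (auto simp: C1_def C2_def)
  \<comment> \<open>Chosen so that \<open>C1 * C2 * 14 * e\<close> is half of \<epsilon>; the factor
    14 bounds \<open>14 powr p\<close>, from the radius of the ball in
    \<open>weighted_bend_energy_le\<close>.\<close>
  define e where "e = \<epsilon> / (28 * C1 * C2)"
  have e: "e > 0" using \<epsilon> C by (simp add: e_def)
  obtain \<delta>2 where \<delta>2: "\<delta>2 > 0" "\<And>x r. 0 < r \<Longrightarrow> r \<le> \<delta>2 \<Longrightarrow>
    powr_energy p (cball (cis (2 * pi * x)) r) \<le> ennreal (e * r powr p)"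
    by (rule Q_p0_cball_energy[OF h p(1) e]) blast
  \<comment> \<open>The last entry gives the other half of \<epsilon> to the curvature term
    \<open>C1 * (240 / 2 ^ n)\<close>; the others are the thresholds for small derivative, small
    energy and small bends.\<close>
  define d where "d = min (min (\<delta>1 / 5) (\<delta>2 / 14)) (min (\<epsilon>0 / 12) (\<epsilon> / (480 * C1)))"
  have d: "d > 0" using \<delta>1 \<delta>2 \<epsilon>0 \<epsilon> C by (auto simp: d_def)
  obtain n3 where n3: "(1/2) ^ n3 < d" using real_arch_pow_inv[of d "1/2"] d by auto
  show ?thesis
  proof (rule that[of "max (max 3 n1) n3"])
    fix n k :: nat assume n: "max (max 3 n1) n3 \<le> n" and k: "k < 2 ^ n"
    have "1 / 2 ^ n \<le> 1 / (2::real) ^ n3" using n by (intro divide_left_mono power_increasing) auto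
    also have "\<dots> < d" using n3 by (simp add: power_divide)
    finally have nd: "1 / 2 ^ n < d" .
    have n5: "5 / 2 ^ n \<le> \<delta>1" "14 / 2 ^ n \<le> \<delta>2" "6 / 2 ^ n \<le> \<epsilon>0 / 2" "C1 * (240 / 2 ^ n) \<le> \<epsilon> / 2"
    proof -
      have "1 / 2 ^ n \<le> \<delta>1 / 5" "1 / 2 ^ n \<le> \<delta>2 / 14" "1 / 2 ^ n \<le> \<epsilon>0 / 12" "1 / 2 ^ n \<le> \<epsilon> / (480 * C1)"
        using nd by (auto simp: d_def)
      then show "5 / 2 ^ n \<le> \<delta>1" "14 / 2 ^ n \<le> \<delta>2" "6 / 2 ^ n \<le> \<epsilon>0 / 2" "C1 * (240 / 2 ^ n) \<le> \<epsilon> / 2"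
        using C by (auto simp: field_simps)
    qed
    have small: "norm (deriv h z) * (1 - norm z) \<le> \<eta>" if "z \<in> ball 0 1" "1 - norm z \<le> 5 / 2 ^ n" for z
      using that n5(1) by (intro \<delta>1(2)) auto
    define wt where "wt m = (1 / 2 ^ m) powr p" for m :: nat
    have wt0: "0 \<le> wt m" for m by (simp add: wt_def)
    have wtS: "wt m \<le> \<sigma> * wt (Suc m)" for m
    proof -
      have "wt m = (2 * (1 / 2 ^ Suc m)) powr p" by (simp add: wt_def)
      also have "\<dots> = \<sigma> * wt (Suc m)" unfolding wt_def \<sigma>_def by (rule powr_mult)
      finally show ?thesis by simp
    qed
    have wtdec: "wt (n + j) \<le> wt n" for j
      unfolding wt_def using p by (intro powr_mono2 divide_left_mono power_increasing) auto
    have wtpos: "wt n > 0" by (simp add: wt_def)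
    have "Delta_sum wt n k
        \<le> ennreal C1 * bend_sum wt n k"
      unfolding C1_def
    proof (rule weighted_Delta_sum_le[OF n1])
      show "bend n' k' \<le> \<epsilon>0" if "n' \<ge> n" for n' k'
        using n \<eta> n5 that by (intro bend_le[of n \<eta>] small) auto
    qed (use n k wt0 wtS \<sigma> q in auto)
    also have "bend_sum wt n k \<le> ennreal (120 / 2 ^ n) * (\<Sum>j. ennreal (wt (n + j) / 2 ^ (n + j)))
      + ennreal C2 * powr_energy p (cball (mid n k) (14 / 2 ^ n))"
      unfolding C2_def
    proof (rule weighted_bend_energy_le[where \<Omega> = "\<lambda>t. t powr p" and \<eta> = \<eta>])
      fix N :: nat and t :: real assume "0 < t" "10 / 2 ^ Suc N < t"
      then have "1 / 2 ^ N \<le> t" by (simp add: field_simps)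
      then show "wt N \<le> 1 * t powr p" unfolding wt_def using p by (auto intro: powr_mono2)
    qed (use n k wt0 wtS \<sigma> \<eta> small in auto)
    also have "powr_energy p (cball (mid n k) (14 / 2 ^ n)) \<le> ennreal (14 * e * wt n)"
    proof -
      have "powr_energy p (cball (mid n k) (14 / 2 ^ n)) \<le> ennreal (e * (14 / 2 ^ n) powr p)"
        unfolding mid_cis by (rule \<delta>2(2)) (use n5 in auto)
      also have "(14 / 2 ^ n) powr p = 14 powr p * wt n"
        unfolding wt_def by (subst powr_mult[symmetric]) auto
      also have "ennreal (e * (14 powr p * wt n)) \<le> ennreal (e * (14 powr 1 * wt n))"
        using e p wt0[of n] by (intro ennreal_leI mult_left_mono mult_right_mono powr_mono) auto
      finally show ?thesis by (simp add: mult_ac)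
    qed
    also have "(\<Sum>j. ennreal (wt (n + j) / 2 ^ (n + j))) \<le> ennreal (2 * wt n)"
    proof -
      have "(\<Sum>j. ennreal (wt (n + j) / 2 ^ (n + j))) \<le> (\<Sum>j. ennreal (wt n * (1/2) ^ j))"
      proof (intro suminf_le allI ennreal_leI)
        fix j
        have "wt (n + j) / 2 ^ (n + j) \<le> wt n / 2 ^ j"
          using wt0 wtdec by (intro frac_le power_increasing) auto
        then show "wt (n + j) / 2 ^ (n + j) \<le> wt n * (1/2) ^ j" by (simp add: power_divide)
      qed auto
      also have "\<dots> = ennreal (wt n * 2)"
        using wt0[of n] sums_mult[OF geometric_sums[of "1/2::real"], of "wt n"] by (intro suminf_ennreal_eq) auto
      finally show ?thesis by (simp add: mult.commute)
    qed
    finally have "Delta_sum wt n k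
       \<le> ennreal C1 * (ennreal (120 / 2 ^ n) * ennreal (2 * wt n) + ennreal C2 * ennreal (14 * e * wt n))"
      by (simp add: add_mono mult_left_mono)
    also have "\<dots> = ennreal (C1 * (120 / 2 ^ n * (2 * wt n) + C2 * (14 * e * wt n)))"
      using C e wt0[of n] by (simp add: ennreal_mult[symmetric] ennreal_plus[symmetric] del: ennreal_plus)
    also have "C1 * (120 / 2 ^ n * (2 * wt n) + C2 * (14 * e * wt n)) = (C1 * (240 / 2 ^ n) + \<epsilon> / 2) * wt n"
      using C by (simp add: e_def field_simps)
    also have "\<dots> \<le> \<epsilon> * wt n" using n5(4) wt0[of n] by (intro mult_right_mono) auto
    finally have "(\<Sum>j. \<Sum>i<2^j. dyadic_Delta \<Gamma> f (n + j, k * 2 ^ j + i) * ennreal (wt (n + j))) \<le> ennreal (\<epsilon> * wt n)"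
      unfolding suminf_descendants_weighted by (simp add: ennreal_leI)
    then have "ennreal (1 / wt n) * (\<Sum>j. \<Sum>i<2^j. dyadic_Delta \<Gamma> f (n + j, k * 2 ^ j + i) * ennreal (wt (n + j))) \<le> ennreal (1 / wt n) * ennreal (\<epsilon> * wt n)"
      by (rule mult_left_mono) simp
    also have "\<dots> = ennreal \<epsilon>" using \<epsilon> wtpos by (subst ennreal_mult[symmetric]) auto
    finally show "ennreal (1 / (1 / 2 ^ n) powr p) * (\<Sum>j. \<Sum>i<2^j. dyadic_Delta \<Gamma> f (n + j, k * 2 ^ j + i) * ennreal ((1 / 2 ^ (n + j)) powr p)) \<le> ennreal \<epsilon>"
      unfolding wt_def .
  qed
qed

lemma Q_p0_dyadic_limit:
  assumes h: "h \<in> Q_p0 p" and p: "0 < p" "p < 1"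
  shows "((\<lambda>\<delta>::real. SUP J\<in>{J \<in> dyadic_indices. dyadic_length J \<le> \<delta>}.
                ennreal (1 / dyadic_length J powr p) *
                (\<Sum>\<^sub>\<infinity>I\<in>{I \<in> dyadic_indices. dyadic_arc I \<subseteq> dyadic_arc J}.
                   dyadic_Delta \<Gamma> f I * ennreal (dyadic_length I powr p)))
              \<longlongrightarrow> 0) (at_right 0)" (is "((\<lambda>\<delta>. SUP J\<in>?A \<delta>. ?F J) \<longlongrightarrow> 0) _")
proof (rule order_tendstoI)
  fix a :: ennreal assume "0 < a"
  then obtain \<epsilon> where \<epsilon>: "\<epsilon> > 0" "ennreal \<epsilon> < a"
  proof (cases a)
    case (real r)
    then show ?thesis using \<open>0 < a\<close> by (intro that[of "r / 2"]) (auto simp: ennreal_less_iff)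
  next
    case top
    then show ?thesis by (intro that[of 1]) auto
  qed
  obtain n4 where n4: "\<And>n k. n4 \<le> n \<Longrightarrow> k < 2 ^ n \<Longrightarrow>
    ennreal (1 / (1 / 2 ^ n) powr p) * (\<Sum>j. \<Sum>i<2^j. dyadic_Delta \<Gamma> f (n + j, k * 2 ^ j + i) * ennreal ((1 / 2 ^ (n + j)) powr p)) \<le> ennreal \<epsilon>"
    by (rule Q_p0_dyadic_sum_small[OF h p \<epsilon>(1)]) blast
  have "(SUP J\<in>?A \<delta>. ?F J) < a"
    if \<delta>: "0 < \<delta>" "\<delta> < 1 / 2 ^ n4" for \<delta>
  proof (rule le_less_trans[OF SUP_least \<epsilon>(2)], clarify)
    fix n k assume nk: "(n, k) \<in> dyadic_indices" and len: "dyadic_length (n, k) \<le> \<delta>"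
    have "1 / 2 ^ n < 1 / (2::real) ^ n4" using len \<delta> by (simp add: dyadic_length_def)
    then have "(2::real) ^ n4 < 2 ^ n" by (simp add: divide_less_cancel field_simps)
    then have nn: "n4 \<le> n" by simp
    have "(\<Sum>\<^sub>\<infinity>I\<in>{I \<in> dyadic_indices. dyadic_arc I \<subseteq> dyadic_arc (n, k)}. dyadic_Delta \<Gamma> f I * ennreal (dyadic_length I powr p))
        \<le> (\<Sum>j. \<Sum>i<2^j. dyadic_Delta \<Gamma> f (n + j, k * 2 ^ j + i) * ennreal (dyadic_length (n + j, k * 2 ^ j + i) powr p))"
      using dyadic_subarc_descendant[OF nk] by (intro infsum_ennreal_le sum_descendants_le) auto
    also have "\<dots> = (\<Sum>j. \<Sum>i<2^j. dyadic_Delta \<Gamma> f (n + j, k * 2 ^ j + i) * ennreal ((1 / 2 ^ (n + j)) powr p))"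
      by (simp add: dyadic_length_def)
    finally have "?F (n, k)
      \<le> ennreal (1 / (1 / 2 ^ n) powr p) * (\<Sum>j. \<Sum>i<2^j. dyadic_Delta \<Gamma> f (n + j, k * 2 ^ j + i) * ennreal ((1 / 2 ^ (n + j)) powr p))"
      unfolding dyadic_length_def by (simp add: mult_left_mono)
    also have "\<dots> \<le> ennreal \<epsilon>" using nk by (intro n4 nn) (auto simp: dyadic_indices_def)
    finally show "?F (n, k) \<le> ennreal \<epsilon>" .
  qed
  then show "\<forall>\<^sub>F \<delta> in at_right 0. (SUP J\<in>?A \<delta>. ?F J) < a"
    unfolding eventually_at_right_field by (intro exI[of _ "1 / 2 ^ n4"]) auto
qed simp

end

section \<open>Logarithmic weights and the class D_log\<close>

lemma log_power_nonneg: "0 \<le> log_power p x"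
  by (simp add: log_power_def)

lemma log_power_mono:
  assumes "0 \<le> p" "1 \<le> x" "x \<le> y"
  shows "log_power p x \<le> log_power p y"
  using assms by (auto simp: log_power_def intro!: powr_mono2)

lemma measurable_log_power [measurable]: "(\<lambda>t. log_power p (1 / t)) \<in> borel_measurable borel"
  unfolding log_power_def by (cases "p = 0") simp_all

text \<open>An exponential with base 3/2 dominates every power of n and leaves the ratio 3/4. The
  series is the curvature term of \<open>weighted_bend_energy_le\<close> for the logarithmic
  weight.\<close>

lemma summable_log_power: "summable (\<lambda>n. log_power p (2 ^ n) / 2 ^ n)"
proof (rule summable_comparison_test_ev)
  have "\<forall>\<^sub>F n in sequentially. log_power p (2 ^ n) \<le> (3/2) ^ n"
  proof (cases "p = 0")
    case True
    then show ?thesis by (simp add: log_power_def one_le_power)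
  next
    case False
    have "\<forall>\<^sub>F n in sequentially. (real n * ln 2) powr p \<le> (3/2) ^ n"
      by real_asymp
    then show ?thesis using False by (simp add: log_power_def ln_realpow)
  qed
  then show "\<forall>\<^sub>F n in sequentially. norm (log_power p (2 ^ n) / 2 ^ n) \<le> (3/4) ^ n"
  proof eventually_elim
    case (elim n)
    have "log_power p (2 ^ n) / 2 ^ n \<le> (3/2) ^ n / 2 ^ n" using elim by (intro divide_right_mono) auto
    also have "\<dots> = (3/4) ^ n" by (simp add: power_divide[symmetric])
    finally show ?case by (simp add: log_power_nonneg)
  qed
qed simp

context conformal_log
begin

abbreviation log_energy :: "real \<Rightarrow> complex set \<Rightarrow> ennreal" where
  "log_energy p \<equiv> weighted_energy (\<lambda>t. log_power p (1 / t))"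

lemma D_log_energy:
  assumes "h \<in> D_log p"
  shows "log_energy p UNIV < \<infinity>"
proof -
  have "log_energy p UNIV
      = (\<integral>\<^sup>+ z\<in>ball 0 1. ennreal ((norm (deriv h z))\<^sup>2 * log_power p (1 / (1 - norm z))) \<partial>lborel)"
    by (intro nn_integral_cong) (auto simp: energy_def ennreal_mult log_power_nonneg split: split_indicator)
  then show ?thesis using assms by (simp add: D_log_def)
qed

text \<open>The collars of width 1 / (m + 1) shrink to nothing inside the disc and the total energy
  is finite, so their energies decrease to 0. This provides the local smallness that
  \<open>Q_p0\<close> has by definition.\<close>

lemma D_log_tail:
  assumes h: "h \<in> D_log p" and e: "e > 0"
  obtains \<delta> where "\<delta> > 0" "log_energy p {w. 1 - norm w \<le> \<delta>} \<le> ennreal e"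
proof -
  define \<psi> where "\<psi> m w = energy w * ennreal (log_power p (1 / (1 - norm w))) * indicator {w. 1 - norm w \<le> 1 / real (Suc m)} w" for m w
  have "(\<integral>\<^sup>+ w. (INF m. \<psi> m w) \<partial>lborel) = (INF m. \<integral>\<^sup>+ w. \<psi> m w \<partial>lborel)"
  proof (rule nn_integral_monotone_convergence_INF_decseq)
    show "decseq \<psi>"
    proof (intro decseq_SucI le_funI)
      fix m w
      have "1 / real (Suc (Suc m)) \<le> 1 / real (Suc m)" by (intro divide_left_mono) auto
      then show "\<psi> (Suc m) w \<le> \<psi> m w"
        unfolding \<psi>_def by (intro mult_left_mono) (auto split: split_indicator)
    qed
    show "\<psi> m \<in> borel_measurable lborel" for m unfolding \<psi>_def by measurable
    have "(\<integral>\<^sup>+ w. \<psi> 0 w \<partial>lborel) \<le> log_energy p UNIV"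
      unfolding \<psi>_def by (intro nn_integral_mono) (auto split: split_indicator)
    then show "(\<integral>\<^sup>+ w. \<psi> 0 w \<partial>lborel) < \<infinity>" using D_log_energy[OF h] by (rule le_less_trans)
  qed
  moreover have "(INF m. \<psi> m w) = 0" for w
  proof (cases "w \<in> ball 0 1")
    case True
    then obtain m where "inverse (real (Suc m)) < 1 - norm w" using reals_Archimedean[of "1 - norm w"] by auto
    then have "\<psi> m w = 0" by (simp add: \<psi>_def inverse_eq_divide)
    then have "(INF m. \<psi> m w) \<le> 0" by (metis INF_lower UNIV_I)
    then show ?thesis by simp
  qed (simp add: \<psi>_def energy_def)
  ultimately have "(INF m. \<integral>\<^sup>+ w. \<psi> m w \<partial>lborel) < ennreal e" using e by simp
  then obtain m where "(\<integral>\<^sup>+ w. \<psi> m w \<partial>lborel) < ennreal e" by (auto simp: INF_less_iff)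
  then show ?thesis
    by (intro that[of "1 / real (Suc m)"]) (auto simp: \<psi>_def)
qed

lemma D_log_little_bloch:
  assumes h: "h \<in> D_log p" and p: "0 \<le> p" and \<eta>: "\<eta> > 0"
  obtains \<delta> where "\<delta> > 0" "\<And>z. z \<in> ball 0 1 \<Longrightarrow> 1 - norm z \<le> \<delta> \<Longrightarrow> norm (deriv h z) * (1 - norm z) \<le> \<eta>"
proof -
  \<comment> \<open>Up to height 1/2 the weight is at least its value for 2, which is positive. The
    bound 1/4 for the height of \<open>z\<close> below keeps the whole disc around \<open>z\<close>
    in that range.\<close>
  define c where "c = log_power p 2"
  have c: "c > 0" by (simp add: c_def log_power_def)
  then have "c * \<eta>\<^sup>2 / 64 > 0" using \<eta> by simp
  from D_log_tail[OF h this] obtain \<delta> where \<delta>: "\<delta> > 0" "log_energy p {w. 1 - norm w \<le> \<delta>} \<le> ennreal (c * \<eta>\<^sup>2 / 64)"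
    by blast
  show ?thesis
  proof (rule that[of "min (\<delta> / 2) (1/4)"])
    fix z :: complex assume z: "z \<in> ball 0 1" and zd: "1 - norm z \<le> min (\<delta> / 2) (1/4)"
    have w: "1 - norm w \<le> \<delta>" "1 - norm w \<le> 1/2" "0 < 1 - norm w" if "w \<in> ball z ((1 - norm z) / 2)" for w
    proof -
      have "\<bar>norm z - norm w\<bar> < (1 - norm z) / 2"
        using that norm_triangle_ineq3[of z w] by (simp add: dist_norm)
      moreover have "2 * (1 - norm z) \<le> \<delta>" "2 * (1 - norm z) \<le> 1/2" "0 < 1 - norm z" using zd z by auto
      ultimately show "1 - norm w \<le> \<delta>" "1 - norm w \<le> 1/2" "0 < 1 - norm w" by argo+
    qed
    show "norm (deriv h z) * (1 - norm z) \<le> \<eta>"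
    proof (rule bloch_le_of_energy[OF z c \<eta>, where \<Omega> = "\<lambda>t. log_power p (1 / t)"])
      fix w assume "w \<in> ball z ((1 - norm z) / 2)"
      then have "1 - norm w \<le> 1/2" "0 < 1 - norm w" by (rule w)+
      then have "2 \<le> 1 / (1 - norm w)" by (simp add: pos_le_divide_eq)
      then show "c \<le> log_power p (1 / (1 - norm w))" unfolding c_def using p by (intro log_power_mono) auto
    next
      have "log_energy p (ball z ((1 - norm z) / 2)) \<le> log_energy p {w. 1 - norm w \<le> \<delta>}"
        using w(1) by (intro nn_integral_mono) (auto split: split_indicator)
      then show "log_energy p (ball z ((1 - norm z) / 2)) \<le> ennreal (c * \<eta>\<^sup>2 / 64)"
        using \<delta>(2) by (rule order_trans)
    qed
  qed (use \<delta> in auto)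
qed

end

section \<open>Part (ii): finite total length and the logarithmic sum\<close>

context conformal_jordan
begin

text \<open>Serves the finitely many arcs of generations below n, where either subarc may be the
  smaller one and only finiteness is wanted. The curve is traversed twice to fill the window from 0
  to 2 of \<open>subarc_length_le_total\<close>.\<close>

lemma length_le_total:
  assumes n: "n \<ge> 1" and bend: "\<And>n' k. n' \<ge> n \<Longrightarrow> bend n' k \<le> \<epsilon>"
    and X: "\<And>k. k < 2 ^ n \<Longrightarrow> (\<Sum>l. ennreal (((1 + \<epsilon>) / 2) ^ l) * bend_energy n k l) < \<infinity>"
  obtains S where "0 \<le> S" "length_le 0 2 S"
proof -
  define X' where "X' k = enn2real (\<Sum>l. ennreal (((1 + \<epsilon>) / 2) ^ l) * bend_energy n k l)" for k
  have X': "(\<Sum>l. ennreal (((1 + \<epsilon>) / 2) ^ l) * bend_energy n k l) \<le> ennreal (X' k)" "0 \<le> X' k" if "k < 2 ^ n" for k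
    using X[OF that] by (auto simp: X'_def)
  define S where "S = (\<Sum>k<2^n. chord n k * (1 + X' k))"
  have S: "(\<Sum>l<2 ^ (n + j). chord (n + j) l) \<le> S" for j
  proof -
    have "(\<Sum>l<2 ^ (n + j). chord (n + j) l) = (\<Sum>k<2^n. \<Sum>i<2^j. chord (n + j) (k * 2 ^ j + i))"
      by (simp add: sum_nested_lessThan power_add)
    also have "\<dots> \<le> S" unfolding S_def by (intro sum_mono sum_chord_le[OF n bend X']) auto
    finally show ?thesis .
  qed
  have per: "chord m (l + 2 ^ m) = chord m l" for m l
  proof -
    have "real (l + 2 ^ m) / 2 ^ m = real l / 2 ^ m + of_int 1" "real (Suc (l + 2 ^ m)) / 2 ^ m = real (Suc l) / 2 ^ m + of_int 1"
      by (simp_all add: field_simps)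
    then show ?thesis unfolding chord_\<gamma> by (simp only: \<gamma>_add_int)
  qed
  have "length_le (real 0 / 2 ^ n) (real (2 * 2 ^ n) / 2 ^ n) (2 * S)"
    unfolding length_le_def
  proof (intro allI impI, elim conjE)
    fix N :: nat and \<tau> :: "nat \<Rightarrow> real"
    assume \<tau>: "mono_on {..N} \<tau>" "\<tau> ` {..N} \<subseteq> {real 0 / 2 ^ n..real (2 * 2 ^ n) / 2 ^ n}"
    show "(\<Sum>i<N. dist (\<gamma> (\<tau> i)) (\<gamma> (\<tau> (Suc i)))) \<le> 2 * S"
    proof (rule dyadic_partition_sum_le[OF continuous_\<gamma> _ \<tau>])
      fix j
      have "(\<Sum>l\<in>{0 * 2 ^ j..<2 * 2 ^ n * 2 ^ j}. dist (\<gamma> (real l / 2 ^ (n + j))) (\<gamma> (real (Suc l) / 2 ^ (n + j))))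
          = (\<Sum>l<2 * 2 ^ (n + j). chord (n + j) l)"
        by (simp only: chord_\<gamma>) (simp add: power_add lessThan_atLeast0 mult.assoc)
      also have "\<dots> = (\<Sum>a<2. \<Sum>l<2 ^ (n + j). chord (n + j) (a * 2 ^ (n + j) + l))"
        by (rule sum_nested_lessThan[symmetric])
      also have "\<dots> = 2 * (\<Sum>l<2 ^ (n + j). chord (n + j) l)"
        using per[of "n + j"] by (simp add: numeral_2_eq_2 add.commute)
      finally show "(\<Sum>l\<in>{0 * 2 ^ j..<2 * 2 ^ n * 2 ^ j}. dist (\<gamma> (real l / 2 ^ (n + j))) (\<gamma> (real (Suc l) / 2 ^ (n + j)))) \<le> 2 * S"
        using S[of j] by simp
    qed
  qed
  then have "length_le 0 2 (2 * S)" by simp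
  moreover have "0 \<le> S" unfolding S_def by (intro sum_nonneg mult_nonneg_nonneg) (auto simp: chord_def X')
  ultimately show ?thesis by (intro that[of "2 * S"]) auto
qed

lemma dyadic_Delta_finite:
  assumes S: "0 \<le> S" "length_le 0 2 S" and n: "n \<ge> 1" and k: "k < 2 ^ n"
  shows "dyadic_Delta \<Gamma> f (n, k) < \<infinity>"
proof -
  have c: "chord n k > 0" by (rule chord_pos[OF n])
  have "real (Suc k) \<le> real (2 ^ n)" using k by (simp only: of_nat_le_iff Suc_le_eq)
  moreover have "(2::real) ^ 1 \<le> 2 ^ n" using n by (intro power_increasing) auto
  ultimately have "subarc_length \<Gamma> (\<gamma> (real k / 2 ^ n)) (\<gamma> (real (Suc k) / 2 ^ n)) \<le> ennreal S"
    by (intro subarc_length_le_total S) (auto simp: field_simps)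
  then have "subarc_length \<Gamma> (\<gamma> (real k / 2 ^ n)) (\<gamma> (real (Suc k) / 2 ^ n)) - ennreal (chord n k) \<le> ennreal S"
    using diff_le_self_ennreal order_trans by blast
  then have "dyadic_Delta \<Gamma> f (n, k) \<le> ennreal S / ennreal (chord n k)"
    unfolding dyadic_Delta_eq by (rule divide_right_mono_ennreal)
  also have "\<dots> = ennreal (S / chord n k)" using c S by (subst divide_ennreal) auto
  also have "\<dots> < \<infinity>" by simp
  finally show ?thesis .
qed

text \<open>Logarithmic weights increase with the generation, so \<sigma> = 1 and bends up to 1/2
  are good enough: chords then decay like (3/4)^l. One generation n is fixed; the families below its
  2^n arcs are estimated, and the coarser arcs are added as a finite sum of finite terms.\<close>

lemma D_log_dyadic_sum_finite:
  assumes h: "h \<in> D_log p" and p: "0 \<le> p"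
  shows "(\<Sum>\<^sub>\<infinity>I\<in>dyadic_indices. dyadic_Delta \<Gamma> f I * ennreal (log_power p (1 / dyadic_length I))) < \<infinity>"
proof -
  define wt where "wt m = log_power p (2 ^ m)" for m :: nat
  define \<Omega> where "\<Omega> t = log_power p (1 / t)" for t :: real
  \<comment> \<open>If \<open>t \<le> 10 / 2 ^ N\<close> and \<open>2 ^ N \<ge> 100\<close>, then
    \<open>ln (2 ^ N) \<le> 2 * ln (1 / t)\<close>; the power p of that 2 is the factor
    needed.\<close>
  define K where "K = (2::real) powr p"
  obtain n1 where n1: "fine_level n1" using ex_fine_level ..
  obtain \<delta> where \<delta>: "\<delta> > 0" "\<And>z. z \<in> ball 0 1 \<Longrightarrow> 1 - norm z \<le> \<delta> \<Longrightarrow> norm (deriv h z) * (1 - norm z) \<le> 1/192"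
    by (rule D_log_little_bloch[OF h p, of "1/192"]) auto
  obtain n3 where n3: "(1/2) ^ n3 < \<delta> / 5" using real_arch_pow_inv[of "\<delta> / 5" "1/2"] \<delta>(1) by auto
  \<comment> \<open>128 = 2^7 exceeds the 100 of the weight comparison and makes
    \<open>6 / 2 ^ n\<close> at most 1/4.\<close>
  define n where "n = max (max 7 n1) n3"
  have n: "7 \<le> n" "n1 \<le> n" "n3 \<le> n" by (auto simp: n_def)
  have "1 / 2 ^ n \<le> 1 / (2::real) ^ n3" using n by (intro divide_left_mono power_increasing) auto
  then have "5 / 2 ^ n \<le> \<delta>" using n3 by (simp add: power_divide)
  then have small: "norm (deriv h z) * (1 - norm z) \<le> 1/192" if "z \<in> ball 0 1" "1 - norm z \<le> 5 / 2 ^ n" for z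
    using that by (intro \<delta>(2)) auto
  have p7: "(128::real) \<le> 2 ^ N" if "7 \<le> N" for N
    using power_increasing[OF that, of "2::real"] by simp
  have bend: "bend m k \<le> 1/2" if "n \<le> m" for m k
    using n p7[OF n(1)] that by (intro bend_le[of n "1/192"] small) (auto simp: field_simps)
  have wt0: "0 \<le> wt m" for m by (simp add: wt_def log_power_nonneg)
  have wtmono: "wt m \<le> wt m'" if "m \<le> m'" for m m'
    unfolding wt_def using p that by (intro log_power_mono one_le_power power_increasing) auto
  have wtpos: "wt n > 0"
    using p7[OF n(1)] by (simp add: wt_def log_power_def)
  have wt\<Omega>: "wt N \<le> K * \<Omega> t" if "n \<le> N" "0 < t" "t \<le> 10 / 2 ^ N" for N t
  proof (cases "p = 0")
    case False
    have N: "(128::real) \<le> 2 ^ N" using that n by (intro p7) auto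
    have "2 ^ N / 10 \<le> 1 / t" using that by (simp add: field_simps)
    then have "(2 ^ N / 10)\<^sup>2 \<le> (1 / t)\<^sup>2" by (intro power_mono) auto
    moreover have "(2::real) ^ N * 1 \<le> 2 ^ N * (2 ^ N / 100)" using N by (intro mult_left_mono) auto
    moreover have "(2::real) ^ N * (2 ^ N / 100) = (2 ^ N / 10)\<^sup>2" by (simp add: power2_eq_square)
    ultimately have "2 ^ N \<le> (1 / t)\<^sup>2" by linarith
    then have "ln (2 ^ N) \<le> ln ((1 / t)\<^sup>2)" using that by (subst ln_le_cancel_iff) auto
    also have "\<dots> = 2 * ln (1 / t)" using that by (simp add: ln_realpow)
    finally have l: "ln (2 ^ N) \<le> 2 * ln (1 / t)" .
    have "ln (2 ^ N) powr p \<le> (2 * ln (1 / t)) powr p"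
      using l N p by (intro powr_mono2) auto
    also have "\<dots> = K * ln (1 / t) powr p" unfolding K_def by (rule powr_mult)
    finally show ?thesis using False by (simp add: wt_def \<Omega>_def log_power_def)
  qed (simp add: wt_def \<Omega>_def log_power_def K_def)
  have S: "bend_sum wt n k < \<infinity>" if k: "k < 2 ^ n" for k
  proof -
    have 1: "bend_sum wt n k \<le> ennreal (120 / 2 ^ n) * (\<Sum>j. ennreal (wt (n + j) / 2 ^ (n + j)))
      + ennreal (640000000 / (2 - 1) * K) * weighted_energy \<Omega> (cball (mid n k) (14 / 2 ^ n))"
    proof (rule weighted_bend_energy_le[where \<Omega> = \<Omega> and \<eta> = "1/192"])
      show "\<Omega> \<in> borel_measurable borel" unfolding \<Omega>_def by measurable
      show "wt m \<le> 1 * wt (Suc m)" for m using wtmono[of m "Suc m"] by simp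
    qed (use n k wt0 small wt\<Omega> in \<open>auto simp: K_def\<close>)
    have 2: "(\<Sum>j. ennreal (wt (n + j) / 2 ^ (n + j))) < \<infinity>"
    proof -
      have "summable (\<lambda>j. wt (j + n) / 2 ^ (j + n))"
        using summable_log_power[of p] by (subst summable_iff_shift) (simp add: wt_def)
      then show ?thesis
        using wt0 by (subst suminf_ennreal2) (auto simp: add.commute)
    qed
    have 3: "weighted_energy \<Omega> (cball (mid n k) (14 / 2 ^ n)) < \<infinity>"
    proof -
      have "weighted_energy \<Omega> (cball (mid n k) (14 / 2 ^ n)) \<le> weighted_energy \<Omega> UNIV"
        by (intro nn_integral_mono) (auto split: split_indicator)
      also have "\<dots> < \<infinity>" unfolding \<Omega>_def by (rule D_log_energy[OF h])
      finally show ?thesis .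
    qed
    show ?thesis using 2 3 by (intro le_less_trans[OF 1]) (simp add: ennreal_mult_less_top)
  qed
  define V where "V k = (\<Sum>j. \<Sum>i<2^j. dyadic_Delta \<Gamma> f (n + j, k * 2 ^ j + i) * ennreal (wt (n + j)))" for k
  have V: "V k < \<infinity>" if k: "k < 2 ^ n" for k
  proof -
    have "V k \<le> ennreal (1 / (1 - (1 + 1/2) / 2 * 1)) * bend_sum wt n k"
      unfolding V_def suminf_descendants_weighted
    proof (rule weighted_Delta_sum_le[OF n1])
      show "wt m \<le> 1 * wt (Suc m)" for m using wtmono[of m "Suc m"] by simp
    qed (use n k wt0 bend in auto)
    also have "\<dots> < \<infinity>" using S[OF k] by (simp add: ennreal_mult_less_top)
    finally show ?thesis .
  qed
  \<comment> \<open>From generation n on the weights are at least \<open>wt n > 0\<close>, so the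
    sum without weights, which controls the total length, is finite too.\<close>
  have X: "(\<Sum>l. ennreal (((1 + 1/2) / 2) ^ l) * bend_energy n k l) < \<infinity>" if k: "k < 2 ^ n" for k
  proof -
    have "(\<Sum>l. ennreal (((1 + 1/2) / 2) ^ l) * bend_energy n k l) \<le> (\<Sum>l. ennreal (1 / wt n) * (ennreal (wt (n + l)) * bend_energy n k l))"
    proof (intro suminf_le allI)
      fix l
      have "((1 + 1/2) / 2) ^ l \<le> (1::real)" by (intro power_le_one) auto
      also have "1 \<le> 1 / wt n * wt (n + l)" using wtpos wtmono[of n "n + l"] by simp
      finally have "ennreal (((1 + 1/2) / 2) ^ l) * bend_energy n k l \<le> ennreal (1 / wt n * wt (n + l)) * bend_energy n k l"
        by (intro mult_right_mono ennreal_leI) auto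
      also have "\<dots> = ennreal (1 / wt n) * (ennreal (wt (n + l)) * bend_energy n k l)"
        using wtpos wt0 by (subst ennreal_mult) (auto simp: mult.assoc)
      finally show "ennreal (((1 + 1/2) / 2) ^ l) * bend_energy n k l \<le> ennreal (1 / wt n) * (ennreal (wt (n + l)) * bend_energy n k l)" .
    qed auto
    also have "\<dots> < \<infinity>" using S[OF k] by (simp add: ennreal_mult_less_top)
    finally show ?thesis .
  qed
  obtain L where L: "0 \<le> L" "length_le 0 2 L"
    using length_le_total[of n "1/2"] n bend X by auto
  define G where "G = (\<lambda>I. dyadic_Delta \<Gamma> f I * ennreal (log_power p (1 / dyadic_length I)))"
  \<comment> \<open>The generations too coarse for the bend estimate.\<close>
  define A where "A = (SIGMA m:{1..<n}. {..<(2::nat)^m})"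
  have finA: "finite A" unfolding A_def by (intro finite_SigmaI) auto
  have "infsum G dyadic_indices \<le> sum G A + (\<Sum>k<2^n. V k)"
  proof (rule infsum_ennreal_le)
    fix F assume F: "finite F" "F \<subseteq> dyadic_indices"
    have "sum G F = sum G (F \<inter> A) + sum G (F - A)"
      using F(1) by (metis sum.Int_Diff)
    also have "sum G (F \<inter> A) \<le> sum G A" using finA by (intro sum_mono2) auto
    also have "sum G (F - A) \<le> (\<Sum>x\<in>F - A. \<Sum>k<2^n. if x \<in> descendants n k then G x else 0)"
    proof (rule sum_mono)
      fix x assume x: "x \<in> F - A"
      obtain m l where ml: "x = (m, l)" by (cases x)
      with x F(2) have m: "1 \<le> m" "l < 2 ^ m" "n \<le> m" by (auto simp: dyadic_indices_def A_def)
      define j where "j = m - n"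
      have mj: "m = n + j" using m by (simp add: j_def)
      \<comment> \<open>Integer division finds the ancestor of \<open>(m, l)\<close> in generation
        \<open>n\<close>; the remainder is its position among the descendants.\<close>
      define k where "k = l div 2 ^ j"
      have k: "k < 2 ^ n" unfolding k_def using m(2) by (intro less_mult_imp_div_less) (simp add: mj power_add)
      have "l = k * 2 ^ j + l mod 2 ^ j" unfolding k_def by (rule div_mult_mod_eq[symmetric])
      moreover have "l mod 2 ^ j < 2 ^ j" by simp
      ultimately have "x \<in> descendants n k" unfolding ml mj descendants_def by blast
      then show "G x \<le> (\<Sum>k<2^n. if x \<in> descendants n k then G x else 0)"
        using member_le_sum[of k "{..<2^n}" "\<lambda>k. if x \<in> descendants n k then G x else 0"] k by auto
    qed
    also have "\<dots> = (\<Sum>k<2^n. sum G ((F - A) \<inter> descendants n k))"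
      using F(1) by (subst sum.swap) (simp add: sum.inter_restrict)
    also have "\<dots> \<le> (\<Sum>k<2^n. V k)"
    proof (rule sum_mono)
      fix k
      have "sum G ((F - A) \<inter> descendants n k) \<le> (\<Sum>j. \<Sum>i<2^j. G (n + j, k * 2 ^ j + i))"
        using F(1) by (intro sum_descendants_le) auto
      also have "\<dots> = V k" by (simp add: V_def G_def wt_def dyadic_length_def)
      finally show "sum G ((F - A) \<inter> descendants n k) \<le> V k" .
    qed
    finally show "sum G F \<le> sum G A + (\<Sum>k<2^n. V k)" by (simp add: add_mono)
  qed
  also have "\<dots> < \<infinity>"
  proof -
    have "G x < \<infinity>" if "x \<in> A" for x
      using that dyadic_Delta_finite[OF L] by (auto simp: A_def G_def ennreal_mult_less_top)
    then show ?thesis using V finA by auto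
  qed
  finally show ?thesis unfolding G_def .
qed

end

theorem corollary1:
  fixes \<Gamma> :: "complex set" and f h :: "complex \<Rightarrow> complex"
  assumes "closed_jordan_curve \<Gamma>"
    and "conformal_onto_inside f \<Gamma>"
    and "log_deriv_branch f h"
  shows "(\<forall>p::real. 0 < p \<and> p < 1 \<and> h \<in> Q_p0 p \<longrightarrow>
            ((\<lambda>\<delta>::real. SUP J\<in>{J \<in> dyadic_indices. dyadic_length J \<le> \<delta>}.
                ennreal (1 / dyadic_length J powr p) *
                (\<Sum>\<^sub>\<infinity>I\<in>{I \<in> dyadic_indices. dyadic_arc I \<subseteq> dyadic_arc J}.
                   dyadic_Delta \<Gamma> f I * ennreal (dyadic_length I powr p)))
              \<longlongrightarrow> 0) (at_right 0))
       \<and> (\<forall>p::real. 0 \<le> p \<and> h \<in> D_log p \<longrightarrow>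
            (\<Sum>\<^sub>\<infinity>I\<in>dyadic_indices.
               dyadic_Delta \<Gamma> f I * ennreal (log_power p (1 / dyadic_length I))) < \<infinity>)"
proof -
  note ext = conformal_onto_inside_sphere[OF assms(1,2)]
  interpret conformal_jordan \<Gamma> f h
  proof
    show "f holomorphic_on ball 0 1" using assms(2) by (simp add: conformal_onto_inside_def)
    show "continuous_on (cball 0 1) f" "inj_on f (cball 0 1)" "f ` sphere 0 1 = \<Gamma>" by (fact ext)+
    show "h holomorphic_on ball 0 1" "\<And>z. z \<in> ball 0 1 \<Longrightarrow> exp (h z) = deriv f z"
      using assms(3) by (auto simp: log_deriv_branch_def)
    show "continuous_on (sphere 0 1) f" "inj_on f (sphere 0 1)"
      using continuous_on_subset[OF ext(1)] inj_on_subset[OF ext(2)] by auto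
  qed
  show ?thesis
    using Q_p0_dyadic_limit D_log_dyadic_sum_finite by blast
qed

end
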